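(* Let $G$ be a $2$-connected multigraph and let $H$ be a $2$-connected multigraph which is a minor of $G$. If $H$ admits a $d$-dimensional injective super stable tensegrity realization which has a non-splittable equilibrium stress, then $G$ admits a $d$-dimensional injective super stable tensegrity realization.
   Context: A multigraph is a finite undirected graph that may contain parallel edges but no loops. A tensegrity realization of $G$ in $\mathbb{R}^d$ is $(G,\sigma,p)$ with $\sigma:E(G)\to\{+,-\}$ and $p:V(G)\to\mathbb{R}^d$; it is injective if $p$ is injective. With $V(G)=\{1,\dots,n\}$ and standard basis $\mathbf{e}_i$, for $\omega:E(G)\to\mathbb{R}$ put $L_{G,\omega}=\sum_{e\in E(G)}\omega(e)(\mathbf{e}_i-\mathbf{e}_j)(\mathbf{e}_i-\mathbf{e}_j)^\top$ ($i,j$ endpoints of $e$). $\omega$ is an equilibrium stress of $(G,\sigma,p)$ if $\sum_{e \text{ joins } i,j}\omega(e)(p(j)-p(i))=0$ for every vertex $i$, strictly proper if $\sigma(e)\omega(e)>0$ for all $e$. An equilibrium stress $\omega$ is splittable at a vertex $v$ if there is a nonempty proper subset $F$ of the set $E_G(v)$ of edges incident to $v$ with $\sum_{f\in F,\ f \text{ joins } u,v}\omega(f)(p(u)-p(v))=0$; it is non-splittable if it is splittable at no vertex. A tensegrity whose points affinely span $\mathbb{R}^d$ is a $d$-dimensional super stable tensegrity if (i) some strictly proper equilibrium stress $\omega$ has $L_{G,\omega}\succeq0$ and $\dim\ker L_{G,\omega}=d+1$, and (ii) no nonzero symmetric $d\times d$ matrix $S$ has $(p(j)-p(i))^\top S(p(j)-p(i))=0$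 for all edges $ij$. Minors are in the usual sense (loops from contraction deleted); a $k$-connected graph has at least $k+1$ vertices. *)

theory Defs
  imports "HOL-Analysis.Analysis"
begin

section \<open>Multigraphs\<close>

record ('v, 'e) mgraph =
  verts :: "'v set"
  edges :: "'e set"
  ends :: "'e \<Rightarrow> 'v set"

text \<open>Edges are named, so distinct edges may be parallel; two distinct endpoints exclude loops.\<close>

definition multigraph :: "('v, 'e) mgraph \<Rightarrow> bool" where
  "multigraph G \<longleftrightarrow> finite (verts G) \<and> finite (edges G) \<and>
     (\<forall>e\<in>edges G. ends G e \<subseteq> verts G \<and> card (ends G e) = 2)"

definition incident :: "('v, 'e) mgraph \<Rightarrow> 'v \<Rightarrow> 'e set" where
  "incident G v = {e \<in> edges G. v \<in> ends G e}"

text \<open>The endpoint of \<open>e\<close> other than \<open>v\<close>; meaningful only if \<open>v\<close> is an endpoint of \<open>e\<close>.\<close>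

definition other_end :: "('v, 'e) mgraph \<Rightarrow> 'e \<Rightarrow> 'v \<Rightarrow> 'v" where
  "other_end G e v = (THE u. ends G e = {v, u})"

lemma other_end_eq: "ends G e = {v, u} \<Longrightarrow> other_end G e v = u"
  unfolding other_end_def by (rule the_equality) (auto simp: doubleton_eq_iff)

section \<open>Connectivity\<close>

definition adjacency :: "('v, 'e) mgraph \<Rightarrow> ('v \<times> 'v) set" where
  "adjacency G = {(u, v). \<exists>e\<in>edges G. ends G e = {u, v}}"

definition connected_graph :: "('v, 'e) mgraph \<Rightarrow> bool" where
  "connected_graph G \<longleftrightarrow> verts G \<noteq> {} \<and>
     (\<forall>u\<in>verts G. \<forall>v\<in>verts G. (u, v) \<in> (adjacency G)\<^sup>*)"

definition delete_vertices :: "('v, 'e) mgraph \<Rightarrow> 'v set \<Rightarrow> ('v, 'e) mgraph" where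
  "delete_vertices G X =
     G\<lparr>verts := verts G - X, edges := {e \<in> edges G. ends G e \<inter> X = {}}\<rparr>"

definition k_connected :: "nat \<Rightarrow> ('v, 'e) mgraph \<Rightarrow> bool" where
  "k_connected k G \<longleftrightarrow> card (verts G) \<ge> k + 1 \<and>
     (\<forall>X\<subseteq>verts G. card X < k \<longrightarrow> connected_graph (delete_vertices G X))"

section \<open>Minors\<close>

definition delete_edge :: "('v, 'e) mgraph \<Rightarrow> 'e \<Rightarrow> ('v, 'e) mgraph" where
  "delete_edge G e = G\<lparr>edges := edges G - {e}\<rparr>"

text \<open>Contracting an edge with endpoints \<open>u\<close> and \<open>v\<close> merges \<open>v\<close> into \<open>u\<close>. The contracted edge
  disappears together with all edges parallel to it, which would become loops; other edges that
  become parallel are kept.\<close>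

definition contract :: "('v, 'e) mgraph \<Rightarrow> 'v \<Rightarrow> 'v \<Rightarrow> ('v, 'e) mgraph" where
  "contract G u v =
     G\<lparr>verts := verts G - {v},
       edges := {f \<in> edges G. ends G f \<noteq> {u, v}},
       ends := (\<lambda>f. (\<lambda>x. if x = v then u else x) ` ends G f)\<rparr>"

inductive minor_step :: "('v, 'e) mgraph \<Rightarrow> ('v, 'e) mgraph \<Rightarrow> bool" where
  edge_deletion: "e \<in> edges G \<Longrightarrow> minor_step G (delete_edge G e)"
| vertex_deletion: "v \<in> verts G \<Longrightarrow> minor_step G (delete_vertices G {v})"
| edge_contraction: "\<lbrakk>e \<in> edges G; ends G e = {u, v}; u \<noteq> v\<rbrakk> \<Longrightarrow> minor_step G (contract G u v)"

definition isomorphic :: "('v, 'e) mgraph \<Rightarrow> ('w, 'f) mgraph \<Rightarrow> bool" where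
  "isomorphic G H \<longleftrightarrow> (\<exists>\<phi> \<psi>. bij_betw \<phi> (verts G) (verts H) \<and> bij_betw \<psi> (edges G) (edges H) \<and>
     (\<forall>e\<in>edges G. ends H (\<psi> e) = \<phi> ` ends G e))"

definition is_minor :: "('w, 'f) mgraph \<Rightarrow> ('v, 'e) mgraph \<Rightarrow> bool" where
  "is_minor H G \<longleftrightarrow> (\<exists>G'. minor_step\<^sup>*\<^sup>* G G' \<and> isomorphic G' H)"

section \<open>Tensegrities and stresses\<close>

text \<open>The signs \<open>+\<close> and \<open>-\<close> are the reals \<open>1\<close> and \<open>-1\<close>.
  Values of \<open>\<sigma>\<close>, \<open>\<omega>\<close> and \<open>p\<close> off the graph are irrelevant.\<close>

definition tensegrity ::
  "('v, 'e) mgraph \<Rightarrow> ('e \<Rightarrow> real) \<Rightarrow> ('v \<Rightarrow> real ^ 'd) \<Rightarrow> bool" where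
  "tensegrity G \<sigma> p \<longleftrightarrow> multigraph G \<and> (\<forall>e\<in>edges G. \<sigma> e \<in> {1, -1})"

definition equilibrium_stress ::
  "('v, 'e) mgraph \<Rightarrow> ('v \<Rightarrow> real ^ 'd) \<Rightarrow> ('e \<Rightarrow> real) \<Rightarrow> bool" where
  "equilibrium_stress G p \<omega> \<longleftrightarrow>
     (\<forall>v\<in>verts G. (\<Sum>e\<in>incident G v. \<omega> e *\<^sub>R (p (other_end G e v) - p v)) = 0)"

definition strictly_proper ::
  "('v, 'e) mgraph \<Rightarrow> ('e \<Rightarrow> real) \<Rightarrow> ('e \<Rightarrow> real) \<Rightarrow> bool" where
  "strictly_proper G \<sigma> \<omega> \<longleftrightarrow> (\<forall>e\<in>edges G. \<sigma> e * \<omega> e > 0)"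

definition splittable_at ::
  "('v, 'e) mgraph \<Rightarrow> ('v \<Rightarrow> real ^ 'd) \<Rightarrow> ('e \<Rightarrow> real) \<Rightarrow> 'v \<Rightarrow> bool" where
  "splittable_at G p \<omega> v \<longleftrightarrow>
     (\<exists>F. F \<noteq> {} \<and> F \<subset> incident G v \<and>
        (\<Sum>f\<in>F. \<omega> f *\<^sub>R (p (other_end G f v) - p v)) = 0)"

definition non_splittable ::
  "('v, 'e) mgraph \<Rightarrow> ('v \<Rightarrow> real ^ 'd) \<Rightarrow> ('e \<Rightarrow> real) \<Rightarrow> bool" where
  "non_splittable G p \<omega> \<longleftrightarrow> (\<forall>v\<in>verts G. \<not> splittable_at G p \<omega> v)"

section \<open>Weighted Laplacian and super stability\<close>

text \<open>The vector \<open>\<e>\<^sub>i - \<e>\<^sub>j\<close> for the endpoints \<open>i\<close>, \<open>j\<close> of \<open>e\<close>, with an arbitrary choice of sign,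
  which cancels in the Laplacian (lemma \<open>outer_edge_vec\<close>).\<close>

definition edge_vec :: "('v::finite, 'e) mgraph \<Rightarrow> 'e \<Rightarrow> real ^ 'v" where
  "edge_vec G e = (let i = (SOME i. i \<in> ends G e) in axis i 1 - axis (other_end G e i) 1)"

definition outer :: "real ^ 'n \<Rightarrow> real ^ 'n ^ 'n" where
  "outer x = (columnvector x :: real ^ 1 ^ 'n) ** rowvector x"

lemma outer_minus: "outer (- x) = outer x"
  by (simp add: outer_def columnvector_def rowvector_def matrix_matrix_mult_def)

lemma outer_edge_vec:
  assumes ij: "ends G e = {i, j}"
  shows "outer (edge_vec G e) = outer (axis i 1 - axis j 1)"
proof -
  define k where "k = (SOME k. k \<in> ends G e)"
  have vec: "edge_vec G e = axis k 1 - axis (other_end G e k) 1"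
    by (simp add: edge_vec_def k_def Let_def)
  have ji: "ends G e = {j, i}"
    using ij by auto
  have "k \<in> ends G e"
    unfolding k_def by (rule someI[of _ i]) (simp add: ij)
  then consider "k = i" | "k = j"
    using ij by auto
  then show ?thesis
  proof cases
    case 1
    then show ?thesis
      by (simp add: vec other_end_eq[OF ij])
  next
    case 2
    then have "edge_vec G e = - (axis i 1 - axis j 1)"
      by (simp add: vec other_end_eq[OF ji])
    then show ?thesis
      by (metis outer_minus)
  qed
qed

text \<open>Rows and columns are indexed by the whole vertex type; those outside \<open>verts G\<close> are zero.
  Accordingly the kernel is taken inside the coordinate subspace of \<open>verts G\<close>.\<close>

definition laplacian :: "('v::finite, 'e) mgraph \<Rightarrow> ('e \<Rightarrow> real) \<Rightarrow> real ^ 'v ^ 'v" where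
  "laplacian G \<omega> = (\<Sum>e\<in>edges G. \<omega> e *\<^sub>R outer (edge_vec G e))"

definition laplacian_kernel :: "('v::finite, 'e) mgraph \<Rightarrow> ('e \<Rightarrow> real) \<Rightarrow> (real ^ 'v) set" where
  "laplacian_kernel G \<omega> = {x. (\<forall>a. a \<notin> verts G \<longrightarrow> x $ a = 0) \<and> laplacian G \<omega> *v x = 0}"

definition pos_semidef :: "real ^ 'n ^ 'n \<Rightarrow> bool" where
  "pos_semidef A \<longleftrightarrow> transpose A = A \<and> (\<forall>x. x \<bullet> (A *v x) \<ge> 0)"

definition super_stable ::
  "('v::finite, 'e) mgraph \<Rightarrow> ('e \<Rightarrow> real) \<Rightarrow> ('v \<Rightarrow> real ^ 'd) \<Rightarrow> bool" where
  "super_stable G \<sigma> p \<longleftrightarrow> tensegrity G \<sigma> p \<and>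
     affine hull (p ` verts G) = UNIV \<and>
     (\<exists>\<omega>. equilibrium_stress G p \<omega> \<and> strictly_proper G \<sigma> \<omega> \<and>
        pos_semidef (laplacian G \<omega>) \<and> dim (laplacian_kernel G \<omega>) = CARD('d) + 1) \<and>
     (\<forall>S :: real ^ 'd ^ 'd. transpose S = S \<longrightarrow>
        (\<forall>e\<in>edges G. \<forall>i j. ends G e = {i, j} \<longrightarrow> (p j - p i) \<bullet> (S *v (p j - p i)) = 0) \<longrightarrow>
        S = 0)"

end

theory Submission imports Defs begin

text \<open>
  Merge the vertices of each branch set of the minor \<open>H\<close> in \<open>G\<close>, the branch sets being enlarged so
  that they cover \<open>G\<close>. This gives a non-injective realization of \<open>G\<close> with a stress on the edges of
  \<open>H\<close>. The missing edges are then added one at a time, with tiny weight if their ends are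
  already apart. When no such edge is left, a fibre is split into two connected parts joined by an
  edge \<open>c\<close> of huge weight; by 2-connectivity both parts can be chosen with an edge leaving the
  fibre, so non-splittability makes the force across \<open>c\<close> nonzero and moves the two parts apart.

  In each step the change of the Laplacian has to be compensated so that its nullity remains
  \<open>d + 1\<close>. Condition (ii) of super stability says that the weights move the Laplacian transversally to
  the matrices of that nullity, so an open mapping theorem applies. Injectivity,
  non-splittability and condition (ii) are open and hence preserved.
\<close>

section \<open>Quadratic forms of prescribed nullity\<close>

text \<open>Adding an edge and splitting a fibre are the same kind of perturbation. When a fibre is
  split, the gap between its two parts is measured in units of a small parameter s; the edge c
  between them, with weight 1 / s^2, then contributes the square of a new free coordinate. In both
  operations vectors \<open>a i + s *\<^sub>R b i\<close> deform a form that has nullity exactly d +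
  1 at s = 0, so one open mapping argument serves both. The perturbation does not reveal whether the
  gap is nonzero. That follows from equilibrium: c alone balances the stressed edges at one part,
  which form a nonempty proper subset of those at the merged vertex, and an edge of length 0 carries
  no force. For this reason edges between different fibres are added before a fibre is split: the
  edges that 2-connectivity provides at both parts must already carry stress. Non-splittability is
  needed again after each step. At a new vertex the total force is 0, so a set of edges containing c
  may be replaced by its complement, which consists of old edges.\<close>

lemma eventually_pos_on_compact:
  fixes \<Psi> :: "'a::topological_space \<times> 'b::topological_space \<Rightarrow> real"
  assumes "compact K" and cont: "continuous_on UNIV \<Psi>" and pos: "\<And>z. z \<in> K \<Longrightarrow> \<Psi> (x0, z) > 0"
  shows "eventually (\<lambda>x. \<forall>z\<in>K. \<Psi> (x, z) > 0) (nhds x0)"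
proof -
  have "open {y. \<Psi> y > 0}"
    using cont by (intro open_Collect_less continuous_intros) auto
  moreover have "{x0} \<times> K \<subseteq> {y. \<Psi> y > 0}"
    using pos by auto
  ultimately obtain X where "x0 \<in> X" "open X" "X \<times> K \<subseteq> {y. \<Psi> y > 0}"
    by (metis Elementary_Topology.tube_lemma[OF \<open>compact K\<close>])
  then show ?thesis
    unfolding eventually_nhds by blast
qed

text \<open>Homogeneity reduces positivity at all nonzero \<open>z\<close> to the compact unit
  sphere. Definiteness, nondegenerate pairing of kernels and condition (ii) all become open
  conditions in this way.\<close>

lemma eventually_pos_homogeneous:
  fixes \<Psi> :: "'a::topological_space \<times> 'b::euclidean_space \<Rightarrow> real"
  assumes cont: "continuous_on UNIV \<Psi>"
    and hom: "\<And>x t z. \<Psi> (x, t *\<^sub>R z) = t\<^sup>2 * \<Psi> (x, z)"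
    and pos: "\<And>z. z \<noteq> 0 \<Longrightarrow> \<Psi> (x0, z) > 0"
  shows "eventually (\<lambda>x. \<forall>z. z \<noteq> 0 \<longrightarrow> \<Psi> (x, z) > 0) (nhds x0)"
proof -
  have "eventually (\<lambda>x. \<forall>z\<in>sphere 0 1. \<Psi> (x, z) > 0) (nhds x0)"
    using cont by (intro eventually_pos_on_compact) (auto intro!: pos)
  then show ?thesis
  proof eventually_elim
    case (elim x)
    show ?case
    proof (intro allI impI)
      fix z :: 'b assume "z \<noteq> 0"
      then have "\<Psi> (x, z /\<^sub>R norm z) > 0"
        using elim by simp
      then show "\<Psi> (x, z) > 0"
        unfolding hom using \<open>z \<noteq> 0\<close> by (auto simp: zero_less_mult_iff)
    qed
  qed
qed

section \<open>Configurations as matrices with one row per vertex\<close>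

text \<open>With points as rows, \<open>tens\<close>, \<open>app\<close> and \<open>rowmap\<close>
  are the products \<open>a x^T\<close>, \<open>P^T a\<close> and \<open>P X^T\<close>. For the
  vector \<open>a\<close> of an edge, \<open>app P a\<close> is the edge direction.\<close>

definition tens :: "real ^ 'n \<Rightarrow> real ^ 'd \<Rightarrow> real ^ 'd ^ 'n" where
  "tens a x = (\<chi> v. a $ v *\<^sub>R x)"

definition app :: "real ^ 'd ^ 'n \<Rightarrow> real ^ 'n \<Rightarrow> real ^ 'd" where
  "app P a = (\<Sum>v\<in>UNIV. a $ v *\<^sub>R P $ v)"

definition rowmap :: "real ^ 'd ^ 'd \<Rightarrow> real ^ 'd ^ 'n \<Rightarrow> real ^ 'd ^ 'n" where
  "rowmap X P = (\<chi> v. X *v P $ v)"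

lemma bounded_bilinear_tens [bounded_bilinear]: "bounded_bilinear tens"
  unfolding bilinear_conv_bounded_bilinear[symmetric] bilinear_def linear_iff
  by (auto simp: tens_def vec_eq_iff algebra_simps)

lemma bounded_bilinear_app [bounded_bilinear]: "bounded_bilinear app"
  unfolding bilinear_conv_bounded_bilinear[symmetric] bilinear_def linear_iff
  by (auto simp: app_def algebra_simps sum.distrib scaleR_sum_right)

lemma bounded_bilinear_matrix_vector [bounded_bilinear]:
  "bounded_bilinear (\<lambda>(X::real ^ 'd ^ 'e) x. X *v x)"
  unfolding bilinear_conv_bounded_bilinear[symmetric] bilinear_def linear_iff
  by (auto simp: matrix_vector_mult_add_rdistrib matrix_vector_right_distrib
      scaleR_matrix_vector_assoc matrix_vector_mult_scaleR)

lemma bounded_bilinear_rowmap [bounded_bilinear]: "bounded_bilinear rowmap"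
  unfolding bilinear_conv_bounded_bilinear[symmetric] bilinear_def linear_iff
  by (auto simp: rowmap_def vec_eq_iff matrix_vector_mult_add_rdistrib matrix_vector_right_distrib
      scaleR_matrix_vector_assoc[symmetric] matrix_vector_mult_scaleR)

lemma bounded_linear_transpose [bounded_linear]:
  "bounded_linear (transpose :: real ^ 'd ^ 'e \<Rightarrow> real ^ 'e ^ 'd)"
  unfolding linear_conv_bounded_linear[symmetric] linear_iff
  by (auto simp: transpose_def vec_eq_iff)

interpretation tens: bounded_bilinear tens by (rule bounded_bilinear_tens)
interpretation app: bounded_bilinear app by (rule bounded_bilinear_app)
interpretation mv: bounded_bilinear "\<lambda>(X::real ^ 'd ^ 'e) x. X *v x"
  by (rule bounded_bilinear_matrix_vector)
interpretation rowmap: bounded_bilinear rowmap by (rule bounded_bilinear_rowmap)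
text \<open>Adjointness of \<open>tens\<close> and \<open>app\<close>: an equation between
  configurations becomes a scalar identity tested against arbitrary \<open>Y\<close>.\<close>

lemma inner_tens: "Y \<bullet> tens a x = app Y a \<bullet> x"
  by (simp add: tens_def app_def inner_vec_def[of Y] inner_sum_left)

lemma app_rowmap: "app (rowmap X P) a = X *v app P a"
  by (simp add: app_def rowmap_def mv.sum_right mv.scaleR_right)

lemma app_tens: "app (tens u c) a = (u \<bullet> a) *\<^sub>R c"
  by (simp add: app_def tens_def inner_vec_def scaleR_sum_left mult.commute)

lemma inner_matrix_adjoint: "(x::real^'d) \<bullet> (transpose X *v y) = (X *v x) \<bullet> y"
  by (metis dot_lmul_matrix inner_commute transpose_matrix_vector)

lemma app_axis [simp]: "app P (axis v 1) = P $ v"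
proof -
  have "app P (axis v 1) = (\<Sum>w\<in>UNIV. if w = v then P $ w else 0)"
    unfolding app_def by (rule sum.cong) (auto simp: axis_def)
  then show ?thesis
    by simp
qed

text \<open>If \<open>u\<close> is the all-ones vector, these are the affine functions of the
  points, with gradient \<alpha> and constant \<beta>: the expected kernel of dimension d +
  1.\<close>

definition affcomb :: "real ^ 'd ^ 'n \<Rightarrow> real ^ 'n \<Rightarrow> real ^ 'd \<Rightarrow> real \<Rightarrow> real ^ 'n" where
  "affcomb P u \<alpha> \<beta> = (\<chi> v. \<alpha> \<bullet> P $ v + \<beta> * u $ v)"

lemma inner_affcomb: "a \<bullet> affcomb P u \<alpha> \<beta> = \<alpha> \<bullet> app P a + \<beta> * (a \<bullet> u)"
  by (simp add: affcomb_def app_def inner_vec_def[of a] algebra_simps sum.distrib inner_sum_right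
      sum_distrib_left)

lemma affcomb_add: "affcomb P u (\<alpha> + \<alpha>') (\<beta> + \<beta>') = affcomb P u \<alpha> \<beta> + affcomb P u \<alpha>' \<beta>'"
  and affcomb_scaleR: "affcomb P u (t *\<^sub>R \<alpha>) (t * \<beta>) = t *\<^sub>R affcomb P u \<alpha> \<beta>"
  by (simp_all add: affcomb_def vec_eq_iff algebra_simps)

text \<open>The form only has to be positive on the orthogonal complement of a reference kernel given by
  \<open>P\<close>: by a dimension count this is a complement of the actual kernel given by \<open>Q\<close> as soon as the
  two kernels pair nondegenerately.\<close>

lemma psd_of_kernel:
  fixes A :: "'i \<Rightarrow> real ^ 'n" and P Q :: "real ^ 'd ^ 'n"
  assumes Au: "\<And>i. i \<in> I \<Longrightarrow> A i \<bullet> u = 0"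
    and equil: "\<And>z. (\<Sum>i\<in>I. (w i * (A i \<bullet> z)) *\<^sub>R app Q (A i)) = 0"
    and nondeg: "\<And>\<alpha> \<beta>. \<lbrakk>app P (affcomb Q u \<alpha> \<beta>) = 0; u \<bullet> affcomb Q u \<alpha> \<beta> = 0\<rbrakk> \<Longrightarrow> \<alpha> = 0 \<and> \<beta> = 0"
    and pos: "\<And>z. \<lbrakk>z \<noteq> 0; app P z = 0; u \<bullet> z = 0\<rbrakk> \<Longrightarrow> (\<Sum>i\<in>I. w i * (A i \<bullet> z)\<^sup>2) > 0"
  shows "(\<Sum>i\<in>I. w i * (A i \<bullet> z)\<^sup>2) \<ge> 0"
    and "(\<Sum>i\<in>I. w i * (A i \<bullet> z)\<^sup>2) = 0 \<Longrightarrow> \<exists>\<alpha> \<beta>. z = affcomb Q u \<alpha> \<beta>"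
proof -
  \<comment> \<open>\<open>h\<close> pairs the kernel of \<open>Q\<close> with that of
    \<open>P\<close>. Both sides have dimension d + 1, so injectivity gives a kernel vector
    \<open>k\<close> with the same pairings as \<open>z\<close>; subtracting it does not change the
    form.\<close>
  define h where "h = (\<lambda>x. (app P (affcomb Q u (fst x) (snd x)), u \<bullet> affcomb Q u (fst x) (snd x)))"
  have lin: "linear h"
    by (rule linearI) (simp_all add: h_def affcomb_add affcomb_scaleR app.add_right inner_add_right
        app.scaleR_right)
  moreover have "inj h"
    using nondeg unfolding linear_injective_0[OF lin] by (auto simp: h_def prod_eq_iff)
  ultimately have "surj h"
    by (rule linear_injective_imp_surjective) simp
  then obtain x where x: "h x = (app P z, u \<bullet> z)"
    by (metis surjD)
  define k where "k = affcomb Q u (fst x) (snd x)"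
  have Ak: "A i \<bullet> k = fst x \<bullet> app Q (A i)" if "i \<in> I" for i
    using Au[OF that] by (simp add: k_def inner_affcomb)
  have "(\<Sum>i\<in>I. w i * (A i \<bullet> y) * (A i \<bullet> k)) = fst x \<bullet> (\<Sum>i\<in>I. (w i * (A i \<bullet> y)) *\<^sub>R app Q (A i))" for y
    by (simp add: Ak inner_sum_right cong: sum.cong_simp)
  then have k0: "(\<Sum>i\<in>I. w i * (A i \<bullet> y) * (A i \<bullet> k)) = 0" for y
    by (simp add: equil)
  have "(\<Sum>i\<in>I. w i * (A i \<bullet> z)\<^sup>2) = (\<Sum>i\<in>I. w i * (A i \<bullet> (z - k))\<^sup>2 + 2 * (w i * (A i \<bullet> z) * (A i \<bullet> k)) - w i * (A i \<bullet> k) * (A i \<bullet> k))"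
    by (rule sum.cong) (auto simp: inner_diff_right power2_eq_square algebra_simps)
  also have "\<dots> = (\<Sum>i\<in>I. w i * (A i \<bullet> (z - k))\<^sup>2)"
    using k0[of z] k0[of k] by (simp add: sum.distrib sum_subtractf flip: sum_distrib_left)
  finally have eq: "(\<Sum>i\<in>I. w i * (A i \<bullet> z)\<^sup>2) = (\<Sum>i\<in>I. w i * (A i \<bullet> (z - k))\<^sup>2)" .
  have orth: "app P (z - k) = 0" "u \<bullet> (z - k) = 0"
    using x by (simp_all add: h_def k_def app.diff_right inner_diff_right)
  show "(\<Sum>i\<in>I. w i * (A i \<bullet> z)\<^sup>2) \<ge> 0"
    unfolding eq using pos[OF _ orth] by (cases "z = k") auto
  show "\<exists>\<alpha> \<beta>. z = affcomb Q u \<alpha> \<beta>" if "(\<Sum>i\<in>I. w i * (A i \<bullet> z)\<^sup>2) = 0"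
    using that pos[OF _ orth] unfolding eq by (cases "z = k") (auto simp: k_def)
qed

text \<open>The form of the symmetric matrix \<open>transpose A ** A\<close> at v is |A v|^2. This
  extends condition (ii) to arbitrary matrices that annihilate all edge directions.\<close>

lemma symmetric_isotropic_imp_0:
  fixes A :: "real ^ 'd ^ 'd"
  assumes conic: "\<And>S :: real ^ 'd ^ 'd. \<lbrakk>transpose S = S; \<And>i. i \<in> I \<Longrightarrow> v i \<bullet> (S *v v i) = 0\<rbrakk> \<Longrightarrow> S = 0"
    and A: "\<And>i. i \<in> I \<Longrightarrow> A *v v i = 0"
  shows "A = 0"
proof -
  have "transpose A ** A = 0"
  proof (rule conic)
    show "transpose (transpose A ** A) = transpose A ** A"
      by (simp add: matrix_transpose_mul)
    show "v i \<bullet> ((transpose A ** A) *v v i) = 0" if "i \<in> I" for i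
      using A[OF that] by (simp flip: matrix_vector_mul_assoc)
  qed
  have "A *v x = 0" for x
  proof -
    have "(A *v x) \<bullet> (A *v x) = x \<bullet> ((transpose A ** A) *v x)"
      by (simp add: inner_matrix_adjoint del: transpose_matrix_vector flip: matrix_vector_mul_assoc)
    then show ?thesis
      using \<open>transpose A ** A = 0\<close> by simp
  qed
  then show ?thesis
    by (simp add: matrix_eq)
qed

text \<open>Using \<alpha> as every row of a matrix reduces this to the previous lemma. Condition
  (ii) thus contains the fact that the edge directions span.\<close>

lemma conic_imp_inner_0:
  fixes \<alpha> :: "real ^ 'd"
  assumes conic: "\<And>S :: real ^ 'd ^ 'd. \<lbrakk>transpose S = S; \<And>i. i \<in> I \<Longrightarrow> v i \<bullet> (S *v v i) = 0\<rbrakk> \<Longrightarrow> S = 0"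
    and \<alpha>: "\<And>i. i \<in> I \<Longrightarrow> \<alpha> \<bullet> v i = 0"
  shows "\<alpha> = 0"
proof -
  define A :: "real ^ 'd ^ 'd" where "A = (\<chi> k. \<alpha>)"
  have A: "A *v x = (\<chi> k. \<alpha> \<bullet> x)" for x
    by (simp add: A_def matrix_vector_mult_def inner_vec_def)
  have "A = 0"
    by (rule symmetric_isotropic_imp_0[of I v, OF conic]) (simp_all add: A \<alpha> vec_eq_iff)
  then show ?thesis
    by (simp add: A_def vec_eq_iff)
qed

text \<open>Solving \<open>F = (0, s)\<close> for small \<open>s\<close> gives the equilibrium equations for the matrix with vectors
  \<open>a i + s *\<^sub>R b i\<close>. The unknowns are the kernel \<open>Q\<close> and a matrix \<open>T\<close>, whose symmetric part changes the
  weights; \<open>conic\<close> says that these changes reach every symmetric form on the old kernel. The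
  equilibrium equations are redundant, as \<open>L Q\<close> paired with \<open>Q\<close> is symmetric and orthogonal to \<open>u\<close>.
  The terms with the antisymmetric part of \<open>T\<close> and with \<open>c\<close> make the derivative surjective,
  and the same redundancy forces them to vanish at a solution.\<close>

lemma perturbation:
  fixes a b :: "'i \<Rightarrow> real ^ 'n" and \<omega> :: "'i \<Rightarrow> real" and P :: "real ^ 'd ^ 'n"
  assumes [simp]: "finite I" and u0: "u \<noteq> 0"
    and au: "\<And>i. i \<in> I \<Longrightarrow> a i \<bullet> u = 0" and bu: "\<And>i. i \<in> I \<Longrightarrow> b i \<bullet> u = 0"
    and equil: "\<And>z. (\<Sum>i\<in>I. (\<omega> i * (a i \<bullet> z)) *\<^sub>R app P (a i)) = 0"
    and psd: "\<And>z. (\<Sum>i\<in>I. \<omega> i * (a i \<bullet> z)\<^sup>2) \<ge> 0"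
    and ker: "\<And>z. (\<Sum>i\<in>I. \<omega> i * (a i \<bullet> z)\<^sup>2) = 0 \<Longrightarrow> \<exists>\<alpha> \<beta>. z = affcomb P u \<alpha> \<beta>"
    and conic: "\<And>S :: real ^ 'd ^ 'd. \<lbrakk>transpose S = S; \<And>i. i \<in> I \<Longrightarrow> app P (a i) \<bullet> (S *v app P (a i)) = 0\<rbrakk> \<Longrightarrow> S = 0"
  obtains s :: "nat \<Rightarrow> real" and Q w where
    "\<And>n. s n > 0" "s \<longlonglongrightarrow> 0" "Q \<longlonglongrightarrow> P" "\<And>i. (\<lambda>n. w n i) \<longlonglongrightarrow> \<omega> i"
    "\<And>n z. (\<Sum>i\<in>I. (w n i * ((a i + s n *\<^sub>R b i) \<bullet> z)) *\<^sub>R app (Q n) (a i + s n *\<^sub>R b i)) = 0"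
    "\<And>n z. (\<Sum>i\<in>I. w n i * ((a i + s n *\<^sub>R b i) \<bullet> z)\<^sup>2) \<ge> 0"
    "\<And>n z. (\<Sum>i\<in>I. w n i * ((a i + s n *\<^sub>R b i) \<bullet> z)\<^sup>2) = 0 \<Longrightarrow> \<exists>\<alpha> \<beta>. z = affcomb (Q n) u \<alpha> \<beta>"
proof -
  define v where "v i = app P (a i)" for i
  \<comment> \<open>Centring: \<open>P0\<close> is \<open>P\<close> shifted along \<open>u\<close>
    so that \<open>app P0 u = 0\<close>. Edge directions are unchanged, and
    \<open>rowmap X P0\<close> becomes orthogonal to every \<open>tens u x\<close>, which separates
    the two correction terms.\<close>
  define m where "m = (1 / (u \<bullet> u)) *\<^sub>R app P u"
  define P0 where "P0 = P - tens u m"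
  define A where "A s i = a i + s *\<^sub>R b i" for s i
  define wt where "wt T i = \<omega> i + v i \<bullet> (T *v v i)" for T i
  have uu: "u \<bullet> u > 0"
    using u0 by simp
  have P0u: "app P0 u = 0"
    using uu by (simp add: P0_def m_def app.diff_left app_tens)
  have P0a: "app P0 (a i) = v i" if "i \<in> I" for i
    using au[OF that] by (simp add: P0_def v_def app.diff_left app_tens inner_commute)
  have Au: "A s i \<bullet> u = 0" if "i \<in> I" for s i
    using that by (simp add: A_def au bu inner_add_left)
  then have uA: "u \<bullet> A s i = 0" if "i \<in> I" for s i
    using that by (simp add: inner_commute)
  note conic' = conic[folded v_def]

  \<comment> \<open>The argument is \<open>(T, Q, c, s)\<close>. Repeating \<open>s\<close> as the
    second component lets the open mapping theorem prescribe its value.\<close>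
  define F :: "(real^'d^'d) \<times> (real^'d^'n) \<times> (real^'d) \<times> real \<Rightarrow> (real^'d^'n) \<times> real" where
    "F = (\<lambda>x. ((\<Sum>i\<in>I. wt (fst x) i *\<^sub>R tens (A (snd (snd (snd x))) i) (app (fst (snd x)) (A (snd (snd (snd x))) i)))
         + rowmap (fst x - transpose (fst x)) P0 + tens u (fst (snd (snd x))), snd (snd (snd x))))"
  define F' :: "(real^'d^'d) \<times> (real^'d^'n) \<times> (real^'d) \<times> real \<Rightarrow> (real^'d^'n) \<times> real" where
    "F' = (\<lambda>x. ((\<Sum>i\<in>I. \<omega> i *\<^sub>R tens (a i) (app (fst (snd x)) (a i))
                     + (v i \<bullet> (fst x *v v i)) *\<^sub>R tens (a i) (v i)
                     + (\<omega> i * snd (snd (snd x))) *\<^sub>R (tens (b i) (v i) + tens (a i) (app P (b i))))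
         + rowmap (fst x - transpose (fst x)) P0 + tens u (fst (snd (snd x))), snd (snd (snd x))))"
  define x0 :: "(real^'d^'d) \<times> (real^'d^'n) \<times> (real^'d) \<times> real" where "x0 = (0, P, 0, 0)"
  \<comment> \<open>Weak form of \<open>F\<close>: the facts about solutions come from suitable
    choices of \<open>Y\<close>.\<close>
  have Finner: "fst (F (T, Q, c, s)) \<bullet> Y = (\<Sum>i\<in>I. wt T i * (app Q (A s i) \<bullet> app Y (A s i)))
      + rowmap (T - transpose T) P0 \<bullet> Y + c \<bullet> app Y u" for T Q c s Y
    by (simp add: F_def inner_commute[of _ Y] inner_add_right inner_sum_right inner_tens)
      (simp add: inner_commute)
  have F'inner: "fst (F' (T, Q, c, 0)) \<bullet> Y = (\<Sum>i\<in>I. \<omega> i * (app Q (a i) \<bullet> app Y (a i)))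
      + (\<Sum>i\<in>I. (v i \<bullet> (T *v v i)) * (v i \<bullet> app Y (a i)))
      + rowmap (T - transpose T) P0 \<bullet> Y + c \<bullet> app Y u" for T Q c Y
    by (simp add: F'_def inner_commute[of _ Y] inner_add_right inner_sum_right inner_tens sum.distrib)
      (simp add: inner_commute)

  have contF: "continuous_on UNIV F"
    unfolding F_def wt_def A_def by (intro continuous_intros)
  have derF: "(F has_derivative F') (at x0)"
    unfolding F_def F'_def wt_def A_def x0_def
    by (auto intro!: derivative_eq_intros bounded_linear.has_derivative[OF bounded_linear_transpose]
        ext sum.cong simp: algebra_simps v_def tens.add_left tens.add_right app.add_left app.add_right
          tens.scaleR_left tens.scaleR_right app.scaleR_right tens.zero_left tens.zero_right
          app.zero_right rowmap.zero_right)
  then have linF': "linear F'"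
    by (rule has_derivative_linear)

  have "surj F'"
  proof (rule ccontr)
    assume "\<not> surj F'"
    moreover have "span (range F') = range F'"
      using linF' by (simp add: linear_subspace_image subspace_UNIV span_eq_iff)
    ultimately obtain y where "y \<noteq> 0" and y: "\<And>x. y \<bullet> F' x = 0"
      by (metis rangeI span_not_UNIV_orthogonal)
    obtain Y \<tau> where y_eq: "y = (Y, \<tau>)"
      by (cases y)
    have Y: "fst (F' (T, Q, c, 0)) \<bullet> Y = 0" for T Q c
      using y[of "(T, Q, c, 0)"] by (simp add: y_eq F'_def inner_prod_def inner_commute)
    \<comment> \<open>The direction \<open>Q = Y\<close> gives the sum of the values of the form at
      the columns of \<open>Y\<close>. All are nonnegative, so each column is a null vector.\<close>
    have "\<exists>\<alpha> \<beta>. (\<chi> j. Y $ j $ k) = affcomb P u \<alpha> \<beta>" for k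
    proof (rule ker)
      have col: "a i \<bullet> (\<chi> j. Y $ j $ k) = app Y (a i) $ k" for i k
        by (simp add: inner_vec_def app_def)
      have "0 = (\<Sum>i\<in>I. \<omega> i * (app Y (a i) \<bullet> app Y (a i)))"
        using Y[of 0 Y 0] by (simp add: F'inner transpose_def zero_vec_def[symmetric] rowmap.zero_left)
      also have "\<dots> = (\<Sum>k\<in>UNIV. \<Sum>i\<in>I. \<omega> i * (a i \<bullet> (\<chi> j. Y $ j $ k))\<^sup>2)"
        by (subst sum.swap) (simp add: col inner_vec_def[of "app _ _"] power2_eq_square sum_distrib_left)
      finally have "\<forall>k\<in>UNIV. (\<Sum>i\<in>I. \<omega> i * (a i \<bullet> (\<chi> j. Y $ j $ k))\<^sup>2) = 0"
        by (subst sum_nonneg_eq_0_iff[symmetric]) (use psd in auto)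
      then show "(\<Sum>i\<in>I. \<omega> i * (a i \<bullet> (\<chi> j. Y $ j $ k))\<^sup>2) = 0"
        by simp
    qed
    then obtain \<alpha> \<beta> where col: "\<And>k. (\<chi> j. Y $ j $ k) = affcomb P u (\<alpha> k) (\<beta> k)"
      by metis
    define B :: "real ^ 'd ^ 'd" where "B = (\<chi> k. \<alpha> k)"
    \<comment> \<open>\<open>B *v m\<close> accounts for replacing \<open>P\<close> by the centred
      \<open>P0\<close>.\<close>
    define e where "e = B *v m + (\<chi> k. \<beta> k)"
    have B: "(B *v x) $ k = \<alpha> k \<bullet> x" for x k
      by (simp add: B_def matrix_vector_mult_def inner_vec_def)
    have "Y $ j $ k = \<alpha> k \<bullet> P $ j + \<beta> k * u $ j" for j k
      using arg_cong[OF col[of k], of "\<lambda>z. z $ j"] by (simp add: affcomb_def)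
    then have Y_eq: "Y = rowmap B P0 + tens u e"
      by (simp add: vec_eq_iff rowmap_def tens_def P0_def e_def B inner_diff_right algebra_simps)
    have appY: "app Y (a i) = B *v v i" if "i \<in> I" for i
      using au[OF that] P0a[OF that]
      by (simp add: Y_eq app.add_left app_rowmap app_tens inner_commute)
    have tT: "x \<bullet> (transpose B *v x) = x \<bullet> (B *v x)" for x
      using inner_matrix_adjoint[of x B x] by (simp add: inner_commute)
    \<comment> \<open>\<open>T = B + transpose B\<close> is symmetric, so only the change of weights
      is seen, and it appears as a sum of squares.\<close>
    have "(\<Sum>i\<in>I. 2 * (v i \<bullet> (B *v v i))\<^sup>2) = 0"
      using Y[of "B + transpose B" 0 0]
      by (simp add: F'inner linear_add[OF bounded_linear.linear[OF bounded_linear_transpose]] add.commute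
          mv.add_left inner_add_right tT appY power2_eq_square rowmap.zero_left
          app.zero_left mult.assoc cong: sum.cong_simp
          del: transpose_matrix_vector)
    then have vBv: "v i \<bullet> (B *v v i) = 0" if "i \<in> I" for i
      using that by (subst (asm) sum_nonneg_eq_0_iff) auto
    have "B + transpose B = 0"
      using vBv by (intro conic') (simp_all add: linear_add[OF bounded_linear.linear[OF bounded_linear_transpose]]
          add.commute mv.add_left inner_add_right tT del: transpose_matrix_vector)
    then have "transpose B = - B"
      by (rule minus_unique[symmetric])
    then have "B - transpose B = B + B"
      by simp
    \<comment> \<open>With \<open>T = B\<close> the weights no longer change to first order, so only
      the antisymmetric correction term remains.\<close>
    moreover have "rowmap (B - transpose B) P0 \<bullet> Y = 0"
      using Y[of B 0 0] by (simp add: F'inner vBv app.zero_left cong: sum.cong_simp)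
    ultimately have "rowmap B P0 \<bullet> Y + rowmap B P0 \<bullet> Y = 0"
      by (simp only: rowmap.add_left inner_add_left)
    then have "rowmap B P0 \<bullet> (rowmap B P0 + tens u e) = 0"
      by (simp flip: Y_eq)
    then have "rowmap B P0 = 0"
      by (simp add: inner_add_right inner_tens app_rowmap P0u)
    then have "B *v v i = 0" if "i \<in> I" for i
      using that by (metis P0a app_rowmap app.zero_left)
    then have "B = 0"
      using symmetric_isotropic_imp_0[where I = I and v = v, OF conic'] by blast
    then have "Y = tens u e"
      by (simp add: Y_eq rowmap.zero_left)
    moreover have "e = 0"
      using Y[of 0 0 e] uu
      by (simp add: F'inner rowmap.zero_left app.zero_left app_tens transpose_def zero_vec_def[symmetric] \<open>Y = tens u e\<close>)
    ultimately have "Y = 0"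
      by (simp add: tens.zero_right)
    moreover have "\<tau> = 0"
      using y[of "(0, 0, 0, 1)"] \<open>Y = 0\<close> by (simp add: y_eq F'_def inner_prod_def)
    ultimately show False
      using \<open>y \<noteq> 0\<close> by (simp add: y_eq zero_prod_def)
  qed
  then obtain g where "linear g" and g: "F' \<circ> g = id"
    using linear_surjective_right_inverse[OF linF'] by blast
  then have "bounded_linear g"
    by (simp add: linear_conv_bounded_linear)

  \<comment> \<open>Three open conditions: the form is positive definite modulo the old kernel, the
    kernels of \<open>Q\<close> and \<open>P\<close> pair nondegenerately, and testing with
    \<open>rowmap W Q\<close> detects an antisymmetric correction \<open>W\<close>.\<close>
  define good where "good x \<longleftrightarrow>
      (\<forall>z. z \<noteq> 0 \<longrightarrow> (\<Sum>i\<in>I. wt (fst x) i * (A (snd (snd (snd x))) i \<bullet> z)\<^sup>2) + (app P z \<bullet> app P z + (u \<bullet> z)\<^sup>2) > 0) \<and>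
      (\<forall>y. y \<noteq> 0 \<longrightarrow> (\<Sum>j\<in>UNIV. (fst y \<bullet> fst (snd x) $ j + snd y * u $ j) * (fst y \<bullet> P $ j + snd y * u $ j)) > 0) \<and>
      (\<forall>W. W \<noteq> 0 \<longrightarrow> rowmap W (fst (snd x)) \<bullet> rowmap W P0 > 0)"
    for x :: "(real^'d^'d) \<times> (real^'d^'n) \<times> (real^'d) \<times> real"
  have "eventually good (nhds x0)"
    unfolding good_def
  proof (intro eventually_conj)
    \<comment> \<open>A null vector lies in the old kernel and pairs to 0 with it, hence with
      itself.\<close>
    have base: "(\<Sum>i\<in>I. \<omega> i * (a i \<bullet> z)\<^sup>2) + (app P z \<bullet> app P z + (u \<bullet> z)\<^sup>2) > 0" if "z \<noteq> 0" for z
    proof -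
      have "(\<Sum>i\<in>I. \<omega> i * (a i \<bullet> z)\<^sup>2) + (app P z \<bullet> app P z + (u \<bullet> z)\<^sup>2) \<noteq> 0"
      proof
        assume "(\<Sum>i\<in>I. \<omega> i * (a i \<bullet> z)\<^sup>2) + (app P z \<bullet> app P z + (u \<bullet> z)\<^sup>2) = 0"
        moreover have "app P z \<bullet> app P z \<ge> 0" "(u \<bullet> z)\<^sup>2 \<ge> 0"
          by simp_all
        ultimately have 0: "(\<Sum>i\<in>I. \<omega> i * (a i \<bullet> z)\<^sup>2) = 0" "app P z \<bullet> app P z = 0" "(u \<bullet> z)\<^sup>2 = 0"
          using psd[of z] by linarith+
        then obtain \<alpha> \<beta> where "z = affcomb P u \<alpha> \<beta>"
          using ker by blast
        then have "z \<bullet> z = \<alpha> \<bullet> app P z + \<beta> * (z \<bullet> u)"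
          by (metis inner_affcomb)
        then show False
          using 0 that by (simp add: inner_commute)
      qed
      then show ?thesis
        using psd[of z] by (simp add: order_less_le)
    qed
    let ?\<Psi>1 = "\<lambda>(x, z). (\<Sum>i\<in>I. wt (fst x) i * (A (snd (snd (snd x))) i \<bullet> z)\<^sup>2) + (app P z \<bullet> app P z + (u \<bullet> z)\<^sup>2)"
    have "\<forall>\<^sub>F x in nhds x0. \<forall>z. z \<noteq> 0 \<longrightarrow> ?\<Psi>1 (x, z) > 0"
    proof (rule eventually_pos_homogeneous)
      show "continuous_on UNIV ?\<Psi>1"
        unfolding split_beta wt_def A_def by (intro continuous_intros)
      show "?\<Psi>1 (x, t *\<^sub>R z) = t\<^sup>2 * ?\<Psi>1 (x, z)" for x t z
        by (simp add: app.scaleR_right sum_distrib_left power2_eq_square algebra_simps)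
      show "?\<Psi>1 (x0, z) > 0" if "z \<noteq> 0" for z
        using base[OF that] by (simp add: x0_def wt_def A_def)
    qed
    then show "\<forall>\<^sub>F x in nhds x0. \<forall>z. z \<noteq> 0 \<longrightarrow> (\<Sum>i\<in>I. wt (fst x) i * (A (snd (snd (snd x))) i \<bullet> z)\<^sup>2) + (app P z \<bullet> app P z + (u \<bullet> z)\<^sup>2) > 0"
      by simp
    let ?\<Psi>2 = "\<lambda>(x, y). \<Sum>j\<in>UNIV. (fst y \<bullet> fst (snd x) $ j + snd y * u $ j) * (fst y \<bullet> P $ j + snd y * u $ j)"
    have "\<forall>\<^sub>F x in nhds x0. \<forall>y. y \<noteq> 0 \<longrightarrow> ?\<Psi>2 (x, y) > 0"
    proof (rule eventually_pos_homogeneous)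
      show "continuous_on UNIV ?\<Psi>2"
        unfolding split_beta by (intro continuous_intros)
      show "?\<Psi>2 (x, t *\<^sub>R y) = t\<^sup>2 * ?\<Psi>2 (x, y)" for x t y
        by (simp add: sum_distrib_left power2_eq_square algebra_simps)
      fix y :: "(real^'d) \<times> real" assume "y \<noteq> 0"
      define k where "k = affcomb P u (fst y) (snd y)"
      have "k \<noteq> 0"
      proof
        assume "k = 0"
        then have "fst y \<bullet> v i = 0" if "i \<in> I" for i
          using inner_affcomb[of "a i" P u "fst y" "snd y"] that by (simp add: k_def au v_def)
        then have "fst y = 0"
          using conic_imp_inner_0[where I = I and v = v, OF conic'] by blast
        moreover obtain j where "u $ j \<noteq> 0"
          using u0 by (auto simp: vec_eq_iff)
        then have "snd y = 0"
          using arg_cong[OF \<open>k = 0\<close>, of "\<lambda>k. k $ j"] \<open>fst y = 0\<close> by (simp add: k_def affcomb_def)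
        ultimately show False
          using \<open>y \<noteq> 0\<close> by (simp add: prod_eq_iff)
      qed
      then have "k \<bullet> k > 0"
        by simp
      then show "?\<Psi>2 (x0, y) > 0"
        by (simp add: k_def inner_vec_def affcomb_def x0_def)
    qed
    then show "\<forall>\<^sub>F x in nhds x0. \<forall>y. y \<noteq> 0 \<longrightarrow> (\<Sum>j\<in>UNIV. (fst y \<bullet> fst (snd x) $ j + snd y * u $ j) * (fst y \<bullet> P $ j + snd y * u $ j)) > 0"
      by simp
    let ?\<Psi>3 = "\<lambda>(x, W). rowmap W (fst (snd x)) \<bullet> rowmap W P0"
    have "\<forall>\<^sub>F x in nhds x0. \<forall>W. W \<noteq> 0 \<longrightarrow> ?\<Psi>3 (x, W) > 0"
    proof (rule eventually_pos_homogeneous)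
      show "continuous_on UNIV ?\<Psi>3"
        unfolding split_beta by (intro continuous_intros)
      show "?\<Psi>3 (x, t *\<^sub>R W) = t\<^sup>2 * ?\<Psi>3 (x, W)" for x t W
        by (simp add: rowmap.scaleR_left power2_eq_square)
      fix W :: "real^'d^'d" assume "W \<noteq> 0"
      have "rowmap W P0 \<noteq> 0"
      proof
        assume "rowmap W P0 = 0"
        then have "W *v v i = 0" if "i \<in> I" for i
          using that by (metis P0a app_rowmap app.zero_left)
        then have "W = 0"
          using symmetric_isotropic_imp_0[where I = I and v = v, OF conic'] by blast
        then show False
          using \<open>W \<noteq> 0\<close> by simp
      qed
      \<comment> \<open>The difference is a \<open>tens u\<close> term, orthogonal to
        \<open>rowmap W P0\<close> by centring.\<close>
      moreover have "rowmap W P \<bullet> rowmap W P0 = rowmap W P0 \<bullet> rowmap W P0"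
      proof -
        have "rowmap W P = rowmap W P0 + tens u (W *v m)"
          by (simp add: P0_def vec_eq_iff rowmap_def tens_def mv.diff_right mv.scaleR_right)
        then show ?thesis
          by (simp add: inner_add_left inner_commute[of "tens _ _"] inner_tens app_rowmap P0u)
      qed
      ultimately show "?\<Psi>3 (x0, W) > 0"
        by (simp add: x0_def)
    qed
    then show "\<forall>\<^sub>F x in nhds x0. \<forall>W. W \<noteq> 0 \<longrightarrow> rowmap W (fst (snd x)) \<bullet> rowmap W P0 > 0"
      by simp
  qed
  then obtain N where "open N" "x0 \<in> N" and N: "\<And>x. x \<in> N \<Longrightarrow> good x"
    unfolding eventually_nhds by blast
  have "\<exists>x. good x \<and> dist x0 x < 1 / Suc n \<and> fst (F x) = 0 \<and> snd (snd (snd x)) > 0" for n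
  proof -
    have "F x0 \<in> interior (F ` (N \<inter> ball x0 (1 / Suc n)))"
      using \<open>open N\<close> \<open>x0 \<in> N\<close>
      by (intro sussmann_open_mapping[OF open_UNIV contF _ derF \<open>bounded_linear g\<close> g])
        (auto simp: interior_open open_Int)
    moreover have "F x0 = (0, 0)"
    proof -
      have "fst (F x0) \<bullet> Y = 0" for Y
      proof -
        have "(\<Sum>i\<in>I. \<omega> i * (app P (a i) \<bullet> app Y (a i))) = (\<Sum>i\<in>I. \<Sum>j\<in>UNIV. (\<omega> i * (a i \<bullet> axis j 1)) *\<^sub>R app P (a i) \<bullet> Y $ j)"
          by (rule sum.cong) (auto simp: app_def[of Y] inner_sum_right sum_distrib_left inner_axis mult.assoc)
        also have "\<dots> = (\<Sum>j\<in>UNIV. (\<Sum>i\<in>I. (\<omega> i * (a i \<bullet> axis j 1)) *\<^sub>R app P (a i)) \<bullet> Y $ j)"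
          by (subst sum.swap) (simp add: inner_sum_left)
        finally show ?thesis
          unfolding x0_def Finner equil by (simp add: wt_def A_def rowmap.zero_left transpose_def zero_vec_def[symmetric])
      qed
      then have "fst (F x0) = 0"
        by (metis inner_eq_zero_iff)
      then show ?thesis
        by (simp add: prod_eq_iff) (simp add: F_def x0_def)
    qed
    ultimately obtain e where "e > 0" and e: "ball (0, 0) e \<subseteq> F ` (N \<inter> ball x0 (1 / Suc n))"
      by (metis mem_interior)
    \<comment> \<open>First component 0 makes the solution exact; the second is any positive value
      below \<open>e\<close>, so that \<open>s > 0\<close>.\<close>
    have "(0, e / 2) \<in> ball (0 :: real^'d^'n, 0 :: real) e"
      using \<open>e > 0\<close> by (simp add: dist_Pair_Pair)
    with e have "(0, e / 2) \<in> F ` (N \<inter> ball x0 (1 / Suc n))"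
      by (rule subsetD)
    then obtain x where "x \<in> N" "dist x0 x < 1 / Suc n" "F x = (0, e / 2)"
      by (elim imageE IntE) (simp add: mem_ball)
    moreover have "snd (F x) = snd (snd (snd x))"
      by (simp add: F_def)
    ultimately show ?thesis
      using N \<open>e > 0\<close> by (intro exI[of _ x]) auto
  qed
  then obtain X where X: "\<And>n. good (X n)" "\<And>n. dist x0 (X n) < 1 / Suc n"
      "\<And>n. fst (F (X n)) = 0" "\<And>n. snd (snd (snd (X n))) > 0"
    by metis
  have "X \<longlonglongrightarrow> x0"
  proof (rule tendsto_dist_iff[THEN iffD2], rule real_tendsto_sandwich[OF _ _ tendsto_const LIMSEQ_inverse_real_of_nat])
    show "\<forall>\<^sub>F n in sequentially. dist (X n) x0 \<le> inverse (real (Suc n))"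
      using X(2) by (intro always_eventually allI) (simp add: dist_commute inverse_eq_divide less_imp_le)
  qed auto
  define T Q c s where "T n = fst (X n)" and "Q n = fst (snd (X n))" and "c n = fst (snd (snd (X n)))"
    and "s n = snd (snd (snd (X n)))" for n
  have X_eq: "X n = (T n, Q n, c n, s n)" for n
    by (simp add: T_def Q_def c_def s_def)
  have FX: "(\<Sum>i\<in>I. wt (T n) i * (app (Q n) (A (s n) i) \<bullet> app Y (A (s n) i)))
      + rowmap (T n - transpose (T n)) P0 \<bullet> Y + c n \<bullet> app Y u = 0" for n Y
    using X(3)[of n] Finner[of "T n" "Q n" "c n" "s n" Y] by (simp add: X_eq)
  have lims: "T \<longlonglongrightarrow> 0" "Q \<longlonglongrightarrow> P" "s \<longlonglongrightarrow> 0"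
    using \<open>X \<longlonglongrightarrow> x0\<close> by (auto simp: T_def[abs_def] Q_def[abs_def] s_def[abs_def] x0_def
        dest: tendsto_fst tendsto_fst[OF tendsto_snd] tendsto_snd[OF tendsto_snd[OF tendsto_snd]])
  \<comment> \<open>The test \<open>tens u (c n)\<close> kills the form because all vectors are
    orthogonal to \<open>u\<close>, and the antisymmetric term by centring.\<close>
  have "c n = 0" for n
    using FX[of n "tens u (c n)"] uu
    by (simp add: app_tens inner_tens app_rowmap P0u uA cong: sum.cong_simp)
  \<comment> \<open>Tested with \<open>rowmap W (Q n)\<close>, the form consists of multiples of
    \<open>x \<bullet> (W *v x) = 0\<close>. The third condition in \<open>good\<close> then forces
    \<open>W = 0\<close>.\<close>
  have sym: "T n - transpose (T n) = 0" for n
  proof -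
    define W where "W = T n - transpose (T n)"
    have "x \<bullet> (W *v x) = 0" for x
      using inner_matrix_adjoint[of x "T n" x]
      by (simp add: W_def mv.diff_left inner_diff_right inner_commute)
    then have "rowmap W P0 \<bullet> rowmap W (Q n) = 0"
      using FX[of n "rowmap W (Q n)"] \<open>c n = 0\<close> by (simp add: app_rowmap W_def)
    then show ?thesis
      using X(1)[of n, unfolded good_def X_eq, THEN conjunct2, THEN conjunct2, rule_format, of W]
      by (auto simp: W_def inner_commute)
  qed
  have eq: "(\<Sum>i\<in>I. (wt (T n) i * (A (s n) i \<bullet> z)) *\<^sub>R app (Q n) (A (s n) i)) = 0" (is "?l = 0") for n z
  proof -
    have "?l \<bullet> ?l = 0"
      using FX[of n "tens z ?l"]
      by (simp add: sym \<open>c n = 0\<close> rowmap.zero_left app_tens inner_sum_left inner_commute[of _ z] mult.assoc)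
    then show ?thesis
      by simp
  qed
  have fin: "(\<Sum>i\<in>I. wt (T n) i * (A (s n) i \<bullet> z)\<^sup>2) \<ge> 0 \<and>
     ((\<Sum>i\<in>I. wt (T n) i * (A (s n) i \<bullet> z)\<^sup>2) = 0 \<longrightarrow> (\<exists>\<alpha> \<beta>. z = affcomb (Q n) u \<alpha> \<beta>))" for n z
  proof -
    have nd: "\<alpha> = 0 \<and> \<beta> = 0" if "app P (affcomb (Q n) u \<alpha> \<beta>) = 0" "u \<bullet> affcomb (Q n) u \<alpha> \<beta> = 0" for \<alpha> \<beta>
    proof -
      have "affcomb (Q n) u \<alpha> \<beta> \<bullet> affcomb P u \<alpha> \<beta> = 0"
        unfolding inner_affcomb[of "affcomb (Q n) u \<alpha> \<beta>" P]
        using that by (simp add: inner_commute[of "affcomb (Q n) u \<alpha> \<beta>" u])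
      then have "\<not> (\<Sum>j\<in>UNIV. (\<alpha> \<bullet> Q n $ j + \<beta> * u $ j) * (\<alpha> \<bullet> P $ j + \<beta> * u $ j)) > 0"
        by (simp add: inner_vec_def[where 'a = real] affcomb_def)
      then have "(\<alpha>, \<beta>) = 0"
        using X(1)[of n, unfolded good_def X_eq, THEN conjunct2, THEN conjunct1, rule_format, of "(\<alpha>, \<beta>)"]
        by auto
      then show ?thesis
        by (simp add: zero_prod_def)
    qed
    have pos: "(\<Sum>i\<in>I. wt (T n) i * (A (s n) i \<bullet> z)\<^sup>2) > 0" if "z \<noteq> 0" "app P z = 0" "u \<bullet> z = 0" for z
      using X(1)[of n, unfolded good_def X_eq, THEN conjunct1, rule_format, OF that(1)] that(2,3)
      by simp
    show ?thesis
      using psd_of_kernel[of I "A (s n)" u "wt (T n)" "Q n" P, OF Au eq nd pos] by blast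
  qed
  show thesis
  proof (rule that[of s Q "\<lambda>n. wt (T n)"])
    show "(\<lambda>n. wt (T n) i) \<longlonglongrightarrow> \<omega> i" for i
      unfolding wt_def using lims by (auto intro!: tendsto_eq_intros)
  qed (use lims X(4) eq fin in \<open>auto simp: A_def s_def\<close>)
qed

section \<open>Stresses on quotients of a graph\<close>

text \<open>The same choice as inside \<open>edge_vec\<close>, so that \<open>edge_diff\<close> is
  the pairing with \<open>edge_vec\<close>. The orientation cancels in products of two
  differences.\<close>

definition src :: "('v, 'e) mgraph \<Rightarrow> 'e \<Rightarrow> 'v" where
  "src G e = (SOME i. i \<in> ends G e)"

definition tgt :: "('v, 'e) mgraph \<Rightarrow> 'e \<Rightarrow> 'v" where
  "tgt G e = other_end G e (src G e)"

definition edge_diff :: "('v, 'e) mgraph \<Rightarrow> ('v \<Rightarrow> 'a::ab_group_add) \<Rightarrow> 'e \<Rightarrow> 'a" where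
  "edge_diff G x e = x (src G e) - x (tgt G e)"

lemma ends_src_tgt:
  assumes "multigraph G" "e \<in> edges G"
  shows "ends G e = {src G e, tgt G e}" "src G e \<noteq> tgt G e" "src G e \<in> verts G" "tgt G e \<in> verts G"
proof -
  have "ends G e \<subseteq> verts G" "card (ends G e) = 2"
    using assms by (auto simp: multigraph_def)
  then obtain i j where ij: "ends G e = {i, j}" "i \<noteq> j"
    by (auto simp: card_2_iff)
  have "src G e \<in> ends G e"
    unfolding src_def by (rule someI[of _ i]) (simp add: ij)
  then have "\<exists>k. ends G e = {src G e, k} \<and> src G e \<noteq> k"
    using ij by auto
  then obtain k where k: "ends G e = {src G e, k}" "src G e \<noteq> k"
    by blast
  then have "tgt G e = k"
    by (simp add: tgt_def other_end_eq)
  then show "ends G e = {src G e, tgt G e}" "src G e \<noteq> tgt G e" "src G e \<in> verts G" "tgt G e \<in> verts G"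
    using k \<open>ends G e \<subseteq> verts G\<close> by auto
qed

text \<open>A rank-maximal semidefinite stress on the edge set \<open>E\<close> of the graph obtained by merging
  the vertices with equal \<open>\<pi>\<close>: functions on the quotient are functions constant on the fibres.\<close>

definition max_rank_stress ::
  "('v, 'e) mgraph \<Rightarrow> 'e set \<Rightarrow> ('v \<Rightarrow> 'c) \<Rightarrow> ('v \<Rightarrow> real ^ 'd) \<Rightarrow> ('e \<Rightarrow> real) \<Rightarrow> bool" where
  "max_rank_stress G E \<pi> p \<omega> \<longleftrightarrow>
     (\<forall>x. (\<forall>a\<in>verts G. \<forall>b\<in>verts G. \<pi> a = \<pi> b \<longrightarrow> x a = x b) \<longrightarrow>
        (\<Sum>e\<in>E. (\<omega> e * edge_diff G x e) *\<^sub>R edge_diff G p e) = 0 \<and>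
        (\<Sum>e\<in>E. \<omega> e * (edge_diff G x e)\<^sup>2) \<ge> 0 \<and>
        ((\<Sum>e\<in>E. \<omega> e * (edge_diff G x e)\<^sup>2) = 0 \<longrightarrow> (\<exists>\<alpha> \<beta>. \<forall>a\<in>verts G. x a = \<alpha> \<bullet> p a + \<beta>)))"

lemma max_rank_stressD:
  assumes "max_rank_stress G E \<pi> p \<omega>"
    and "\<And>a b. \<lbrakk>a \<in> verts G; b \<in> verts G; \<pi> a = \<pi> b\<rbrakk> \<Longrightarrow> x a = x b"
  shows "(\<Sum>e\<in>E. (\<omega> e * edge_diff G x e) *\<^sub>R edge_diff G p e) = 0"
    and "(\<Sum>e\<in>E. \<omega> e * (edge_diff G x e)\<^sup>2) \<ge> 0"
    and "(\<Sum>e\<in>E. \<omega> e * (edge_diff G x e)\<^sup>2) = 0 \<Longrightarrow> \<exists>\<alpha> \<beta>. \<forall>a\<in>verts G. x a = \<alpha> \<bullet> p a + \<beta>"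
proof -
  have "\<forall>a\<in>verts G. \<forall>b\<in>verts G. \<pi> a = \<pi> b \<longrightarrow> x a = x b"
    using assms(2) by blast
  note D = assms(1)[unfolded max_rank_stress_def, THEN spec, THEN mp, OF this]
  show "(\<Sum>e\<in>E. (\<omega> e * edge_diff G x e) *\<^sub>R edge_diff G p e) = 0"
    by (rule D[THEN conjunct1])
  show "(\<Sum>e\<in>E. \<omega> e * (edge_diff G x e)\<^sup>2) \<ge> 0"
    by (rule D[THEN conjunct2, THEN conjunct1])
  show "(\<Sum>e\<in>E. \<omega> e * (edge_diff G x e)\<^sup>2) = 0 \<Longrightarrow> \<exists>\<alpha> \<beta>. \<forall>a\<in>verts G. x a = \<alpha> \<bullet> p a + \<beta>"
    by (rule D[THEN conjunct2, THEN conjunct2, THEN mp])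
qed

text \<open>A coarser quotient has fewer test functions. This is used to replace formal labels of
  the fibres by the positions themselves.\<close>

lemma max_rank_stress_coarsen:
  assumes "max_rank_stress G E \<pi> p \<omega>"
    and "\<And>a b. \<lbrakk>a \<in> verts G; b \<in> verts G; \<pi> a = \<pi> b\<rbrakk> \<Longrightarrow> \<pi>' a = \<pi>' b"
  shows "max_rank_stress G E \<pi>' p \<omega>"
  unfolding max_rank_stress_def
proof (intro allI impI)
  fix x :: "'a \<Rightarrow> real"
  assume x: "\<forall>a\<in>verts G. \<forall>b\<in>verts G. \<pi>' a = \<pi>' b \<longrightarrow> x a = x b"
  have "x a = x b" if "a \<in> verts G" "b \<in> verts G" "\<pi> a = \<pi> b" for a b
    using x assms(2)[OF that] that by blast
  note D = max_rank_stressD[OF assms(1), of x, OF this]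
  show "(\<Sum>e\<in>E. (\<omega> e * edge_diff G x e) *\<^sub>R edge_diff G p e) = 0 \<and>
      (\<Sum>e\<in>E. \<omega> e * (edge_diff G x e)\<^sup>2) \<ge> 0 \<and>
      ((\<Sum>e\<in>E. \<omega> e * (edge_diff G x e)\<^sup>2) = 0 \<longrightarrow> (\<exists>\<alpha> \<beta>. \<forall>v\<in>verts G. x v = \<alpha> \<bullet> p v + \<beta>))"
    using D by blast
qed

text \<open>Condition (ii) of super stability for the edges in \<open>E\<close>: their directions
  lie on no conic at infinity.\<close>

definition conic_free :: "('v, 'e) mgraph \<Rightarrow> 'e set \<Rightarrow> ('v \<Rightarrow> real ^ 'd) \<Rightarrow> bool" where
  "conic_free G E p \<longleftrightarrow> (\<forall>S :: real ^ 'd ^ 'd. transpose S = S \<longrightarrow>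
     (\<forall>e\<in>E. edge_diff G p e \<bullet> (S *v edge_diff G p e) = 0) \<longrightarrow> S = 0)"

text \<open>Positions of the vertices after the vertices with \<open>\<xi> = 1\<close> have moved away from their
  representative \<open>\<rho>\<close> by \<open>s\<close> times the free coordinate \<open>r\<close>.\<close>

definition lift :: "('v \<Rightarrow> 'v) \<Rightarrow> ('v \<Rightarrow> real) \<Rightarrow> 'v \<Rightarrow> real \<Rightarrow> 'a::real_vector ^ 'v::finite \<Rightarrow> 'v \<Rightarrow> 'a" where
  "lift \<rho> \<xi> r s z a = z $ \<rho> a + (s * \<xi> a) *\<^sub>R z $ r"

text \<open>If \<open>Y\<close> is empty the edge \<open>c\<close> is added with weight about \<open>s\<^sup>2\<close>. Otherwise \<open>Y\<close> is split off its
  fibre and the edge \<open>c\<close>, whose length tends to 0, gets weight about \<open>1 / s\<^sup>2\<close>, so that its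
  contribution to the quadratic form survives at \<open>s = 0\<close> as the square of the new coordinate.
  Coordinates outside \<open>R\<close> are not used by the quotient and are killed by the additional squares \<open>Inr v\<close>.\<close>

lemma add_edge_stress:
  fixes G :: "('v::finite, 'e) mgraph" and p :: "'v \<Rightarrow> real ^ 'd"
  assumes G: "multigraph G" and E: "E \<subseteq> edges G" and c: "c \<in> edges G" "c \<notin> E" and V: "verts G \<noteq> {}"
    and stress: "max_rank_stress G E p p \<omega>" and conic: "conic_free G E p"
    and Y: "Y \<subseteq> verts G"
    and fibre: "\<And>a. a \<in> Y \<Longrightarrow> p a = p r"
    and Y_cases: "Y = {} \<or> r \<in> Y \<and> (\<exists>b\<in>verts G - Y. p b = p r) \<and> edge_diff G p c = 0 \<and> (src G c \<in> Y \<longleftrightarrow> tgt G c \<notin> Y)"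
  obtains q :: "nat \<Rightarrow> 'v \<Rightarrow> real ^ 'd" and w :: "nat \<Rightarrow> 'e \<Rightarrow> real" where
    "\<And>a. a \<in> verts G \<Longrightarrow> (\<lambda>n. q n a) \<longlonglongrightarrow> p a" "\<And>e. e \<in> E \<Longrightarrow> (\<lambda>n. w n e) \<longlonglongrightarrow> \<omega> e"
    "eventually (\<lambda>n. w n c > 0) sequentially"
    "\<And>n a b. \<lbrakk>a \<in> verts G; b \<in> verts G; p a = p b; a \<in> Y \<longleftrightarrow> b \<in> Y\<rbrakk> \<Longrightarrow> q n a = q n b"
    "\<And>n. max_rank_stress G (insert c E) (\<lambda>a. (p a, a \<in> Y)) (q n) (w n)"
proof -
  \<comment> \<open>Representatives lie outside \<open>Y\<close>, so the coordinate of a split fibre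
    belongs to the part other than \<open>Y\<close>. The choice depends on \<open>p a\<close>
    only.\<close>
  define \<rho> where "\<rho> a = (SOME b. b \<in> verts G \<and> p b = p a \<and> b \<notin> Y)" for a
  have \<rho>: "\<rho> a \<in> verts G" "p (\<rho> a) = p a" "\<rho> a \<notin> Y" if "a \<in> verts G" for a
  proof -
    have "\<exists>b. b \<in> verts G \<and> p b = p a \<and> b \<notin> Y"
    proof (cases "a \<in> Y")
      case True
      then show ?thesis
        using Y_cases fibre[OF True] by auto
    qed (use that in auto)
    then have "\<rho> a \<in> verts G \<and> p (\<rho> a) = p a \<and> \<rho> a \<notin> Y"
      unfolding \<rho>_def by (rule someI_ex)
    then show "\<rho> a \<in> verts G" "p (\<rho> a) = p a" "\<rho> a \<notin> Y"
      by auto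
  qed
  have \<rho>_eq: "\<rho> a = \<rho> b" if "p a = p b" for a b
    using that by (simp add: \<rho>_def)
  define R1 where "R1 = \<rho> ` verts G"
  \<comment> \<open>Coordinates in use: one per merged vertex, and \<open>r\<close> for the offset
    of \<open>Y\<close> in units of \<open>s\<close>.\<close>
  define R where "R = R1 \<union> (if Y = {} then {} else {r})"
  have R1: "a \<in> verts G" "a \<notin> Y" "\<rho> a = a" if "a \<in> R1" for a
    using that \<rho> by (auto simp: R1_def intro!: \<rho>_eq)
  have \<rho>R1: "\<rho> a \<in> R1" if "a \<in> verts G" for a
    using that by (simp add: R1_def)
  have rY: "r \<in> Y" "r \<in> verts G" "r \<notin> R1" if "Y \<noteq> {}"
  proof -
    show "r \<in> Y"
      using that Y_cases by blast
    then show "r \<in> verts G" "r \<notin> R1"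
      using Y R1(2) by blast+
  qed
  define \<xi> where "\<xi> a = (if a \<in> Y then 1 else 0 :: real)" for a
  \<comment> \<open>In the coordinates of \<open>lift\<close> an edge has the vector
    \<open>D e + s *\<^sub>R D' e\<close>.\<close>
  define D where "D e = axis (\<rho> (src G e)) 1 - (axis (\<rho> (tgt G e)) 1 :: real ^ 'v)" for e
  define D' where "D' e = (\<xi> (src G e) - \<xi> (tgt G e)) *\<^sub>R (axis r 1 :: real ^ 'v)" for e
  \<comment> \<open>Only \<open>c\<close> is rescaled. If \<open>Y\<close> is empty, its vector
    becomes \<open>s *\<^sub>R D c\<close>. Otherwise \<open>D c = 0\<close>, and division by
    \<open>s\<close> leaves \<open>D' c\<close>. Weight 1 for the rescaled vector stands for s^2 or
    1 / s^2 on the edge itself.\<close>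
  define a where "a i = (case i of Inl e \<Rightarrow> if e = c then if Y = {} then 0 else D' c else D e | Inr v \<Rightarrow> axis v 1)" for i :: "'e + 'v"
  define b where "b i = (case i of Inl e \<Rightarrow> if e = c then if Y = {} then D c else 0 else D' e | Inr v \<Rightarrow> 0)" for i :: "'e + 'v"
  define \<omega>' where "\<omega>' i = (case i of Inl e \<Rightarrow> if e = c then 1 else \<omega> e | Inr v \<Rightarrow> 1)" for i :: "'e + 'v"
  define I where "I = insert c E <+> - R"
  define P :: "real ^ 'd ^ 'v" where "P = (\<chi> v. if v \<in> R1 then p v else 0)"
  define u :: "real ^ 'v" where "u = (\<chi> v. if v \<in> R1 then 1 else 0)"
  have "finite (edges G)"
    using G by (simp add: multigraph_def)
  then have finE: "finite E"
    using E finite_subset by blast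
  then have finI: "finite I"
    by (simp add: I_def)
  have inV: "src G e \<in> verts G" "tgt G e \<in> verts G" if "e \<in> insert c E" for e
    using that c E ends_src_tgt[OF G] by auto
  have P\<rho>: "P $ \<rho> v = p v" "u $ \<rho> v = 1" if "v \<in> verts G" for v
    using that \<rho>R1 \<rho> by (auto simp: P_def u_def)
  have Pr: "P $ r = 0" "u $ r = 0" if "Y \<noteq> {}"
    using rY[OF that] by (auto simp: P_def u_def)
  have \<xi>0: "\<xi> v = 0" if "Y = {}" for v
    using that by (simp add: \<xi>_def)
  have D0: "D' e = 0" if "Y = {}" for e
    using that by (simp add: D'_def \<xi>_def)
  have Inr: "a (Inr v) = axis v 1" "b (Inr v) = 0" "\<omega>' (Inr v) = 1" for v
    by (simp_all add: a_def b_def \<omega>'_def)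
  have split_sum: "(\<Sum>i\<in>I. f i) = (\<Sum>e\<in>insert c E. f (Inl e)) + (\<Sum>v\<in>-R. f (Inr v))"
    for f :: "'e + 'v \<Rightarrow> 'z::comm_monoid_add"
    unfolding I_def using finE by (subst sum.Plus) auto
  define k where "k e s = (if e = c then if Y = {} then s else 1 / s else 1)" for e and s :: real
  have c_same: "\<rho> (src G c) = \<rho> (tgt G c)" if "Y \<noteq> {}"
    using that Y_cases by (intro \<rho>_eq) (auto simp: edge_diff_def)
  have inner_lift: "(a (Inl e) + s *\<^sub>R b (Inl e)) \<bullet> z = k e s * edge_diff G (lift \<rho> \<xi> r s z) e"
    if "s > 0" for e s z
    using that c_same \<xi>0 D0
    by (auto simp: a_def b_def k_def edge_diff_def lift_def D_def D'_def inner_add_left inner_diff_left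
        inner_axis' algebra_simps)
  have app_lift: "app Q (a (Inl e) + s *\<^sub>R b (Inl e)) = k e s *\<^sub>R edge_diff G (lift \<rho> \<xi> r s Q) e"
    if "s > 0" for e s and Q :: "real ^ 'd ^ 'v"
    using that c_same \<xi>0 D0
    by (auto simp: a_def b_def k_def edge_diff_def lift_def D_def D'_def app.add_right app.diff_right
        app.scaleR_right app.zero_right algebra_simps)
  have base_inner: "a (Inl e) \<bullet> z = edge_diff G (\<lambda>v. z $ \<rho> v) e" if "e \<in> E" for e z
    using that c by (auto simp: a_def edge_diff_def D_def inner_diff_left inner_axis')
  have base_app: "app P (a (Inl e)) = edge_diff G p e" if "e \<in> E" for e
    using that c inV[of e] by (auto simp: a_def edge_diff_def D_def app.diff_right P\<rho>)
  have base_app_c: "app P (a (Inl c)) = 0"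
    by (auto simp: a_def D'_def app.scaleR_right app.zero_right Pr)
  have P_0: "P $ v = 0" if "v \<notin> R" for v
    using that by (simp add: P_def R_def)
  have sum_E: "(\<Sum>e\<in>insert c E. f e) = f c + (\<Sum>e\<in>E. f e)" for f :: "'e \<Rightarrow> 'z::comm_monoid_add"
    using finE c by simp
  have const: "z $ \<rho> v = z $ \<rho> v'" if "p v = p v'" for z :: "real ^ 'v" and v v'
    using \<rho>_eq[OF that] by simp
  note stressD = max_rank_stressD[OF stress, where x = "\<lambda>v. z $ \<rho> v" for z, OF const]
  have "\<omega>' (Inl c) = 1" "\<And>e. e \<in> E \<Longrightarrow> \<omega>' (Inl e) = \<omega> e"
    using c by (auto simp: \<omega>'_def)
  note \<omega>' = this
  have q_eq: "(\<Sum>i\<in>I. \<omega>' i * (a i \<bullet> z)\<^sup>2) = (a (Inl c) \<bullet> z)\<^sup>2 + (\<Sum>e\<in>E. \<omega> e * (edge_diff G (\<lambda>v. z $ \<rho> v) e)\<^sup>2)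
      + (\<Sum>v\<in>-R. (z $ v)\<^sup>2)" for z
    unfolding split_sum sum_E by (simp add: \<omega>' Inr base_inner inner_axis' cong: sum.cong_simp)
  have qE: "(\<Sum>e\<in>E. \<omega> e * (edge_diff G (\<lambda>v. z $ \<rho> v) e)\<^sup>2) \<ge> 0" for z
    by (rule stressD)

  have u0: "u \<noteq> 0"
    using V P\<rho>(2) by (metis ex_in_conv zero_index zero_neq_one)
  have Du: "D e \<bullet> u = 0" if "e \<in> insert c E" for e
    using P\<rho>(2) inV[OF that] by (simp add: D_def inner_diff_left inner_axis')
  have D'u: "D' e \<bullet> u = 0" for e
    using Pr(2) D0 by (cases "Y = {}") (auto simp: D'_def inner_axis')
  have "a i \<bullet> u = 0 \<and> b i \<bullet> u = 0" if "i \<in> I" for i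
  proof (cases i)
    case (Inl e)
    then show ?thesis
      using that Du D'u by (auto simp: a_def b_def I_def)
  next
    case (Inr v)
    then have "v \<notin> R1"
      using that by (auto simp: I_def R_def)
    then show ?thesis
      by (simp add: Inr a_def b_def inner_axis' u_def)
  qed
  then have au: "a i \<bullet> u = 0" and bu: "b i \<bullet> u = 0" if "i \<in> I" for i
    using that by auto
  have equil0: "(\<Sum>i\<in>I. (\<omega>' i * (a i \<bullet> z)) *\<^sub>R app P (a i)) = 0" for z
  proof -
    have "(\<Sum>e\<in>E. (\<omega> e * edge_diff G (\<lambda>v. z $ \<rho> v) e) *\<^sub>R edge_diff G p e) = 0"
      by (rule stressD)
    then show ?thesis
      unfolding split_sum sum_E
      by (simp add: \<omega>' Inr base_inner base_app base_app_c P_0 cong: sum.cong_simp)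
  qed
  have psd0: "(\<Sum>i\<in>I. \<omega>' i * (a i \<bullet> z)\<^sup>2) \<ge> 0" for z
    unfolding q_eq using qE[of z] by (intro add_nonneg_nonneg sum_nonneg[of "- R"]) auto
  have ker0: "\<exists>\<alpha> \<beta>. z = affcomb P u \<alpha> \<beta>" if q0: "(\<Sum>i\<in>I. \<omega>' i * (a i \<bullet> z)\<^sup>2) = 0" for z
  proof -
    have "(\<Sum>v\<in>-R. (z $ v)\<^sup>2) \<ge> 0" "(a (Inl c) \<bullet> z)\<^sup>2 \<ge> 0"
      by (auto intro: sum_nonneg)
    then have parts: "(\<Sum>v\<in>-R. (z $ v)\<^sup>2) = 0" "(a (Inl c) \<bullet> z)\<^sup>2 = 0"
        "(\<Sum>e\<in>E. \<omega> e * (edge_diff G (\<lambda>v. z $ \<rho> v) e)\<^sup>2) = 0"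
      using q0 qE[of z] unfolding q_eq by linarith+
    then obtain \<alpha> \<beta> where \<alpha>\<beta>: "\<And>v. v \<in> verts G \<Longrightarrow> z $ \<rho> v = \<alpha> \<bullet> p v + \<beta>"
      using stressD(3) by blast
    have "z $ v = 0" if "v \<notin> R1" for v
    proof (cases "v \<in> R")
      case True
      then have "Y \<noteq> {}" "v = r"
        using that by (auto simp: R_def split: if_splits)
      then show ?thesis
        using parts(2) Y_cases by (auto simp: a_def D'_def \<xi>_def inner_axis')
    next
      case False
      then show ?thesis
        using parts(1) by (subst (asm) sum_nonneg_eq_0_iff) auto
    qed
    moreover have "z $ v = \<alpha> \<bullet> p v + \<beta>" if "v \<in> R1" for v
      using \<alpha>\<beta>[of v] R1[OF that] by simp
    ultimately have "z = affcomb P u \<alpha> \<beta>"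
      by (simp add: vec_eq_iff affcomb_def P_def u_def)
    then show ?thesis
      by blast
  qed
  have conic0: "S = 0" if "transpose S = S" "\<And>i. i \<in> I \<Longrightarrow> app P (a i) \<bullet> (S *v app P (a i)) = 0" for S :: "real^'d^'d"
  proof -
    have "edge_diff G p e \<bullet> (S *v edge_diff G p e) = 0" if "e \<in> E" for e
      using \<open>\<And>i. i \<in> I \<Longrightarrow> app P (a i) \<bullet> (S *v app P (a i)) = 0\<close>[of "Inl e"] that
      by (simp add: I_def base_app InlI)
    then show ?thesis
      using conic \<open>transpose S = S\<close> unfolding conic_free_def by blast
  qed
  show thesis
  proof (rule perturbation[OF finI u0 au bu equil0 psd0 ker0 conic0])
    fix s Q w
    assume sQw: "\<And>n. s n > 0" "s \<longlonglongrightarrow> 0" "Q \<longlonglongrightarrow> P" "\<And>i. (\<lambda>n. w n i) \<longlonglongrightarrow> \<omega>' i"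
    and equil: "\<And>n z. (\<Sum>i\<in>I. (w n i * ((a i + s n *\<^sub>R b i) \<bullet> z)) *\<^sub>R app (Q n) (a i + s n *\<^sub>R b i)) = 0"
    and psd: "\<And>n z. (\<Sum>i\<in>I. w n i * ((a i + s n *\<^sub>R b i) \<bullet> z)\<^sup>2) \<ge> 0"
    and ker: "\<And>n z. (\<Sum>i\<in>I. w n i * ((a i + s n *\<^sub>R b i) \<bullet> z)\<^sup>2) = 0 \<Longrightarrow> \<exists>\<alpha> \<beta>. z = affcomb (Q n) u \<alpha> \<beta>"
    define q where "q n = lift \<rho> \<xi> r (s n) (Q n)" for n
    define w' where "w' n e = w n (Inl e) * (k e (s n))\<^sup>2" for n e
    show thesis
    proof (rule that[of q w'])
      show "(\<lambda>n. q n v) \<longlonglongrightarrow> p v" if "v \<in> verts G" for v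
      proof -
        have "(\<lambda>n. Q n $ \<rho> v + (s n * \<xi> v) *\<^sub>R Q n $ r) \<longlonglongrightarrow> P $ \<rho> v + (0 * \<xi> v) *\<^sub>R P $ r"
          by (intro tendsto_intros sQw)
        then show ?thesis
          using P\<rho>(1)[OF that] by (simp add: q_def lift_def)
      qed
      show "(\<lambda>n. w' n e) \<longlonglongrightarrow> \<omega> e" if "e \<in> E" for e
      proof -
        have "e \<noteq> c"
          using that c by auto
        then show ?thesis
          using sQw(4)[of "Inl e"] \<omega>'(2)[OF that] by (simp add: w'_def k_def)
      qed
      have "\<forall>\<^sub>F n in sequentially. w n (Inl c) > 0"
        using sQw(4)[of "Inl c"] by (rule order_tendstoD) (simp add: \<omega>')
      then show "\<forall>\<^sub>F n in sequentially. w' n c > 0"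
        by eventually_elim (use sQw(1) in \<open>auto simp: w'_def k_def less_imp_neq[symmetric]\<close>)
      show "q n v = q n v'" if "v \<in> verts G" "v' \<in> verts G" "p v = p v'" "v \<in> Y \<longleftrightarrow> v' \<in> Y" for n v v'
        using that by (simp add: q_def lift_def \<xi>_def \<rho>_eq[OF \<open>p v = p v'\<close>])
      show "max_rank_stress G (insert c E) (\<lambda>v. (p v, v \<in> Y)) (q n) (w' n)" for n
        unfolding max_rank_stress_def
      proof (intro allI impI)
        fix x :: "'v \<Rightarrow> real"
        assume x: "\<forall>v\<in>verts G. \<forall>v'\<in>verts G. (p v, v \<in> Y) = (p v', v' \<in> Y) \<longrightarrow> x v = x v'"
        have x': "x v = x v'" if "v \<in> verts G" "v' \<in> verts G" "p v = p v'" "v \<in> Y \<longleftrightarrow> v' \<in> Y" for v v'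
          using x that by blast
        \<comment> \<open>Preimage of \<open>x\<close> under \<open>lift\<close>: the entry at
          \<open>r\<close> is the jump of \<open>x\<close> across the split divided by
          \<open>s n\<close>.\<close>
        define z :: "real ^ 'v" where
          "z = (\<chi> v. if v \<in> R1 then x v else if Y \<noteq> {} \<and> v = r then (x r - x (\<rho> r)) / s n else 0)"
        have zx: "lift \<rho> \<xi> r (s n) z v = x v" if "v \<in> verts G" for v
        proof (cases "v \<in> Y")
          case True
          then have "Y \<noteq> {}"
            by blast
          note r = rY[OF this]
          have "x v = x r"
            using that True r fibre[OF True] by (intro x') simp_all
          moreover have "\<rho> v = \<rho> r"
            by (rule \<rho>_eq) (rule fibre[OF True])
          ultimately show ?thesis
            using True \<open>Y \<noteq> {}\<close> r \<rho>R1[of r] sQw(1)[of n] by (simp add: lift_def z_def \<xi>_def)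
        next
          case False
          then have "x (\<rho> v) = x v"
            using \<rho>[OF that] that by (intro x') auto
          then show ?thesis
            using False \<rho>R1[OF that] by (simp add: lift_def z_def \<xi>_def)
        qed
        then have dz: "edge_diff G (lift \<rho> \<xi> r (s n) z) e = edge_diff G x e" if "e \<in> insert c E" for e
          using inV[OF that] by (simp add: edge_diff_def)
        have z0: "z $ v = 0" if "v \<notin> R" for v
          using that by (auto simp: z_def R_def split: if_splits)
        have q: "(\<Sum>i\<in>I. w n i * ((a i + s n *\<^sub>R b i) \<bullet> z)\<^sup>2) = (\<Sum>e\<in>insert c E. w' n e * (edge_diff G x e)\<^sup>2)"
          unfolding split_sum
          by (simp add: inner_lift sQw(1) Inr inner_axis' z0 dz w'_def power_mult_distrib mult.assoc
              cong: sum.cong_simp del: sum.insert sum.insert_if)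
        have "(\<Sum>e\<in>insert c E. (w' n e * edge_diff G x e) *\<^sub>R edge_diff G (q n) e) = 0"
          using equil[of n z] unfolding split_sum
          by (simp add: inner_lift app_lift sQw(1) Inr inner_axis' z0 dz w'_def q_def power2_eq_square
              mult_ac cong: sum.cong_simp del: sum.insert sum.insert_if)
        moreover have "(\<Sum>e\<in>insert c E. w' n e * (edge_diff G x e)\<^sup>2) \<ge> 0"
          using psd[of n z] unfolding q .
        moreover have "\<exists>\<alpha> \<beta>. \<forall>v\<in>verts G. x v = \<alpha> \<bullet> q n v + \<beta>"
          if q0: "(\<Sum>e\<in>insert c E. w' n e * (edge_diff G x e)\<^sup>2) = 0"
        proof -
          obtain \<alpha> \<beta> where \<alpha>\<beta>: "z = affcomb (Q n) u \<alpha> \<beta>"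
            using ker[of n z] q0 unfolding q by blast
          have "x v = \<alpha> \<bullet> q n v + \<beta>" if "v \<in> verts G" for v
          proof -
            have "x v = z $ \<rho> v + s n * \<xi> v * z $ r"
              using zx[OF that] by (simp add: lift_def)
            also have "\<dots> = \<alpha> \<bullet> q n v + \<beta> * (u $ \<rho> v + s n * \<xi> v * u $ r)"
              by (simp add: \<alpha>\<beta> affcomb_def q_def lift_def inner_add_right algebra_simps)
            \<comment> \<open>A constant does not jump across the split, which is why
              \<open>u\<close> is 0 at \<open>r\<close>.\<close>
            also have "u $ \<rho> v + s n * \<xi> v * u $ r = 1"
              using P\<rho>(2)[OF that] Pr(2) by (auto simp: \<xi>_def)
            finally show ?thesis
              by simp
          qed
          then show ?thesis
            by blast
        qed
        ultimately show "(\<Sum>e\<in>insert c E. (w' n e * edge_diff G x e) *\<^sub>R edge_diff G (q n) e) = 0 \<and>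
            (\<Sum>e\<in>insert c E. w' n e * (edge_diff G x e)\<^sup>2) \<ge> 0 \<and>
            ((\<Sum>e\<in>insert c E. w' n e * (edge_diff G x e)\<^sup>2) = 0 \<longrightarrow> (\<exists>\<alpha> \<beta>. \<forall>v\<in>verts G. x v = \<alpha> \<bullet> q n v + \<beta>))"
          by blast
      qed
    qed
  qed
qed

text \<open>The squared norm of \<open>S - transpose S\<close> penalises asymmetry, so that the form
  is positive at every nonzero matrix and the homogeneous criterion applies on the whole matrix
  space.\<close>

lemma conic_free_eventually:
  fixes G :: "('v::finite, 'e) mgraph" and p :: "'v \<Rightarrow> real ^ 'd"
  assumes G: "multigraph G" and E: "E \<subseteq> edges G" and conic: "conic_free G E p"
    and lim: "\<And>a. a \<in> verts G \<Longrightarrow> (\<lambda>n. q n a) \<longlonglongrightarrow> p a"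
  shows "\<forall>\<^sub>F n in sequentially. conic_free G E (q n)"
proof -
  define d :: "real ^ 'd ^ 'v \<Rightarrow> 'e \<Rightarrow> real ^ 'd" where "d x e = x $ src G e - x $ tgt G e" for x e
  let ?\<Psi> = "\<lambda>(x, S). (\<Sum>e\<in>E. (d x e \<bullet> (S *v d x e))\<^sup>2) + (S - transpose S) \<bullet> (S - transpose S)"
  define x0 where "x0 = (\<chi> v. p v)"
  define x where "x n = (\<chi> v. if v \<in> verts G then q n v else p v)" for n
  have "finite (edges G)"
    using G by (simp add: multigraph_def)
  then have fin: "finite E"
    using E finite_subset by blast
  have d: "d x0 e = edge_diff G p e" "d (x n) e = edge_diff G (q n) e" if "e \<in> E" for n e
    using that E ends_src_tgt[OF G, of e] by (auto simp: d_def x0_def x_def edge_diff_def)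
  have "\<forall>\<^sub>F y in nhds x0. \<forall>S. S \<noteq> 0 \<longrightarrow> ?\<Psi> (y, S) > 0"
  proof (rule eventually_pos_homogeneous)
    show "continuous_on UNIV ?\<Psi>"
      unfolding split_beta d_def by (intro continuous_intros)
    show "?\<Psi> (y, t *\<^sub>R S) = t\<^sup>2 * ?\<Psi> (y, S)" for y t S
    proof -
      have "t *\<^sub>R S - transpose (t *\<^sub>R S) = t *\<^sub>R (S - transpose S)"
        by (simp add: linear_cmul[OF bounded_linear.linear[OF bounded_linear_transpose]] algebra_simps)
      then have "(t *\<^sub>R S - transpose (t *\<^sub>R S)) \<bullet> (t *\<^sub>R S - transpose (t *\<^sub>R S))
          = t\<^sup>2 * ((S - transpose S) \<bullet> (S - transpose S))"
        by (simp only: inner_scaleR_left inner_scaleR_right power2_eq_square mult.assoc)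
      then show ?thesis
        by (simp only: prod.case distrib_left) (simp add: mv.scaleR_left sum_distrib_left power_mult_distrib)
    qed
    show "?\<Psi> (x0, S) > 0" if "S \<noteq> 0" for S
    proof -
      have nonneg: "(\<Sum>e\<in>E. (d x0 e \<bullet> (S *v d x0 e))\<^sup>2) \<ge> 0" "(S - transpose S) \<bullet> (S - transpose S) \<ge> 0"
        by (auto intro: sum_nonneg)
      have "?\<Psi> (x0, S) \<noteq> 0"
      proof
        assume "?\<Psi> (x0, S) = 0"
        then have 0: "(\<Sum>e\<in>E. (d x0 e \<bullet> (S *v d x0 e))\<^sup>2) = 0" "(S - transpose S) \<bullet> (S - transpose S) = 0"
          using nonneg by (auto simp: add_nonneg_eq_0_iff)
        have "edge_diff G p e \<bullet> (S *v edge_diff G p e) = 0" if "e \<in> E" for e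
          using 0(1) fin that by (subst (asm) sum_nonneg_eq_0_iff) (auto simp: d)
        moreover have "transpose S = S"
          using 0(2) by simp
        ultimately show False
          using conic that unfolding conic_free_def by blast
      qed
      then show ?thesis
        using nonneg by (simp add: order_less_le)
    qed
  qed
  moreover have "x \<longlonglongrightarrow> x0"
    unfolding x_def x0_def
  proof (rule tendsto_vec_lambda)
    show "(\<lambda>n. if v \<in> verts G then q n v else p v) \<longlonglongrightarrow> p v" for v
      using lim by (cases "v \<in> verts G") auto
  qed
  ultimately have "\<forall>\<^sub>F n in sequentially. \<forall>S. S \<noteq> 0 \<longrightarrow> ?\<Psi> (x n, S) > 0"
    unfolding filterlim_def le_filter_def eventually_filtermap by blast
  then show ?thesis
  proof eventually_elim
    case (elim n)
    show ?case
      unfolding conic_free_def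
    proof (intro allI impI, rule ccontr)
      fix S :: "real ^ 'd ^ 'd"
      assume "transpose S = S" "\<forall>e\<in>E. edge_diff G (q n) e \<bullet> (S *v edge_diff G (q n) e) = 0" "S \<noteq> 0"
      then show False
        using elim[rule_format, of S] by (simp add: d cong: sum.cong_simp)
    qed
  qed
qed

section \<open>Cuts, forces and the invariant of the induction\<close>

definition cut :: "('v, 'e) mgraph \<Rightarrow> 'e set \<Rightarrow> 'v set \<Rightarrow> 'e set" where
  "cut G E X = {e \<in> E. (src G e \<in> X) \<noteq> (tgt G e \<in> X)}"

definition fibre :: "('v, 'e) mgraph \<Rightarrow> ('v \<Rightarrow> 'c) \<Rightarrow> 'v \<Rightarrow> 'v set" where
  "fibre G p v = {u \<in> verts G. p u = p v}"

text \<open>The product of the two differences is independent of the orientation, and the indicator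
  discards edges that do not cross the boundary of \<open>X\<close>. Up to sign this is the total
  force of \<open>F\<close> on \<open>X\<close>.\<close>

definition force :: "('v, 'e) mgraph \<Rightarrow> ('v \<Rightarrow> real ^ 'd) \<Rightarrow> ('e \<Rightarrow> real) \<Rightarrow> 'v set \<Rightarrow> 'e set \<Rightarrow> real ^ 'd" where
  "force G p \<omega> X F = (\<Sum>e\<in>F. (\<omega> e * edge_diff G (indicator X) e) *\<^sub>R edge_diff G p e)"

text \<open>Invariant of the induction, in which fibres of \<open>p\<close> act as vertices; the
  last clause is non-splittability at a merged vertex. Signs are not recorded, since \<sigma> is
  read off from the final stress.\<close>

definition nonsplit_stress :: "('v, 'e) mgraph \<Rightarrow> 'e set \<Rightarrow> ('v \<Rightarrow> real ^ 'd) \<Rightarrow> ('e \<Rightarrow> real) \<Rightarrow> bool" where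
  "nonsplit_stress G E p \<omega> \<longleftrightarrow> E \<subseteq> edges G \<and> (\<forall>e\<in>E. edge_diff G p e \<noteq> 0 \<and> \<omega> e \<noteq> 0) \<and>
     max_rank_stress G E p p \<omega> \<and> conic_free G E p \<and>
     (\<forall>v\<in>verts G. \<forall>F. F \<noteq> {} \<longrightarrow> F \<subset> cut G E (fibre G p v) \<longrightarrow> force G p \<omega> (fibre G p v) F \<noteq> 0)"

lemma edge_diff_indicator_eq_0_iff: "edge_diff G (indicator X :: _ \<Rightarrow> real) e = 0 \<longleftrightarrow> (src G e \<in> X \<longleftrightarrow> tgt G e \<in> X)"
  by (simp add: edge_diff_def indicator_def)

text \<open>The indicator of a union of fibres is an admissible test function for
  equilibrium.\<close>

lemma force_cut:
  assumes "max_rank_stress G E \<pi> p \<omega>" "finite E"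
    and "\<And>a b. \<lbrakk>a \<in> verts G; b \<in> verts G; \<pi> a = \<pi> b\<rbrakk> \<Longrightarrow> a \<in> X \<longleftrightarrow> b \<in> X"
  shows "force G p \<omega> X (cut G E X) = 0"
proof -
  have "indicator X a = (indicator X b :: real)" if "a \<in> verts G" "b \<in> verts G" "\<pi> a = \<pi> b" for a b
    using assms(3)[OF that] by (simp add: indicator_def)
  then have "(\<Sum>e\<in>E. (\<omega> e * edge_diff G (indicator X) e) *\<^sub>R edge_diff G p e) = 0"
    by (rule max_rank_stressD(1)[OF assms(1)])
  moreover have "force G p \<omega> X (cut G E X) = (\<Sum>e\<in>E. (\<omega> e * edge_diff G (indicator X) e) *\<^sub>R edge_diff G p e)"
    unfolding force_def using assms(2)
    by (intro sum.mono_neutral_left) (auto simp: cut_def edge_diff_indicator_eq_0_iff)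
  ultimately show ?thesis
    by simp
qed

lemma force_union: "\<lbrakk>finite A; finite B; A \<inter> B = {}\<rbrakk> \<Longrightarrow> force G p \<omega> X (A \<union> B) = force G p \<omega> X A + force G p \<omega> X B"
  unfolding force_def by (rule sum.union_disjoint)

lemma force_tendsto:
  assumes "multigraph G" "E \<subseteq> edges G" "F \<subseteq> E"
    and "\<And>a. a \<in> verts G \<Longrightarrow> (\<lambda>n. q n a) \<longlonglongrightarrow> p a" "\<And>e. e \<in> E \<Longrightarrow> (\<lambda>n. w n e) \<longlonglongrightarrow> \<omega> e"
  shows "(\<lambda>n. force G (q n) (w n) X F) \<longlonglongrightarrow> force G p \<omega> X F"
  unfolding force_def
proof (rule tendsto_sum)
  fix e assume "e \<in> F"
  then have "e \<in> E" "src G e \<in> verts G" "tgt G e \<in> verts G"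
    using assms(2,3) ends_src_tgt[OF assms(1)] by auto
  then show "(\<lambda>n. (w n e * edge_diff G (indicator X) e) *\<^sub>R edge_diff G (q n) e)
      \<longlonglongrightarrow> (\<omega> e * edge_diff G (indicator X) e) *\<^sub>R edge_diff G p e"
    unfolding edge_diff_def by (intro tendsto_intros assms)
qed

text \<open>The rank condition holds for every \<open>n\<close>, and the other old conditions are
  finitely many open ones. What remains is that \<open>c\<close> has nonzero length and that the
  vertices of the new quotient are non-splittable; both follow from the old non-splittability and
  the equilibrium of the new stress.\<close>

lemma extend_nonsplit_stress:
  fixes G :: "('v::finite, 'e) mgraph" and p :: "'v \<Rightarrow> real ^ 'd"
  assumes G: "multigraph G" and V: "verts G \<noteq> {}"
    and stress: "nonsplit_stress G E p \<omega>" and c: "c \<in> edges G" "c \<notin> E"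
    and Y: "Y \<subseteq> verts G" "\<And>a. a \<in> Y \<Longrightarrow> p a = p r"
    and Y_cases: "Y = {} \<and> edge_diff G p c \<noteq> 0 \<or>
      r \<in> Y \<and> (\<exists>b\<in>verts G - Y. p b = p r) \<and> edge_diff G p c = 0 \<and> (src G c \<in> Y \<longleftrightarrow> tgt G c \<notin> Y) \<and>
      cut G E Y \<noteq> {} \<and> cut G E (fibre G p r - Y) \<noteq> {}"
  obtains q :: "'v \<Rightarrow> real ^ 'd" and w where "nonsplit_stress G (insert c E) q w"
    "\<And>a b. \<lbrakk>a \<in> verts G; b \<in> verts G\<rbrakk> \<Longrightarrow> q a = q b \<longleftrightarrow> p a = p b \<and> (a \<in> Y \<longleftrightarrow> b \<in> Y)"
proof -
  have E: "E \<subseteq> edges G" and rank: "max_rank_stress G E p p \<omega>" and conic: "conic_free G E p"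
    and nondeg: "\<And>e. e \<in> E \<Longrightarrow> edge_diff G p e \<noteq> 0" "\<And>e. e \<in> E \<Longrightarrow> \<omega> e \<noteq> 0"
    and nonsplit: "\<And>v F. \<lbrakk>v \<in> verts G; F \<noteq> {}; F \<subset> cut G E (fibre G p v)\<rbrakk> \<Longrightarrow> force G p \<omega> (fibre G p v) F \<noteq> 0"
    using stress by (auto simp: nonsplit_stress_def)
  have "finite (edges G)"
    using G by (simp add: multigraph_def)
  then have fin: "finite E"
    using E finite_subset by blast
  have inV: "src G e \<in> verts G" "tgt G e \<in> verts G" if "e \<in> insert c E" for e
    using that c E ends_src_tgt[OF G] by auto
  have Y_cases': "Y = {} \<or> r \<in> Y \<and> (\<exists>b\<in>verts G - Y. p b = p r) \<and> edge_diff G p c = 0 \<and> (src G c \<in> Y \<longleftrightarrow> tgt G c \<notin> Y)"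
    using Y_cases by blast
  show thesis
  proof (rule add_edge_stress[OF G E c V rank conic Y Y_cases'])
    fix q :: "nat \<Rightarrow> 'v \<Rightarrow> real ^ 'd" and w :: "nat \<Rightarrow> 'e \<Rightarrow> real"
    assume q: "\<And>a. a \<in> verts G \<Longrightarrow> (\<lambda>n. q n a) \<longlonglongrightarrow> p a" and w: "\<And>e. e \<in> E \<Longrightarrow> (\<lambda>n. w n e) \<longlonglongrightarrow> \<omega> e"
      and wc: "\<forall>\<^sub>F n in sequentially. w n c > 0"
      and q_eq: "\<And>n a b. \<lbrakk>a \<in> verts G; b \<in> verts G; p a = p b; a \<in> Y \<longleftrightarrow> b \<in> Y\<rbrakk> \<Longrightarrow> q n a = q n b"
      and rank': "\<And>n. max_rank_stress G (insert c E) (\<lambda>a. (p a, a \<in> Y)) (q n) (w n)"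
    have "\<forall>\<^sub>F n in sequentially. \<forall>a\<in>verts G. \<forall>b\<in>verts G. p a \<noteq> p b \<longrightarrow> q n a \<noteq> q n b"
    proof (intro eventually_ball_finite ballI finite)
      fix a b assume ab: "a \<in> verts G" "b \<in> verts G"
      show "\<forall>\<^sub>F n in sequentially. p a \<noteq> p b \<longrightarrow> q n a \<noteq> q n b"
      proof (cases "p a = p b")
        case False
        have "(\<lambda>n. q n a - q n b) \<longlonglongrightarrow> p a - p b"
          by (intro tendsto_diff q ab)
        then have "\<forall>\<^sub>F n in sequentially. q n a - q n b \<noteq> 0"
          by (rule tendsto_imp_eventually_ne) (use False in simp)
        then show ?thesis
          by eventually_elim auto
      qed simp
    qed
    moreover have "\<forall>\<^sub>F n in sequentially. \<forall>e\<in>E. w n e \<noteq> 0"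
    proof (intro eventually_ball_finite ballI fin)
      show "\<forall>\<^sub>F n in sequentially. w n e \<noteq> 0" if "e \<in> E" for e
        by (rule tendsto_imp_eventually_ne[OF w[OF that] nondeg(2)[OF that]])
    qed
    moreover have "\<forall>\<^sub>F n in sequentially. \<forall>v\<in>verts G. \<forall>F\<in>Pow E. F \<noteq> {} \<longrightarrow> F \<subset> cut G E (fibre G p v) \<longrightarrow>
        force G (q n) (w n) (fibre G p v) F \<noteq> 0"
    proof (intro eventually_ball_finite ballI)
      fix v F assume v: "v \<in> verts G" and F: "F \<in> Pow E"
      show "\<forall>\<^sub>F n in sequentially. F \<noteq> {} \<longrightarrow> F \<subset> cut G E (fibre G p v) \<longrightarrow> force G (q n) (w n) (fibre G p v) F \<noteq> 0"
      proof (cases "F \<noteq> {} \<and> F \<subset> cut G E (fibre G p v)")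
        case True
        have "(\<lambda>n. force G (q n) (w n) (fibre G p v) F) \<longlonglongrightarrow> force G p \<omega> (fibre G p v) F"
          using F by (intro force_tendsto[OF G E] q w) auto
        then have "\<forall>\<^sub>F n in sequentially. force G (q n) (w n) (fibre G p v) F \<noteq> 0"
          by (rule tendsto_imp_eventually_ne) (use nonsplit[OF v] True in blast)
        then show ?thesis
          by eventually_elim auto
      qed auto
    qed (use fin in auto)
    moreover have "\<forall>\<^sub>F n in sequentially. conic_free G E (q n)"
      by (rule conic_free_eventually[OF G E conic q])
    ultimately have "\<forall>\<^sub>F n in sequentially. (\<forall>a\<in>verts G. \<forall>b\<in>verts G. p a \<noteq> p b \<longrightarrow> q n a \<noteq> q n b) \<and> (\<forall>e\<in>E. w n e \<noteq> 0) \<and>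
       (\<forall>v\<in>verts G. \<forall>F\<in>Pow E. F \<noteq> {} \<longrightarrow> F \<subset> cut G E (fibre G p v) \<longrightarrow> force G (q n) (w n) (fibre G p v) F \<noteq> 0) \<and>
       conic_free G E (q n) \<and> w n c > 0"
      (is "\<forall>\<^sub>F n in _. ?P n")
      using wc by (intro eventually_conj)
    then have "\<exists>n. ?P n"
      by (rule eventually_happens'[OF sequentially_bot])
    then obtain n where n: "?P n"
      by (rule exE)
    have sep: "p a = p b" if "a \<in> verts G" "b \<in> verts G" "q n a = q n b" for a b
      using n that by blast
    have wn: "\<And>e. e \<in> E \<Longrightarrow> w n e \<noteq> 0" "w n c > 0" and conic': "conic_free G E (q n)"
      using n by blast+
    have old: "force G (q n) (w n) (fibre G p v) F \<noteq> 0"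
      if "v \<in> verts G" "F \<noteq> {}" "F \<subset> cut G E (fibre G p v)" for v F
    proof -
      have "F \<in> Pow E"
        using that by (auto simp: cut_def)
      then show ?thesis
        using n that by blast
    qed
    \<comment> \<open>Edges of \<open>E\<close> join different fibres, so one with an end in a part
      \<open>X'\<close> leaves the whole fibre. Forces on a part can therefore be computed at the
      old fibre.\<close>
    have cutE: "cut G E X' \<subseteq> cut G E (fibre G p v)"
        "e \<in> cut G E X' \<Longrightarrow> edge_diff G (indicator X' :: 'v \<Rightarrow> real) e = edge_diff G (indicator (fibre G p v)) e"
      if "X' \<subseteq> fibre G p v" for X' v e
      using that nondeg(1) inV by (fastforce simp: cut_def fibre_def edge_diff_def indicator_def)+
    have force_old: "force G (q n) (w n) X' F = force G (q n) (w n) (fibre G p v) F"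
      if "X' \<subseteq> fibre G p v" "F \<subseteq> cut G E X'" for X' v F
      unfolding force_def using cutE(2)[OF that(1)] that(2) by (intro sum.cong) auto
    have qc: "edge_diff G (q n) c \<noteq> 0"
    proof (cases "Y = {}")
      case True
      then have "p (src G c) \<noteq> p (tgt G c)"
        using Y_cases by (auto simp: edge_diff_def)
      then show ?thesis
        using sep[OF inV[of c]] by (auto simp: edge_diff_def)
    next
      case False
      then have rY: "r \<in> Y" "r \<in> verts G" "cut G E Y \<noteq> {}" "cut G E (fibre G p r - Y) \<noteq> {}" "(src G c \<in> Y) \<noteq> (tgt G c \<in> Y)"
        using Y_cases Y by auto
      have YX: "Y \<subseteq> fibre G p r"
        using Y by (auto simp: fibre_def)
      \<comment> \<open>The other part has a nonempty cut, so the cut of \<open>Y\<close> is a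
        proper subset to which the old non-splittability applies.\<close>
      have "cut G E Y \<noteq> cut G E (fibre G p r)"
      proof
        assume eq: "cut G E Y = cut G E (fibre G p r)"
        obtain e where e: "e \<in> cut G E (fibre G p r - Y)"
          using rY by blast
        then have "e \<in> cut G E (fibre G p r)"
          using cutE(1)[of "fibre G p r - Y" r] by blast
        then have "e \<in> cut G E Y"
          using eq by simp
        then have "p (src G e) = p (tgt G e)"
          using e YX by (auto simp: cut_def fibre_def)
        then show False
          using e nondeg(1)[of e] by (auto simp: cut_def edge_diff_def)
      qed
      then have "force G (q n) (w n) (fibre G p r) (cut G E Y) \<noteq> 0"
        using old[OF rY(2)] rY(3) cutE(1)[OF YX] by blast
      then have "force G (q n) (w n) Y (cut G E Y) \<noteq> 0"
        using force_old[OF YX order_refl] by simp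
      \<comment> \<open>\<open>Y\<close> is a union of classes of \<open>(p a, a \<in> Y)\<close>,
        so its equilibrium is available before \<open>q n\<close> is known to separate the parts.
        Hence \<open>c\<close> balances a nonzero force.\<close>
      moreover have "force G (q n) (w n) Y (cut G (insert c E) Y) = 0"
        using fin by (intro force_cut[OF rank']) auto
      moreover have "cut G (insert c E) Y = {c} \<union> cut G E Y"
        using rY(5) by (auto simp: cut_def)
      moreover have "finite (cut G E Y)" "{c} \<inter> cut G E Y = {}"
        using fin c by (auto simp: cut_def)
      ultimately have "force G (q n) (w n) Y {c} \<noteq> 0"
        using force_union[of "{c}" "cut G E Y" G "q n" "w n" Y] by auto
      then show ?thesis
        by (auto simp: force_def)
    qed
    have q_iff: "q n a = q n b \<longleftrightarrow> p a = p b \<and> (a \<in> Y \<longleftrightarrow> b \<in> Y)" if ab: "a \<in> verts G" "b \<in> verts G" for a b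
    proof
      \<comment> \<open>\<open>q n\<close> is constant on each part, so if the parts met,
        \<open>c\<close> would have length 0.\<close>
      have contra: False if "a \<in> verts G" "b \<in> verts G" "q n a = q n b" "a \<in> Y" "b \<notin> Y" for a b
      proof -
        have pab: "p a = p r" "p b = p r"
          using Y(2)[OF \<open>a \<in> Y\<close>] sep[OF that(1-3)] by auto
        have c': "p (src G c) = p (tgt G c)" "(src G c \<in> Y) \<noteq> (tgt G c \<in> Y)"
          using Y_cases \<open>a \<in> Y\<close> by (auto simp: edge_diff_def)
        then have "p (src G c) = p r" "p (tgt G c) = p r"
          using Y(2) by metis+
        then have "\<exists>s t. {s, t} = {src G c, tgt G c} \<and> s \<in> Y \<and> t \<notin> Y \<and> p s = p r \<and> p t = p r"
          using c' by (cases "src G c \<in> Y") auto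
        then obtain s t where st: "{s, t} = {src G c, tgt G c}" "s \<in> Y" "t \<notin> Y" "p s = p r" "p t = p r"
          by blast
        then have stV: "s \<in> verts G" "t \<in> verts G"
          using inV[of c] by (auto simp: doubleton_eq_iff)
        have "q n s = q n a"
          using stV that st pab by (intro q_eq) simp_all
        moreover have "q n t = q n b"
          using stV that st pab by (intro q_eq) simp_all
        ultimately have "edge_diff G (q n) c = 0"
          using st(1) \<open>q n a = q n b\<close> by (auto simp: edge_diff_def doubleton_eq_iff)
        then show False
          using qc by simp
      qed
      show "p a = p b \<and> (a \<in> Y \<longleftrightarrow> b \<in> Y)" if "q n a = q n b"
        using contra[OF ab that] contra[OF ab(2,1) that[symmetric]] sep[OF ab that] by blast
      show "q n a = q n b" if "p a = p b \<and> (a \<in> Y \<longleftrightarrow> b \<in> Y)"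
        using q_eq ab that by blast
    qed
    have rank_q: "max_rank_stress G (insert c E) (q n) (q n) (w n)"
      by (rule max_rank_stress_coarsen[OF rank']) (simp add: q_iff)
    have new: "force G (q n) (w n) (fibre G (q n) v) F \<noteq> 0"
      if v: "v \<in> verts G" and F: "F \<noteq> {}" "F \<subset> cut G (insert c E) (fibre G (q n) v)" for v F
    proof -
      define Z where "Z = fibre G (q n) v"
      have ZX: "Z \<subseteq> fibre G p v"
        using v by (auto simp: Z_def fibre_def intro: sep)
      have total: "force G (q n) (w n) Z (cut G (insert c E) Z) = 0"
        using fin v by (intro force_cut[OF rank_q]) (auto simp: Z_def fibre_def)
      have finZ: "finite (cut G (insert c E) Z)"
        using fin by (simp add: cut_def)
      \<comment> \<open>A set without \<open>c\<close> consists of old edges. It is either a proper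
        subset of the old cut, or all of it; then \<open>c\<close> is the only edge left out, and
        its force is nonzero.\<close>
      have main: "force G (q n) (w n) Z F \<noteq> 0" if F: "F \<noteq> {}" "F \<subset> cut G (insert c E) Z" "c \<notin> F" for F
      proof -
        have FE: "F \<subseteq> cut G E Z"
          using F by (auto simp: cut_def)
        show ?thesis
        proof (cases "F = cut G E (fibre G p v)")
          case False
          then have "force G (q n) (w n) (fibre G p v) F \<noteq> 0"
            using FE cutE(1)[OF ZX] F v by (intro old) auto
          then show ?thesis
            using force_old[OF ZX FE] by simp
        next
          case True
          then have "F = cut G E Z"
            using FE cutE(1)[OF ZX] by blast
          then have split: "cut G (insert c E) Z = {c} \<union> F" "(src G c \<in> Z) \<noteq> (tgt G c \<in> Z)"
            using F(2) by (auto simp: cut_def split: if_splits)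
          have "force G (q n) (w n) Z {c} \<noteq> 0"
            using wn(2) qc split(2) by (auto simp: force_def edge_diff_indicator_eq_0_iff)
          moreover have "force G (q n) (w n) Z {c} + force G (q n) (w n) Z F = 0"
            using total finZ \<open>c \<notin> F\<close> unfolding split(1) by (subst (asm) force_union) auto
          ultimately show ?thesis
            by auto
        qed
      qed
      show ?thesis
      proof (cases "c \<in> F")
        case False
        then show ?thesis
          using main F by (simp add: Z_def)
      next
        case True
        \<comment> \<open>Complementary sets have opposite forces, and the complement avoids
          \<open>c\<close>.\<close>
        let ?F = "cut G (insert c E) Z - F"
        have "force G (q n) (w n) Z ?F \<noteq> 0"
          using F True by (intro main) (auto simp: Z_def)
        moreover have "force G (q n) (w n) Z F + force G (q n) (w n) Z ?F = force G (q n) (w n) Z (F \<union> ?F)"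
          using finZ F by (intro force_union[symmetric]) (auto simp: Z_def intro: finite_subset)
        moreover have "F \<union> ?F = cut G (insert c E) Z"
          using F by (auto simp: Z_def)
        ultimately show ?thesis
          using total by (auto simp: Z_def)
      qed
    qed
    show thesis
    proof (rule that)
      have "edge_diff G (q n) e \<noteq> 0" if "e \<in> E" for e
        using nondeg(1)[OF that] sep[OF inV[of e]] that by (auto simp: edge_diff_def)
      moreover have "conic_free G (insert c E) (q n)"
        using conic' unfolding conic_free_def by blast
      ultimately show "nonsplit_stress G (insert c E) (q n) (w n)"
        unfolding nonsplit_stress_def using E c wn qc rank_q new by auto
    qed (rule q_iff)
  qed
qed

section \<open>Refining the quotient of a 2-connected graph\<close>

definition connected_in :: "('v, 'e) mgraph \<Rightarrow> 'v set \<Rightarrow> bool" where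
  "connected_in G X \<longleftrightarrow> (\<forall>u\<in>X. \<forall>v\<in>X. (u, v) \<in> (adjacency G \<inter> X \<times> X)\<^sup>*)"

lemma rtrancl_leaves_set:
  assumes "(u, v) \<in> R\<^sup>*" "u \<in> S" "v \<notin> S"
  shows "\<exists>x y. (x, y) \<in> R \<and> x \<in> S \<and> y \<notin> S"
  using assms by (induction rule: rtrancl_induct) auto

lemma sym_adjacency: "sym (adjacency G)"
  by (auto simp: sym_def adjacency_def insert_commute)

lemma connected_in_hub:
  assumes "\<And>x. x \<in> X \<Longrightarrow> (x, a) \<in> (adjacency G \<inter> X \<times> X)\<^sup>*"
  shows "connected_in G X"
  unfolding connected_in_def
proof (intro ballI)
  fix u v assume uv: "u \<in> X" "v \<in> X"
  have "sym ((adjacency G \<inter> X \<times> X)\<^sup>*)"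
    using sym_adjacency[of G] by (intro sym_rtrancl) (auto simp: sym_def)
  then have "(a, v) \<in> (adjacency G \<inter> X \<times> X)\<^sup>*"
    using assms[OF uv(2)] by (meson symD)
  then show "(u, v) \<in> (adjacency G \<inter> X \<times> X)\<^sup>*"
    using assms[OF uv(1)] by (rule rtrancl_trans[rotated])
qed

text \<open>\<open>Y\<close> is the component of \<open>b\<close> in \<open>X - {a}\<close>. A walk
  in \<open>X\<close> from outside \<open>Y\<close> can enter \<open>Y\<close> only from
  \<open>a\<close>, so up to its first visit to \<open>a\<close> it avoids \<open>Y\<close>.\<close>

lemma connected_split:
  assumes X: "connected_in G X" and ab: "a \<in> X" "b \<in> X" "a \<noteq> b"
  obtains Y where "Y \<subseteq> X" "b \<in> Y" "a \<notin> Y" "connected_in G Y" "connected_in G (X - Y)"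
proof -
  define R where "R = adjacency G \<inter> (X - {a}) \<times> (X - {a})"
  define Y where "Y = {y. (y, b) \<in> R\<^sup>*}"
  have YX: "y \<in> X - {a}" if "y \<in> Y" for y
    using that ab unfolding Y_def by (auto simp: R_def elim: converse_rtranclE)
  show thesis
  proof (rule that)
    show "Y \<subseteq> X" "b \<in> Y" "a \<notin> Y"
      using YX by (auto simp: Y_def)
    show "connected_in G Y"
    proof (rule connected_in_hub)
      fix y assume "y \<in> Y"
      then have "(y, b) \<in> R\<^sup>*"
        by (simp add: Y_def)
      then show "(y, b) \<in> (adjacency G \<inter> Y \<times> Y)\<^sup>*"
      proof (induction rule: converse_rtrancl_induct)
        case (step y z)
        then have "y \<in> Y" "z \<in> Y"
          by (auto simp: Y_def)
        then have "(y, z) \<in> adjacency G \<inter> Y \<times> Y"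
          using step.hyps(1) by (auto simp: R_def)
        then show ?case
          using step.IH by (rule converse_rtrancl_into_rtrancl)
      qed simp
    qed
    show "connected_in G (X - Y)"
    proof (rule connected_in_hub)
      fix x assume x: "x \<in> X - Y"
      then have "(x, a) \<in> (adjacency G \<inter> X \<times> X)\<^sup>*"
        using X ab(1) by (auto simp: connected_in_def)
      then show "(x, a) \<in> (adjacency G \<inter> (X - Y) \<times> (X - Y))\<^sup>*"
        using x
      proof (induction rule: converse_rtrancl_induct)
        case (step x z)
        show ?case
        proof (cases "x = a")
          case False
          have "z \<notin> Y"
          proof
            assume "z \<in> Y"
            then have "(x, z) \<in> R"
              using step.hyps(1) step.prems False YX[of z] by (simp add: R_def)
            moreover have "(z, b) \<in> R\<^sup>*"
              using \<open>z \<in> Y\<close> by (simp add: Y_def)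
            ultimately have "x \<in> Y"
              by (simp add: Y_def converse_rtrancl_into_rtrancl)
            then show False
              using step.prems by simp
          qed
          then have "(x, z) \<in> adjacency G \<inter> (X - Y) \<times> (X - Y)" "z \<in> X - Y"
            using step.hyps(1) step.prems by auto
          then show ?thesis
            by (rule converse_rtrancl_into_rtrancl[OF _ step.IH])
        qed simp
      qed simp
    qed
  qed
qed

text \<open>Deleting one vertex \<open>a\<close> of \<open>X\<close> that has a neighbour outside
  leaves the graph connected, so the rest of \<open>X\<close> has another such vertex.\<close>

lemma boundary_vertices:
  assumes G: "k_connected 2 G" and X: "X \<subseteq> verts G" "v \<in> verts G - X"
    and x: "x \<in> X" "x' \<in> X" "x \<noteq> x'"
  obtains a b y z where "a \<in> X" "b \<in> X" "a \<noteq> b" "y \<notin> X" "z \<notin> X" "(a, y) \<in> adjacency G" "(b, z) \<in> adjacency G"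
proof -
  have conn: "(u, w) \<in> (adjacency (delete_vertices G Z))\<^sup>*"
    if "Z \<subseteq> verts G" "card Z < 2" "u \<in> verts G - Z" "w \<in> verts G - Z" for Z u w
    using G that by (auto simp: k_connected_def connected_graph_def delete_vertices_def)
  have adj: "adjacency (delete_vertices G Z) \<subseteq> adjacency G"
      "(u, w) \<in> adjacency (delete_vertices G Z) \<Longrightarrow> u \<notin> Z" for Z u w
    by (auto simp: adjacency_def delete_vertices_def)
  have "(x, v) \<in> (adjacency (delete_vertices G {}))\<^sup>*"
    using X x by (intro conn) auto
  then obtain a y where ay: "(a, y) \<in> adjacency (delete_vertices G {})" "a \<in> X" "y \<notin> X"
    using rtrancl_leaves_set[of x v _ X] X x by blast
  obtain x'' where x'': "x'' \<in> X" "x'' \<noteq> a"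
    using x by metis
  have "(x'', v) \<in> (adjacency (delete_vertices G {a}))\<^sup>*"
    using X x'' ay(2) by (intro conn) auto
  then obtain b z where bz: "(b, z) \<in> adjacency (delete_vertices G {a})" "b \<in> X" "z \<notin> X"
    using rtrancl_leaves_set[of x'' v _ X] X x'' by blast
  then have "b \<noteq> a"
    using adj(2) by blast
  then show thesis
    using that[of a b y z] ay bz adj(1) by blast
qed

text \<open>Without edges, condition (ii) would force the identity matrix to be 0, although d is at
  least 1.\<close>

lemma nonsplit_stress_edges_nonempty:
  fixes p :: "'v \<Rightarrow> real ^ 'd"
  assumes "nonsplit_stress G E p \<omega>"
  shows "E \<noteq> {}"
proof
  assume "E = {}"
  then have "(mat 1 :: real ^ 'd ^ 'd) = 0"
    using assms unfolding nonsplit_stress_def conic_free_def by simp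
  then show False
    by (simp add: vec_eq_iff mat_def split: if_splits)
qed

text \<open>By \<open>full\<close>, edges leaving a fibre carry stress. Separating two vertices with
  neighbours outside therefore gives both parts a nonempty cut, and connectivity of the fibre
  supplies an edge \<open>c\<close> between the parts.\<close>

lemma split_fibre:
  fixes G :: "('v::finite, 'e) mgraph" and p :: "'v \<Rightarrow> real ^ 'd"
  assumes G: "multigraph G" "k_connected 2 G"
    and stress: "nonsplit_stress G E p \<omega>"
    and conn: "\<And>v. v \<in> verts G \<Longrightarrow> connected_in G (fibre G p v)"
    and full: "\<And>e. \<lbrakk>e \<in> edges G; edge_diff G p e \<noteq> 0\<rbrakk> \<Longrightarrow> e \<in> E"
    and x: "x \<in> verts G" "x' \<in> verts G" "x \<noteq> x'" "p x = p x'"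
  obtains c and q :: "'v \<Rightarrow> real ^ 'd" and w where "c \<in> edges G" "c \<notin> E" "nonsplit_stress G (insert c E) q w"
    "\<And>v. v \<in> verts G \<Longrightarrow> connected_in G (fibre G q v)"
proof -
  define X where "X = fibre G p x"
  have X: "X \<subseteq> verts G" "x \<in> X" "x' \<in> X"
    using x by (auto simp: X_def fibre_def)
  have E: "E \<subseteq> edges G" "\<And>e. e \<in> E \<Longrightarrow> edge_diff G p e \<noteq> 0"
    using stress by (auto simp: nonsplit_stress_def)
  obtain e where e: "e \<in> E"
    using nonsplit_stress_edges_nonempty[OF stress] by blast
  \<comment> \<open>An edge of nonzero length has an end outside \<open>X\<close>, so the fibre is
    not the whole graph.\<close>
  then have "p (src G e) \<noteq> p (tgt G e)" "src G e \<in> verts G" "tgt G e \<in> verts G"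
    using E(1) E(2)[OF e] ends_src_tgt[OF G(1), of e] by (auto simp: edge_diff_def)
  then have "src G e \<in> verts G - X \<or> tgt G e \<in> verts G - X"
    by (auto simp: X_def fibre_def)
  then obtain v where v: "v \<in> verts G - X"
    by blast
  obtain a b y z where ab: "a \<in> X" "b \<in> X" "a \<noteq> b" "y \<notin> X" "z \<notin> X" "(a, y) \<in> adjacency G" "(b, z) \<in> adjacency G"
    using boundary_vertices[OF G(2) X(1) v X(2,3) x(3)] .
  have connX: "connected_in G X"
    unfolding X_def by (rule conn[OF x(1)])
  obtain Y where Y: "Y \<subseteq> X" "b \<in> Y" "a \<notin> Y" "connected_in G Y" "connected_in G (X - Y)"
    using connected_split[OF connX ab(1-3)] .
  have pX: "p u = p b" if "u \<in> X" for u
    using that ab(2) by (simp add: X_def fibre_def)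
  have Xb: "fibre G p b = X"
    using ab(2) by (auto simp: X_def fibre_def)
  have "(b, a) \<in> (adjacency G \<inter> X \<times> X)\<^sup>*"
    using connX ab by (auto simp: connected_in_def)
  then obtain s t where st: "(s, t) \<in> adjacency G \<inter> X \<times> X" "s \<in> Y" "t \<notin> Y"
    using rtrancl_leaves_set[OF _ Y(2,3)] by blast
  then obtain c where c: "c \<in> edges G" "ends G c = {s, t}"
    by (auto simp: adjacency_def)
  then have c_ends: "{src G c, tgt G c} = {s, t}"
    using ends_src_tgt(1)[OF G(1), of c] by simp
  have ps: "p s = p b" "p t = p b"
    using st(1) by (auto intro: pX)
  have c0: "edge_diff G p c = 0"
    using c_ends ps by (auto simp: edge_diff_def doubleton_eq_iff)
  have cE: "c \<notin> E"
    using E(2) c0 by blast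
  have cut: "cut G E Z \<noteq> {}" if "Z \<subseteq> X" "i \<in> Z" "j \<notin> X" and ij: "(i, j) \<in> adjacency G" for Z i j
  proof -
    obtain f where f: "f \<in> edges G" "ends G f = {i, j}"
      using ij by (auto simp: adjacency_def)
    then have f_ends: "{src G f, tgt G f} = {i, j}"
      using ends_src_tgt(1)[OF G(1), of f] by simp
    have "j \<in> verts G"
      using f G(1) by (auto simp: multigraph_def)
    then have "p j \<noteq> p i"
      using that pX[of i] by (auto simp: Xb[symmetric] fibre_def)
    then have "f \<in> E"
      using f_ends by (intro full f) (auto simp: edge_diff_def doubleton_eq_iff)
    then have "f \<in> cut G E Z"
      using f_ends that by (auto simp: cut_def doubleton_eq_iff)
    then show ?thesis
      by blast
  qed
  have "cut G E Y \<noteq> {}" "cut G E (fibre G p b - Y) \<noteq> {}"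
    using cut[of Y b z] cut[of "X - Y" a y] ab Y by (auto simp: Xb)
  moreover have "\<exists>u\<in>verts G - Y. p u = p b"
    using ab(1) Y(3) X(1) pX by blast
  moreover have "src G c \<in> Y \<longleftrightarrow> tgt G c \<notin> Y"
    using c_ends st by (auto simp: doubleton_eq_iff)
  ultimately have cases: "Y = {} \<and> edge_diff G p c \<noteq> 0 \<or>
      b \<in> Y \<and> (\<exists>u\<in>verts G - Y. p u = p b) \<and> edge_diff G p c = 0 \<and> (src G c \<in> Y \<longleftrightarrow> tgt G c \<notin> Y) \<and>
      cut G E Y \<noteq> {} \<and> cut G E (fibre G p b - Y) \<noteq> {}"
    using Y(2) c0 by blast
  have V: "verts G \<noteq> {}" and YV: "Y \<subseteq> verts G" and pY: "\<And>u. u \<in> Y \<Longrightarrow> p u = p b"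
    using x(1) Y(1) X(1) pX by auto
  show thesis
  proof (rule extend_nonsplit_stress[OF G(1) V stress c(1) cE YV pY cases])
    fix q :: "'v \<Rightarrow> real ^ 'd" and w
    assume q: "nonsplit_stress G (insert c E) q w"
      and q_iff: "\<And>u u'. \<lbrakk>u \<in> verts G; u' \<in> verts G\<rbrakk> \<Longrightarrow> q u = q u' \<longleftrightarrow> p u = p u' \<and> (u \<in> Y \<longleftrightarrow> u' \<in> Y)"
    have "connected_in G (fibre G q u)" if u: "u \<in> verts G" for u
    proof -
      have fib: "fibre G q u = {u' \<in> fibre G p u. u' \<in> Y \<longleftrightarrow> u \<in> Y}"
        using q_iff[OF _ u] by (auto simp: fibre_def)
      show ?thesis
      proof (cases "u \<in> X")
        case True
        then have "fibre G p u = X"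
          by (auto simp: X_def fibre_def)
        then have "fibre G q u = (if u \<in> Y then Y else X - Y)"
          using fib Y(1) by auto
        then show ?thesis
          using Y(4,5) by simp
      next
        case False
        then have "u \<notin> Y" "u' \<notin> Y" if "u' \<in> fibre G p u" for u'
          using that u Y(1) by (auto simp: X_def fibre_def)
        then have "fibre G q u = fibre G p u"
          using fib False Y(1) by auto
        then show ?thesis
          using conn[OF u] by simp
      qed
    qed
    then show thesis
      using that[OF c(1) cE q] by blast
  qed
qed

text \<open>Induction on the number of edges without stress. A fibre is split only when all missing
  edges have length 0; once \<open>p\<close> is injective, no edge has length 0 since there are no
  loops.\<close>

theorem injective_nonsplit_stress:
  fixes G :: "('v::finite, 'e) mgraph" and p :: "'v \<Rightarrow> real ^ 'd"
  assumes G: "multigraph G" "k_connected 2 G"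
    and "nonsplit_stress G E p \<omega>" "\<And>v. v \<in> verts G \<Longrightarrow> connected_in G (fibre G p v)"
  shows "\<exists>(q :: 'v \<Rightarrow> real ^ 'd) w. nonsplit_stress G (edges G) q w \<and> inj_on q (verts G)"
  using assms(3,4)
proof (induction "card (edges G - E)" arbitrary: E p \<omega> rule: less_induct)
  case less
  have fin: "finite (edges G)"
    using G(1) by (simp add: multigraph_def)
  have smaller: "card (edges G - insert c E) < card (edges G - E)" if "c \<in> edges G" "c \<notin> E" for c
    using that fin by (intro psubset_card_mono) auto
  have E: "E \<subseteq> edges G"
    using less.prems(1) by (simp add: nonsplit_stress_def)
  show ?case
  proof (cases "\<exists>c\<in>edges G - E. edge_diff G p c \<noteq> 0")
    case True
    then obtain c where c: "c \<in> edges G" "c \<notin> E" "edge_diff G p c \<noteq> 0"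
      by blast
    have V: "verts G \<noteq> {}"
      using ends_src_tgt(3)[OF G(1) c(1)] by blast
    show ?thesis
    proof (rule extend_nonsplit_stress[OF G(1) V less.prems(1) c(1,2), of "{}"])
      fix q :: "'v \<Rightarrow> real ^ 'd" and w
      assume q: "nonsplit_stress G (insert c E) q w"
        and q_iff: "\<And>a b. \<lbrakk>a \<in> verts G; b \<in> verts G\<rbrakk> \<Longrightarrow> q a = q b \<longleftrightarrow> p a = p b \<and> (a \<in> {} \<longleftrightarrow> b \<in> {})"
      have "fibre G q v = fibre G p v" if "v \<in> verts G" for v
        using q_iff that by (auto simp: fibre_def)
      then show ?thesis
        using less.hyps[OF smaller[OF c(1,2)] q] less.prems(2) by simp
    qed (use c in auto)
  next
    case False
    then have full: "e \<in> E" if "e \<in> edges G" "edge_diff G p e \<noteq> 0" for e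
      using that by blast
    show ?thesis
    proof (cases "inj_on p (verts G)")
      case True
      have "edges G \<subseteq> E"
      proof
        fix e assume e: "e \<in> edges G"
        then have "edge_diff G p e \<noteq> 0"
          using ends_src_tgt[OF G(1) e] True by (auto simp: edge_diff_def inj_on_def)
        then show "e \<in> E"
          by (rule full[OF e])
      qed
      then have "E = edges G"
        using E by blast
      then show ?thesis
        using less.prems(1) True by blast
    next
      case False
      then obtain x x' where x: "x \<in> verts G" "x' \<in> verts G" "x \<noteq> x'" "p x = p x'"
        by (auto simp: inj_on_def)
      show ?thesis
      proof (rule split_fibre[OF G less.prems full x])
        fix c w and q :: "'v \<Rightarrow> real ^ 'd"
        assume "c \<in> edges G" "c \<notin> E" "nonsplit_stress G (insert c E) q w"
          "\<And>v. v \<in> verts G \<Longrightarrow> connected_in G (fibre G q v)"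
        then show ?thesis
          using less.hyps[OF smaller] by blast
      qed
    qed
  qed
qed

section \<open>Branch sets of minors\<close>

text \<open>Branch sets are the fibres of \<phi> on \<open>U\<close>. Minor operations keep the
  names of edges, so only vertices are mapped.\<close>

definition minor_model :: "('v, 'e) mgraph \<Rightarrow> ('w, 'e) mgraph \<Rightarrow> 'v set \<Rightarrow> ('v \<Rightarrow> 'w) \<Rightarrow> bool" where
  "minor_model G G' U \<phi> \<longleftrightarrow> U \<subseteq> verts G \<and> \<phi> ` U = verts G' \<and>
     (\<forall>a\<in>verts G'. connected_in G {x \<in> U. \<phi> x = a}) \<and> edges G' \<subseteq> edges G \<and>
     (\<forall>e\<in>edges G'. ends G e \<subseteq> U \<and> ends G' e = \<phi> ` ends G e)"

lemma connected_in_mono: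
  "\<lbrakk>(x, y) \<in> (adjacency G \<inter> A \<times> A)\<^sup>*; A \<subseteq> B\<rbrakk> \<Longrightarrow> (x, y) \<in> (adjacency G \<inter> B \<times> B)\<^sup>*"
  by (erule rtrancl_mono[THEN subsetD, rotated]) auto

lemma connected_in_union:
  assumes A: "connected_in G A" and B: "connected_in G B" and xy: "x \<in> A" "y \<in> B" "(x, y) \<in> adjacency G"
  shows "connected_in G (A \<union> B)"
proof (rule connected_in_hub)
  fix z assume "z \<in> A \<union> B"
  then consider "z \<in> A" | "z \<in> B"
    by blast
  then show "(z, x) \<in> (adjacency G \<inter> (A \<union> B) \<times> (A \<union> B))\<^sup>*"
  proof cases
    case 1
    then have "(z, x) \<in> (adjacency G \<inter> A \<times> A)\<^sup>*"
      using A xy by (simp add: connected_in_def)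
    then show ?thesis
      by (rule connected_in_mono) simp
  next
    case 2
    then have "(z, y) \<in> (adjacency G \<inter> B \<times> B)\<^sup>*"
      using B xy by (simp add: connected_in_def)
    then have "(z, y) \<in> (adjacency G \<inter> (A \<union> B) \<times> (A \<union> B))\<^sup>*"
      by (rule connected_in_mono) simp
    moreover have "(y, x) \<in> adjacency G \<inter> (A \<union> B) \<times> (A \<union> B)"
      using xy sym_adjacency[of G] by (auto dest: symD)
    ultimately show ?thesis
      by (rule rtrancl_into_rtrancl)
  qed
qed

lemma connected_in_singleton: "connected_in G {x}"
  by (simp add: connected_in_def)

text \<open>Deleting a vertex drops its branch set from \<open>U\<close>; contracting an edge unites
  two branch sets, and that edge keeps the union connected.\<close>

lemma minor_model_step:
  assumes G: "multigraph G" and model: "minor_model G G' U \<phi>" and step: "minor_step G' G''"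
  shows "\<exists>U \<phi>. minor_model G G'' U \<phi>"
  using step
proof cases
  case (edge_deletion e)
  then have "minor_model G G'' U \<phi>"
    using model by (auto simp: minor_model_def delete_edge_def)
  then show ?thesis
    by blast
next
  case (vertex_deletion v)
  have "{x \<in> {x \<in> U. \<phi> x \<noteq> v}. \<phi> x = a} = {x \<in> U. \<phi> x = a}" if "a \<noteq> v" for a
    using that by auto
  then have "minor_model G G'' {x \<in> U. \<phi> x \<noteq> v} \<phi>"
    using model unfolding vertex_deletion(1) minor_model_def
    by (auto simp: delete_vertices_def)
  then show ?thesis
    by blast
next
  case (edge_contraction e u v)
  let ?\<phi> = "\<lambda>x. if \<phi> x = v then u else \<phi> x"
  have e: "e \<in> edges G" "ends G e \<subseteq> U" "\<phi> ` ends G e = {u, v}"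
    using model edge_contraction by (auto simp: minor_model_def)
  then have "u \<in> \<phi> ` ends G e" "v \<in> \<phi> ` ends G e"
    by simp_all
  then obtain x y where xy: "x \<in> ends G e" "y \<in> ends G e" "\<phi> x = u" "\<phi> y = v"
    by auto
  have "card (ends G e) = 2"
    using G e(1) by (simp add: multigraph_def)
  then have "ends G e = {x, y}"
    using xy \<open>u \<noteq> v\<close> by (auto simp: card_2_iff)
  then have "(x, y) \<in> adjacency G"
    using e(1) by (auto simp: adjacency_def)
  moreover have "u \<in> verts G'" "v \<in> verts G'"
    using model xy e(2) by (auto simp: minor_model_def)
  ultimately have "connected_in G ({x \<in> U. \<phi> x = u} \<union> {x \<in> U. \<phi> x = v})"
    using model xy e(2) by (intro connected_in_union[of G _ _ x y]) (auto simp: minor_model_def)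
  moreover have "{x \<in> U. ?\<phi> x = u} = {x \<in> U. \<phi> x = u} \<union> {x \<in> U. \<phi> x = v}"
    by auto
  moreover have "{x \<in> U. ?\<phi> x = a} = {x \<in> U. \<phi> x = a}" if "a \<noteq> u" "a \<noteq> v" for a
    using that by auto
  ultimately have "connected_in G {x \<in> U. ?\<phi> x = a}" if "a \<in> verts G' - {v}" for a
    using that model by (cases "a = u") (auto simp: minor_model_def)
  moreover have "?\<phi> ` U = verts G' - {v}"
  proof -
    have "\<phi> ` U = verts G'"
      using model by (simp add: minor_model_def)
    then show ?thesis
      using \<open>u \<in> verts G'\<close> \<open>v \<in> verts G'\<close> \<open>u \<noteq> v\<close> by (auto simp: image_iff split: if_splits)
  qed
  ultimately have "minor_model G G'' U ?\<phi>"
    using model unfolding edge_contraction(1) minor_model_def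
    by (auto simp: contract_def image_image)
  then show ?thesis
    by blast
qed

lemma minor_steps_model:
  assumes "multigraph G" "minor_step\<^sup>*\<^sup>* G G'"
  shows "\<exists>U \<phi>. minor_model G G' U \<phi>"
  using assms(2)
proof (induction rule: rtranclp_induct)
  case base
  have "minor_model G G (verts G) id"
    using assms(1) by (auto simp: minor_model_def multigraph_def connected_in_def)
  then show ?case
    by blast
next
  case (step G' G'')
  then show ?case
    using minor_model_step[OF assms(1)] by blast
qed

text \<open>A vertex outside \<open>U\<close> with a neighbour in \<open>U\<close> joins the branch
  set of that neighbour. Edges of the minor have their ends in \<open>U\<close>, so their images are
  unaffected.\<close>

lemma minor_model_spanning:
  assumes G: "multigraph G" "\<And>u v. \<lbrakk>u \<in> verts G; v \<in> verts G\<rbrakk> \<Longrightarrow> (u, v) \<in> (adjacency G)\<^sup>*"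
    and "minor_model G G' U \<phi>" "U \<noteq> {}"
  shows "\<exists>\<phi>. minor_model G G' (verts G) \<phi>"
  using assms(3,4)
proof (induction "card (verts G - U)" arbitrary: U \<phi> rule: less_induct)
  case less
  have U: "U \<subseteq> verts G" "\<phi> ` U = verts G'" "\<And>a. a \<in> verts G' \<Longrightarrow> connected_in G {x \<in> U. \<phi> x = a}"
      "edges G' \<subseteq> edges G" "\<And>e. e \<in> edges G' \<Longrightarrow> ends G e \<subseteq> U" "\<And>e. e \<in> edges G' \<Longrightarrow> ends G' e = \<phi> ` ends G e"
    using less.prems by (auto simp: minor_model_def)
  show ?case
  proof (cases "U = verts G")
    case True
    then show ?thesis
      using less.prems by blast
  next
    case False
    then obtain u v where "u \<in> U" "v \<in> verts G - U"
      using less.prems(2) U(1) by blast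
    then obtain x y where xy: "(x, y) \<in> adjacency G" "x \<in> U" "y \<notin> U"
      using rtrancl_leaves_set[OF G(2)[of u v]] U(1) by blast
    then have y: "y \<in> verts G"
      using G(1) by (auto simp: adjacency_def multigraph_def)
    have conn: "connected_in G {z \<in> insert y U. (\<phi>(y := \<phi> x)) z = a}" if "a \<in> verts G'" for a
    proof (cases "a = \<phi> x")
      case True
      then have "{z \<in> insert y U. (\<phi>(y := \<phi> x)) z = a} = {z \<in> U. \<phi> z = a} \<union> {y}"
        using xy by auto
      then show ?thesis
        using connected_in_union[OF U(3)[OF that] connected_in_singleton, of x y] xy True by simp
    next
      case False
      then have "{z \<in> insert y U. (\<phi>(y := \<phi> x)) z = a} = {z \<in> U. \<phi> z = a}"
        using xy by auto
      then show ?thesis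
        using U(3)[OF that] by simp
    qed
    have "minor_model G G' (insert y U) (\<phi>(y := \<phi> x))"
      unfolding minor_model_def
    proof (intro conjI ballI)
      show "insert y U \<subseteq> verts G"
        using U(1) y by simp
      show "(\<phi>(y := \<phi> x)) ` insert y U = verts G'"
        using xy by (auto simp: U(2)[symmetric])
      fix e assume e: "e \<in> edges G'"
      then show "ends G e \<subseteq> insert y U"
        using U(5) by blast
      have "(\<phi>(y := \<phi> x)) ` ends G e = \<phi> ` ends G e"
        using U(5)[OF e] xy(3) by (intro image_cong) auto
      then show "ends G' e = (\<phi>(y := \<phi> x)) ` ends G e"
        using U(6)[OF e] by simp
    qed (use U(4) conn in auto)
    moreover have "card (verts G - insert y U) < card (verts G - U)"
      using y xy(3) G(1) by (intro psubset_card_mono) (auto simp: multigraph_def)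
    ultimately show ?thesis
      using less.hyps by blast
  qed
qed

lemma minor_branch_map:
  fixes G :: "('v, 'e) mgraph" and H :: "('w, 'f) mgraph"
  assumes G: "multigraph G" "k_connected 2 G" and H: "verts H \<noteq> {}" and minor: "is_minor H G"
  obtains E \<Phi> \<psi> where "E \<subseteq> edges G" "\<Phi> ` verts G = verts H" "bij_betw \<psi> E (edges H)"
    "\<And>e. e \<in> E \<Longrightarrow> ends H (\<psi> e) = \<Phi> ` ends G e"
    "\<And>a. a \<in> verts H \<Longrightarrow> connected_in G {x \<in> verts G. \<Phi> x = a}"
proof -
  obtain G' where "minor_step\<^sup>*\<^sup>* G G'" and iso: "isomorphic G' H"
    using minor by (auto simp: is_minor_def)
  then obtain U \<phi> where model: "minor_model G G' U \<phi>"
    using minor_steps_model[OF G(1)] by blast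
  obtain f \<psi> where f: "bij_betw f (verts G') (verts H)" "bij_betw \<psi> (edges G') (edges H)"
      "\<And>e. e \<in> edges G' \<Longrightarrow> ends H (\<psi> e) = f ` ends G' e"
    using iso by (auto simp: isomorphic_def)
  have "U \<noteq> {}"
    using model f(1) H by (auto simp: minor_model_def bij_betw_def)
  moreover have "(u, v) \<in> (adjacency G)\<^sup>*" if "u \<in> verts G" "v \<in> verts G" for u v
  proof -
    have "connected_graph (delete_vertices G {})"
      using G(2) by (auto simp: k_connected_def)
    then show ?thesis
      using that by (simp add: connected_graph_def delete_vertices_def adjacency_def)
  qed
  ultimately obtain \<phi>' where m: "minor_model G G' (verts G) \<phi>'"
    using minor_model_spanning[OF G(1) _ model] by blast
  show thesis
  proof (rule that[of "edges G'" "f \<circ> \<phi>'" \<psi>])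
    show "edges G' \<subseteq> edges G"
      using m by (simp add: minor_model_def)
    show "(f \<circ> \<phi>') ` verts G = verts H"
      unfolding image_comp[symmetric] using m f(1) by (simp add: minor_model_def bij_betw_def)
    show "ends H (\<psi> e) = (f \<circ> \<phi>') ` ends G e" if "e \<in> edges G'" for e
      using m f(3)[OF that] that by (simp add: minor_model_def image_comp)
    show "connected_in G {x \<in> verts G. (f \<circ> \<phi>') x = a}" if "a \<in> verts H" for a
    proof -
      obtain b where b: "b \<in> verts G'" "a = f b"
        using f(1) \<open>a \<in> verts H\<close> unfolding bij_betw_def by blast
      have "{x \<in> verts G. (f \<circ> \<phi>') x = a} = {x \<in> verts G. \<phi>' x = b}"
        using m f(1) b by (auto simp: minor_model_def bij_betw_def dest: inj_onD)
      then show ?thesis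
        using m b by (simp add: minor_model_def)
    qed
  qed (rule f(2))
qed

text \<open>Functions constant on the branch sets are functions on \<open>H\<close>, so the
  conditions transfer once orientations are matched.\<close>

lemma nonsplit_stress_branch_map:
  fixes G :: "('v, 'e) mgraph" and H :: "('w, 'f) mgraph" and p :: "'w \<Rightarrow> real ^ 'd"
  assumes G: "multigraph G" and H: "multigraph H" and E: "E \<subseteq> edges G"
    and \<Phi>: "\<Phi> ` verts G = verts H" and \<psi>: "bij_betw \<psi> E (edges H)"
    and ends: "\<And>e. e \<in> E \<Longrightarrow> ends H (\<psi> e) = \<Phi> ` ends G e"
    and stress: "nonsplit_stress H (edges H) p \<omega>" and inj: "inj_on p (verts H)"
  shows "nonsplit_stress G E (\<lambda>v. p (\<Phi> v)) (\<lambda>e. \<omega> (\<psi> e))"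
proof -
  have \<psi>E: "\<psi> e \<in> edges H" if "e \<in> E" for e
    using \<psi> that by (auto simp: bij_betw_def)
  have \<Phi>V: "\<Phi> v \<in> verts H" if "v \<in> verts G" for v
    using \<Phi> that by blast
  have inV: "src G e \<in> verts G" "tgt G e \<in> verts G" if "e \<in> E" for e
    using that E ends_src_tgt[OF G] by auto
  \<comment> \<open>The arbitrary orientations in \<open>G\<close> and \<open>H\<close> may
    disagree; this sign cancels in products of two differences.\<close>
  define \<epsilon> :: "'e \<Rightarrow> real" where "\<epsilon> e = (if src H (\<psi> e) = \<Phi> (src G e) then 1 else - 1)" for e
  have swap: "(src H (\<psi> e) = \<Phi> (src G e) \<and> tgt H (\<psi> e) = \<Phi> (tgt G e)) \<or>
      (src H (\<psi> e) \<noteq> \<Phi> (src G e) \<and> src H (\<psi> e) = \<Phi> (tgt G e) \<and> tgt H (\<psi> e) = \<Phi> (src G e))" if "e \<in> E" for e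
  proof -
    have "{src H (\<psi> e), tgt H (\<psi> e)} = {\<Phi> (src G e), \<Phi> (tgt G e)}" "src H (\<psi> e) \<noteq> tgt H (\<psi> e)"
      using ends_src_tgt(1,2)[OF H \<psi>E[OF that]] ends_src_tgt(1)[OF G subsetD[OF E that]] ends[OF that] by auto
    then show ?thesis
      by (auto simp: doubleton_eq_iff)
  qed
  have ed: "edge_diff G (\<lambda>v. y (\<Phi> v)) e = \<epsilon> e * edge_diff H y (\<psi> e)" if "e \<in> E" for y :: "'w \<Rightarrow> real" and e
    using swap[OF that] by (auto simp: edge_diff_def \<epsilon>_def)
  have ed': "edge_diff G (\<lambda>v. p (\<Phi> v)) e = \<epsilon> e *\<^sub>R edge_diff H p (\<psi> e)" if "e \<in> E" for e
    using swap[OF that] by (auto simp: edge_diff_def \<epsilon>_def)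
  have \<epsilon>2: "\<epsilon> e * \<epsilon> e = 1" "\<epsilon> e \<noteq> 0" for e
    by (auto simp: \<epsilon>_def)
  have \<epsilon>3: "\<epsilon> e * (\<epsilon> e * t) = t" for e t
    by (auto simp: \<epsilon>_def)
  have edH: "edge_diff H p f \<noteq> 0" "\<omega> f \<noteq> 0" if "f \<in> edges H" for f
    using stress that by (auto simp: nonsplit_stress_def)
  have rank: "max_rank_stress H (edges H) p p \<omega>" and conic: "conic_free H (edges H) p"
    using stress by (auto simp: nonsplit_stress_def)
  have reindex: "(\<Sum>e\<in>F. h (\<psi> e)) = (\<Sum>f\<in>\<psi> ` F. h f)" if "F \<subseteq> E" for F and h :: "'f \<Rightarrow> 'z::comm_monoid_add"
    using \<psi> that by (subst sum.reindex) (auto simp: bij_betw_def intro: inj_on_subset)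
  have \<psi>_img: "\<psi> ` E = edges H"
    using \<psi> by (simp add: bij_betw_def)
  show ?thesis
    unfolding nonsplit_stress_def
  proof (intro conjI ballI allI impI E)
    show "edge_diff G (\<lambda>v. p (\<Phi> v)) e \<noteq> 0" "\<omega> (\<psi> e) \<noteq> 0" if "e \<in> E" for e
      using edH[OF \<psi>E[OF that]] \<epsilon>2 by (simp_all add: ed'[OF that])
    show "conic_free G E (\<lambda>v. p (\<Phi> v))"
      unfolding conic_free_def
    proof (intro allI impI)
      fix S :: "real ^ 'd ^ 'd"
      assume S: "transpose S = S" "\<forall>e\<in>E. edge_diff G (\<lambda>v. p (\<Phi> v)) e \<bullet> (S *v edge_diff G (\<lambda>v. p (\<Phi> v)) e) = 0"
      then have "\<forall>e\<in>E. edge_diff H p (\<psi> e) \<bullet> (S *v edge_diff H p (\<psi> e)) = 0"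
        by (simp add: ed' \<epsilon>2 mv.scaleR_right)
      then have "\<forall>f\<in>edges H. edge_diff H p f \<bullet> (S *v edge_diff H p f) = 0"
        by (simp flip: \<psi>_img)
      then show "S = 0"
        using conic S(1) unfolding conic_free_def by blast
    qed
    show "max_rank_stress G E (\<lambda>v. p (\<Phi> v)) (\<lambda>v. p (\<Phi> v)) (\<lambda>e. \<omega> (\<psi> e))"
      unfolding max_rank_stress_def
    proof (intro allI impI)
      fix x :: "'v \<Rightarrow> real"
      assume x: "\<forall>a\<in>verts G. \<forall>b\<in>verts G. p (\<Phi> a) = p (\<Phi> b) \<longrightarrow> x a = x b"
      \<comment> \<open>\<open>x\<close> is constant on branch sets, so the chosen preimage does not
        matter.\<close>
      define y where "y w = x (SOME v. v \<in> verts G \<and> \<Phi> v = w)" for w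
      have xy: "x v = y (\<Phi> v)" if "v \<in> verts G" for v
      proof -
        have "(SOME v'. v' \<in> verts G \<and> \<Phi> v' = \<Phi> v) \<in> verts G \<and> \<Phi> (SOME v'. v' \<in> verts G \<and> \<Phi> v' = \<Phi> v) = \<Phi> v"
          using that by (intro someI[of "\<lambda>v'. v' \<in> verts G \<and> \<Phi> v' = \<Phi> v" v]) simp
        then show ?thesis
          unfolding y_def using x that by metis
      qed
      have edx: "edge_diff G x e = \<epsilon> e * edge_diff H y (\<psi> e)" if "e \<in> E" for e
        using ed[OF that, of y] inV[OF that] by (simp add: edge_diff_def xy)
      note D = max_rank_stressD[OF rank, of y]
      have y: "y a = y b" if "a \<in> verts H" "b \<in> verts H" "p a = p b" for a b
        using inj_onD[OF inj that(3,1,2)] by simp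
      have s1: "(\<Sum>e\<in>E. (\<omega> (\<psi> e) * edge_diff G x e) *\<^sub>R edge_diff G (\<lambda>v. p (\<Phi> v)) e)
          = (\<Sum>f\<in>edges H. (\<omega> f * edge_diff H y f) *\<^sub>R edge_diff H p f)"
        using reindex[of E "\<lambda>f. (\<omega> f * edge_diff H y f) *\<^sub>R edge_diff H p f"]
        by (simp add: edx ed' \<psi>_img mult_ac \<epsilon>3 cong: sum.cong_simp)
      have s2: "(\<Sum>e\<in>E. \<omega> (\<psi> e) * (edge_diff G x e)\<^sup>2) = (\<Sum>f\<in>edges H. \<omega> f * (edge_diff H y f)\<^sup>2)"
        using reindex[of E "\<lambda>f. \<omega> f * (edge_diff H y f)\<^sup>2"]
        by (simp add: edx \<psi>_img power2_eq_square mult_ac \<epsilon>3 cong: sum.cong_simp)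
      show "(\<Sum>e\<in>E. (\<omega> (\<psi> e) * edge_diff G x e) *\<^sub>R edge_diff G (\<lambda>v. p (\<Phi> v)) e) = 0 \<and>
          (\<Sum>e\<in>E. \<omega> (\<psi> e) * (edge_diff G x e)\<^sup>2) \<ge> 0 \<and>
          ((\<Sum>e\<in>E. \<omega> (\<psi> e) * (edge_diff G x e)\<^sup>2) = 0 \<longrightarrow>
            (\<exists>\<alpha> \<beta>. \<forall>a\<in>verts G. x a = \<alpha> \<bullet> p (\<Phi> a) + \<beta>))"
        unfolding s1 s2
      proof (intro conjI impI D(1,2) y)
        assume "(\<Sum>f\<in>edges H. \<omega> f * (edge_diff H y f)\<^sup>2) = 0"
        then obtain \<alpha> \<beta> where "\<forall>b\<in>verts H. y b = \<alpha> \<bullet> p b + \<beta>"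
          using D(3)[OF y] by blast
        then show "\<exists>\<alpha> \<beta>. \<forall>a\<in>verts G. x a = \<alpha> \<bullet> p (\<Phi> a) + \<beta>"
          using xy \<Phi>V by auto
      qed
    qed
    fix v F
    assume v: "v \<in> verts G" and F: "F \<noteq> {}" "F \<subset> cut G E (fibre G (\<lambda>v. p (\<Phi> v)) v)"
    define Z where "Z = fibre H p (\<Phi> v)"
    have Z: "u \<in> fibre G (\<lambda>v. p (\<Phi> v)) v \<longleftrightarrow> \<Phi> u \<in> Z" if "u \<in> verts G" for u
      using that \<Phi>V by (auto simp: fibre_def Z_def)
    have cut_iff: "e \<in> cut G E (fibre G (\<lambda>v. p (\<Phi> v)) v) \<longleftrightarrow> \<psi> e \<in> cut H (edges H) Z" if "e \<in> E" for e
      unfolding cut_def mem_Collect_eq Z[OF inV(1)[OF that]] Z[OF inV(2)[OF that]]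
      using swap[OF that] that \<psi>E[OF that] by metis
    have FE: "F \<subseteq> E"
      using F by (auto simp: cut_def)
    have "\<psi> ` F \<subset> cut H (edges H) Z"
    proof -
      have "\<psi> ` F \<subseteq> cut H (edges H) Z"
        using F FE cut_iff by blast
      moreover obtain e where e: "e \<in> cut G E (fibre G (\<lambda>v. p (\<Phi> v)) v)" "e \<notin> F"
        using F by blast
      then have "e \<in> E"
        by (simp add: cut_def)
      then have "\<psi> e \<in> cut H (edges H) Z" "\<psi> e \<notin> \<psi> ` F"
        using e cut_iff \<psi> FE by (auto simp: bij_betw_def inj_on_def)
      ultimately show ?thesis
        by blast
    qed
    then have "force H p \<omega> Z (\<psi> ` F) \<noteq> 0"
      using stress[unfolded nonsplit_stress_def, THEN conjunct2, THEN conjunct2, THEN conjunct2, THEN conjunct2,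
        rule_format, OF \<Phi>V[OF v], of "\<psi> ` F"] F(1) by (simp add: Z_def)
    moreover have "force G (\<lambda>v. p (\<Phi> v)) (\<lambda>e. \<omega> (\<psi> e)) (fibre G (\<lambda>v. p (\<Phi> v)) v) F = force H p \<omega> Z (\<psi> ` F)"
    proof -
      have "edge_diff G (indicator (fibre G (\<lambda>v. p (\<Phi> v)) v) :: 'v \<Rightarrow> real) e = \<epsilon> e * edge_diff H (indicator Z) (\<psi> e)"
        if "e \<in> F" for e
        using ed[of e "indicator Z"] that FE Z[of "src G e"] Z[of "tgt G e"] inV[of e]
        by (auto simp: edge_diff_def indicator_def)
      then show ?thesis
        unfolding force_def using FE
        by (subst reindex[OF FE, symmetric], intro sum.cong) (auto simp: ed' subsetD mult_ac \<epsilon>3)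
    qed
    ultimately show "force G (\<lambda>v. p (\<Phi> v)) (\<lambda>e. \<omega> (\<psi> e)) (fibre G (\<lambda>v. p (\<Phi> v)) v) F \<noteq> 0"
      by simp
  qed
qed

section \<open>Super stability\<close>

lemma edge_vec_eq: "edge_vec G e = axis (src G e) 1 - axis (tgt G e) 1"
  by (simp add: edge_vec_def Let_def src_def tgt_def)

lemma inner_edge_vec: "edge_vec G e \<bullet> z = edge_diff G (($) z) e"
  by (simp add: edge_vec_eq edge_diff_def inner_diff_left inner_axis')

lemma app_edge_vec: "app P (edge_vec G e) = edge_diff G (($) P) e"
  by (simp add: edge_vec_eq edge_diff_def app.diff_right)

lemma outer_mult: "outer x *v y = (x \<bullet> y) *\<^sub>R x"
  by (simp add: outer_def columnvector_def rowvector_def matrix_matrix_mult_def matrix_vector_mult_def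
      vec_eq_iff inner_vec_def sum_distrib_left mult_ac)

lemma laplacian_mult: "laplacian G \<omega> *v z = (\<Sum>e\<in>edges G. (\<omega> e * edge_diff G (($) z) e) *\<^sub>R edge_vec G e)"
  by (simp add: laplacian_def mv.sum_left mv.scaleR_left outer_mult inner_edge_vec)

lemma inner_laplacian:
  "y \<bullet> (laplacian G \<omega> *v z) = (\<Sum>e\<in>edges G. \<omega> e * edge_diff G (($) z) e * edge_diff G (($) y) e)"
  by (simp add: laplacian_mult inner_sum_right inner_commute[of y] inner_edge_vec)

lemma transpose_laplacian: "transpose (laplacian G \<omega>) = laplacian G \<omega>"
  by (simp add: laplacian_def transpose_def vec_eq_iff outer_def columnvector_def rowvector_def
      matrix_matrix_mult_def mult.commute)

lemma pos_semidef_laplacian_iff: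
  "pos_semidef (laplacian G \<omega>) \<longleftrightarrow> (\<forall>z. (\<Sum>e\<in>edges G. \<omega> e * (edge_diff G (($) z) e)\<^sup>2) \<ge> 0)"
  by (simp add: pos_semidef_def transpose_laplacian inner_laplacian power2_eq_square mult.assoc)

text \<open>The form is minimal at \<open>x\<close>, so its derivative in the direction
  \<open>A *v x\<close> vanishes; that derivative is a multiple of |A x|^2.\<close>

lemma pos_semidef_kernel:
  fixes A :: "real ^ 'n ^ 'n"
  assumes A: "pos_semidef A" and x: "x \<bullet> (A *v x) = 0"
  shows "A *v x = 0"
proof -
  define y where "y = A *v x"
  define k where "k = y \<bullet> (A *v y)"
  have k: "k \<ge> 0"
    using A by (simp add: pos_semidef_def k_def)
  have Ax: "A *v x = y" "x \<bullet> y = 0" and Ay: "y \<bullet> (A *v y) = k"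
    using x by (simp_all add: y_def k_def)
  have "transpose A = A"
    using A by (simp add: pos_semidef_def)
  then have sym: "x \<bullet> (A *v y) = y \<bullet> y"
    using inner_matrix_adjoint[of x A y] by (simp add: Ax)
  have "0 \<le> (x - t *\<^sub>R y) \<bullet> (A *v (x - t *\<^sub>R y))" for t
    using A by (simp add: pos_semidef_def)
  moreover have "(x - t *\<^sub>R y) \<bullet> (A *v (x - t *\<^sub>R y)) = t * t * k - 2 * t * (y \<bullet> y)" for t
    by (simp add: mv.diff_right mv.scaleR_right inner_diff_left inner_diff_right Ax Ay sym algebra_simps)
  ultimately have le: "2 * t * (y \<bullet> y) \<le> t * t * k" for t
    by (metis diff_ge_0_iff_ge)
  show ?thesis
  proof (rule ccontr)
    assume "A *v x \<noteq> 0"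
    then have c: "y \<bullet> y > 0"
      by (simp add: y_def)
    \<comment> \<open>Small enough for the linear term to dominate; \<open>k + 1\<close> also covers
      \<open>k = 0\<close>.\<close>
    define t where "t = (y \<bullet> y) / (k + 1)"
    have t: "t > 0" "t * (k + 1) = y \<bullet> y"
      using c k by (simp_all add: t_def)
    have "t * (2 * (y \<bullet> y)) \<le> t * (t * k)"
      using le[of t] by (simp only: mult_ac)
    then have "2 * (t * (k + 1)) \<le> t * k"
      unfolding t(2) using t(1) by simp
    then have "t * k + 2 * t \<le> 0"
      by (simp add: algebra_simps)
    then show False
      using t(1) k by (smt (verit) mult_nonneg_nonneg)
  qed
qed

lemma incident_eq_cut:
  assumes "multigraph G"
  shows "incident G v = cut G (edges G) {v}"
proof -
  have "v \<in> ends G e \<longleftrightarrow> (src G e \<in> {v}) \<noteq> (tgt G e \<in> {v})" if "e \<in> edges G" for e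
    using ends_src_tgt(1,2)[OF assms that] by auto
  then show ?thesis
    by (auto simp: incident_def cut_def)
qed

lemma force_vertex:
  assumes G: "multigraph G" and F: "F \<subseteq> incident G v"
  shows "force G p \<omega> {v} F = - (\<Sum>f\<in>F. \<omega> f *\<^sub>R (p (other_end G f v) - p v))"
  unfolding force_def sum_negf[symmetric]
proof (rule sum.cong)
  fix f assume "f \<in> F"
  then have f: "f \<in> edges G" "v \<in> ends G f"
    using F by (auto simp: incident_def)
  note st = ends_src_tgt[OF G f(1)]
  show "(\<omega> f * edge_diff G (indicator {v}) f) *\<^sub>R edge_diff G p f = - (\<omega> f *\<^sub>R (p (other_end G f v) - p v))"
  proof (cases "v = src G f")
    case True
    then have "other_end G f v = tgt G f"
      by (simp add: tgt_def)
    then show ?thesis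
      using True st(2) by (simp add: edge_diff_def indicator_def algebra_simps)
  next
    case False
    then have "v = tgt G f"
      using f(2) st(1) by auto
    moreover have "other_end G f v = src G f"
      using st(1) \<open>v = tgt G f\<close> by (intro other_end_eq) auto
    ultimately show ?thesis
      using st(2) by (simp add: edge_diff_def indicator_def algebra_simps)
  qed
qed simp

lemma equilibrium_stress_iff:
  assumes "multigraph G"
  shows "equilibrium_stress G p \<omega> \<longleftrightarrow> (\<forall>v\<in>verts G. force G p \<omega> {v} (incident G v) = 0)"
  by (simp add: equilibrium_stress_def force_vertex[OF assms order_refl])

text \<open>Equilibrium at a vertex is the identity tested with its indicator, and indicators span
  all functions on the vertices.\<close>

lemma equilibrium_stress_weak:
  fixes G :: "('v::finite, 'e) mgraph"
  assumes G: "multigraph G" and eq: "equilibrium_stress G p \<omega>"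
  shows "(\<Sum>e\<in>edges G. (\<omega> e * edge_diff G x e) *\<^sub>R edge_diff G p e) = 0"
proof -
  have fin: "finite (edges G)"
    using G by (simp add: multigraph_def)
  have zero: "(\<Sum>e\<in>edges G. (\<omega> e * edge_diff G (indicator {v}) e) *\<^sub>R edge_diff G p e) = 0" if "v \<in> verts G" for v
  proof -
    have "(\<Sum>e\<in>edges G. (\<omega> e * edge_diff G (indicator {v}) e) *\<^sub>R edge_diff G p e) = force G p \<omega> {v} (cut G (edges G) {v})"
      unfolding force_def using fin
      by (intro sum.mono_neutral_right) (auto simp: cut_def edge_diff_def indicator_def)
    then show ?thesis
      using eq that by (simp add: equilibrium_stress_iff[OF G] incident_eq_cut[OF G])
  qed
  have "edge_diff G x e = (\<Sum>v\<in>verts G. x v * edge_diff G (indicator {v}) e)" if "e \<in> edges G" for e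
    using ends_src_tgt[OF G that]
    by (simp add: edge_diff_def right_diff_distrib sum_subtractf indicator_def if_distrib cong: if_cong)
  then have "(\<Sum>e\<in>edges G. (\<omega> e * edge_diff G x e) *\<^sub>R edge_diff G p e)
      = (\<Sum>e\<in>edges G. \<Sum>v\<in>verts G. x v *\<^sub>R ((\<omega> e * edge_diff G (indicator {v}) e) *\<^sub>R edge_diff G p e))"
    by (intro sum.cong) (auto simp: sum_distrib_left scaleR_sum_left mult_ac)
  also have "\<dots> = (\<Sum>v\<in>verts G. x v *\<^sub>R (\<Sum>e\<in>edges G. (\<omega> e * edge_diff G (indicator {v}) e) *\<^sub>R edge_diff G p e))"
    by (subst sum.swap) (simp add: scaleR_sum_right)
  finally show ?thesis
    by (simp add: zero)
qed

section \<open>Affine functions and the kernel of the Laplacian\<close>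

definition aff_fun :: "('v::finite, 'e) mgraph \<Rightarrow> ('v \<Rightarrow> real ^ 'd) \<Rightarrow> (real ^ 'd) \<times> real \<Rightarrow> real ^ 'v" where
  "aff_fun G p y = (\<chi> v. if v \<in> verts G then fst y \<bullet> p v + snd y else 0)"

lemma linear_aff_fun: "linear (aff_fun G p)"
  by (rule linearI) (auto simp: aff_fun_def vec_eq_iff inner_add_left algebra_simps)

lemma edge_diff_aff_fun:
  assumes "multigraph G" "e \<in> edges G"
  shows "edge_diff G (($) (aff_fun G p y)) e = fst y \<bullet> edge_diff G p e"
  using ends_src_tgt[OF assms] by (simp add: edge_diff_def aff_fun_def inner_diff_right)

lemma inj_aff_fun:
  fixes G :: "('v::finite, 'e) mgraph"
  assumes G: "multigraph G" and V: "verts G \<noteq> {}" and conic: "conic_free G (edges G) p"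
  shows "inj (aff_fun G p)"
  unfolding linear_injective_0[OF linear_aff_fun]
proof (intro allI impI)
  fix y assume y: "aff_fun G p y = 0"
  have "fst y = 0"
  proof (rule conic_imp_inner_0[where I = "edges G" and v = "edge_diff G p"])
    show "S = 0" if "transpose S = S" "\<And>e. e \<in> edges G \<Longrightarrow> edge_diff G p e \<bullet> (S *v edge_diff G p e) = 0" for S
      using conic that unfolding conic_free_def by blast
    show "fst y \<bullet> edge_diff G p e = 0" if "e \<in> edges G" for e
      using edge_diff_aff_fun[OF G that, of p y] by (simp add: y edge_diff_def)
  qed
  moreover obtain v where "v \<in> verts G"
    using V by blast
  ultimately have "snd y = 0"
    using arg_cong[OF y, of "\<lambda>z. z $ v"] by (simp add: aff_fun_def)
  then show "y = 0"
    using \<open>fst y = 0\<close> by (simp add: prod_eq_iff)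
qed

lemma dim_range_aff_fun:
  fixes G :: "('v::finite, 'e) mgraph" and p :: "'v \<Rightarrow> real ^ 'd"
  assumes "inj (aff_fun G p)"
  shows "dim (range (aff_fun G p)) = CARD('d) + 1"
  using dim_image_eq[OF linear_aff_fun, of G p UNIV] assms by simp

lemma range_aff_fun:
  "range (aff_fun G p) = {z. (\<forall>a. a \<notin> verts G \<longrightarrow> z $ a = 0) \<and> (\<exists>\<alpha> \<beta>. \<forall>a\<in>verts G. z $ a = \<alpha> \<bullet> p a + \<beta>)}"
proof (intro equalityI subsetI)
  fix z assume "z \<in> {z. (\<forall>a. a \<notin> verts G \<longrightarrow> z $ a = 0) \<and> (\<exists>\<alpha> \<beta>. \<forall>a\<in>verts G. z $ a = \<alpha> \<bullet> p a + \<beta>)}"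
  then obtain \<alpha> \<beta> where "\<forall>a. a \<notin> verts G \<longrightarrow> z $ a = 0" "\<forall>a\<in>verts G. z $ a = \<alpha> \<bullet> p a + \<beta>"
    by blast
  then have "z = aff_fun G p (\<alpha>, \<beta>)"
    by (simp add: aff_fun_def vec_eq_iff)
  then show "z \<in> range (aff_fun G p)"
    by blast
qed (fastforce simp: aff_fun_def)

lemma range_aff_fun_subset_kernel:
  assumes G: "multigraph G" and eq: "equilibrium_stress G p \<omega>"
  shows "range (aff_fun G p) \<subseteq> laplacian_kernel G \<omega>"
proof clarify
  fix \<alpha> \<beta>
  have "y \<bullet> (laplacian G \<omega> *v aff_fun G p (\<alpha>, \<beta>)) = 0" for y
  proof -
    have "y \<bullet> (laplacian G \<omega> *v aff_fun G p (\<alpha>, \<beta>)) = \<alpha> \<bullet> (\<Sum>e\<in>edges G. (\<omega> e * edge_diff G (($) y) e) *\<^sub>R edge_diff G p e)"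
      by (simp add: inner_laplacian edge_diff_aff_fun[OF G] inner_sum_right mult_ac cong: sum.cong_simp)
    then show ?thesis
      by (simp add: equilibrium_stress_weak[OF G eq])
  qed
  then have "laplacian G \<omega> *v aff_fun G p (\<alpha>, \<beta>) = 0"
    by (metis inner_eq_zero_iff)
  then show "aff_fun G p (\<alpha>, \<beta>) \<in> laplacian_kernel G \<omega>"
    by (simp add: laplacian_kernel_def aff_fun_def)
qed

text \<open>Affine functions of the points lie in the kernel of every equilibrium stress and already
  have dimension d + 1, so they exhaust this kernel.\<close>

lemma super_stable_max_rank_stress:
  fixes G :: "('v::finite, 'e) mgraph" and p :: "'v \<Rightarrow> real ^ 'd"
  assumes G: "multigraph G" and V: "verts G \<noteq> {}" and conic: "conic_free G (edges G) p"
    and eq: "equilibrium_stress G p \<omega>" and psd: "pos_semidef (laplacian G \<omega>)"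
    and dim: "dim (laplacian_kernel G \<omega>) = CARD('d) + 1"
  shows "max_rank_stress G (edges G) id p \<omega>"
  unfolding max_rank_stress_def
proof (intro allI impI conjI)
  fix x :: "'v \<Rightarrow> real"
  define z where "z = (\<chi> v. if v \<in> verts G then x v else 0)"
  have z: "edge_diff G (($) z) e = edge_diff G x e" if "e \<in> edges G" for e
    using ends_src_tgt[OF G that] by (simp add: edge_diff_def z_def)
  show "(\<Sum>e\<in>edges G. (\<omega> e * edge_diff G x e) *\<^sub>R edge_diff G p e) = 0"
    by (rule equilibrium_stress_weak[OF G eq])
  have "(\<Sum>e\<in>edges G. \<omega> e * (edge_diff G (($) z) e)\<^sup>2) \<ge> 0"
    using psd unfolding pos_semidef_laplacian_iff by blast
  then show "(\<Sum>e\<in>edges G. \<omega> e * (edge_diff G x e)\<^sup>2) \<ge> 0"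
    by (simp add: z cong: sum.cong_simp)
  assume "(\<Sum>e\<in>edges G. \<omega> e * (edge_diff G x e)\<^sup>2) = 0"
  then have "z \<bullet> (laplacian G \<omega> *v z) = 0"
    by (simp add: inner_laplacian z power2_eq_square mult.assoc cong: sum.cong_simp)
  then have "laplacian G \<omega> *v z = 0"
    by (rule pos_semidef_kernel[OF psd])
  then have "z \<in> laplacian_kernel G \<omega>"
    by (simp add: laplacian_kernel_def z_def)
  moreover have "range (aff_fun G p) = laplacian_kernel G \<omega>"
  proof (rule subspace_dim_equal)
    show "subspace (range (aff_fun G p))"
      by (rule linear_subspace_image[OF linear_aff_fun subspace_UNIV])
    show "subspace (laplacian_kernel G \<omega>)"
      by (auto simp: laplacian_kernel_def subspace_def mv.add_right mv.scaleR_right)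
  qed (use range_aff_fun_subset_kernel[OF G eq] dim_range_aff_fun[OF inj_aff_fun[OF G V conic]] dim in auto)
  ultimately have "\<exists>\<alpha> \<beta>. \<forall>a\<in>verts G. z $ a = \<alpha> \<bullet> p a + \<beta>"
    unfolding range_aff_fun by blast
  then show "\<exists>\<alpha> \<beta>. \<forall>a\<in>verts G. x a = \<alpha> \<bullet> p a + \<beta>"
    by (simp add: z_def)
qed

text \<open>A vector orthogonal to all differences of points is orthogonal to all edge directions,
  and these span.\<close>

lemma affine_hull_conic_free:
  fixes G :: "('v::finite, 'e) mgraph" and p :: "'v \<Rightarrow> real ^ 'd"
  assumes G: "multigraph G" and V: "verts G \<noteq> {}" and conic: "conic_free G (edges G) p"
  shows "affine hull (p ` verts G) = UNIV"
proof -
  obtain v0 where v0: "v0 \<in> verts G"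
    using V by blast
  let ?B = "{x - p v0 | x. x \<in> p ` verts G - {p v0}}"
  have "span ?B = UNIV"
  proof (rule ccontr)
    assume "span ?B \<noteq> UNIV"
    then obtain a where a: "a \<noteq> 0" "\<And>x. x \<in> span ?B \<Longrightarrow> a \<bullet> x = 0"
      using span_not_UNIV_orthogonal by blast
    have av: "a \<bullet> p v = a \<bullet> p v0" if "v \<in> verts G" for v
    proof (cases "p v = p v0")
      case False
      then have "p v - p v0 \<in> span ?B"
        using that by (intro span_base) blast
      then have "a \<bullet> (p v - p v0) = 0"
        by (rule a(2))
      then show ?thesis
        by (simp add: inner_diff_right)
    qed simp
    have "a = 0"
    proof (rule conic_imp_inner_0[where I = "edges G" and v = "edge_diff G p"])
      show "S = 0" if "transpose S = S" "\<And>e. e \<in> edges G \<Longrightarrow> edge_diff G p e \<bullet> (S *v edge_diff G p e) = 0" for S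
        using conic that unfolding conic_free_def by blast
      show "a \<bullet> edge_diff G p e = 0" if "e \<in> edges G" for e
        using ends_src_tgt[OF G that] av by (simp add: edge_diff_def inner_diff_right)
    qed
    then show False
      using a(1) by simp
  qed
  moreover have "affine hull (p ` verts G) = {p v0 + v | v. v \<in> span ?B}"
    using v0 by (intro affine_hull_span) auto
  ultimately show ?thesis
    by (auto intro: exI[of _ "_ - p v0"])
qed

lemma conic_free_iff:
  assumes G: "multigraph G"
  shows "conic_free G (edges G) p \<longleftrightarrow> (\<forall>S :: real ^ 'd ^ 'd. transpose S = S \<longrightarrow>
        (\<forall>e\<in>edges G. \<forall>i j. ends G e = {i, j} \<longrightarrow> (p j - p i) \<bullet> (S *v (p j - p i)) = 0) \<longrightarrow> S = 0)"
proof -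
  have "(\<forall>i j. ends G e = {i, j} \<longrightarrow> (p j - p i) \<bullet> (S *v (p j - p i)) = 0) \<longleftrightarrow> edge_diff G p e \<bullet> (S *v edge_diff G p e) = 0"
    if "e \<in> edges G" for e and S :: "real ^ 'd ^ 'd"
  proof -
    have "(p i - p j) \<bullet> (S *v (p i - p j)) = (p j - p i) \<bullet> (S *v (p j - p i))" for i j
      by (simp add: mv.diff_right inner_diff_left inner_diff_right)
    then show ?thesis
      using ends_src_tgt(1)[OF G that] by (auto simp: edge_diff_def doubleton_eq_iff)
  qed
  then show ?thesis
    unfolding conic_free_def by simp
qed

text \<open>For injective \<open>p\<close> the fibres are single vertices, so the quotient is
  \<open>G\<close> itself; the signs of the nonzero stress give \<sigma>.\<close>

lemma nonsplit_stress_super_stable: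
  fixes G :: "('v::finite, 'e) mgraph" and p :: "'v \<Rightarrow> real ^ 'd"
  assumes G: "multigraph G" and V: "verts G \<noteq> {}"
    and stress: "nonsplit_stress G (edges G) p \<omega>" and inj: "inj_on p (verts G)"
  shows "super_stable G (\<lambda>e. sgn (\<omega> e)) p"
proof -
  have conic: "conic_free G (edges G) p" and rank: "max_rank_stress G (edges G) p p \<omega>"
    and \<omega>0: "\<And>e. e \<in> edges G \<Longrightarrow> \<omega> e \<noteq> 0"
    using stress by (auto simp: nonsplit_stress_def)
  have fin: "finite (edges G)"
    using G by (simp add: multigraph_def)
  have rank_id: "max_rank_stress G (edges G) id p \<omega>"
    by (rule max_rank_stress_coarsen[OF rank]) (use inj in \<open>auto dest: inj_onD\<close>)
  have eq: "equilibrium_stress G p \<omega>"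
    unfolding equilibrium_stress_iff[OF G] incident_eq_cut[OF G]
  proof
    fix v
    show "force G p \<omega> {v} (cut G (edges G) {v}) = 0"
      by (rule force_cut[OF rank fin]) (use inj in \<open>auto dest: inj_onD\<close>)
  qed
  have psd: "pos_semidef (laplacian G \<omega>)"
    unfolding pos_semidef_laplacian_iff
    by (intro allI max_rank_stressD(2)[OF rank_id]) simp
  have "laplacian_kernel G \<omega> \<subseteq> range (aff_fun G p)"
  proof
    fix z assume z: "z \<in> laplacian_kernel G \<omega>"
    then have "z \<bullet> (laplacian G \<omega> *v z) = 0"
      by (simp add: laplacian_kernel_def)
    then have "(\<Sum>e\<in>edges G. \<omega> e * (edge_diff G (($) z) e)\<^sup>2) = 0"
      by (simp add: inner_laplacian power2_eq_square mult.assoc)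
    then have "\<exists>\<alpha> \<beta>. \<forall>a\<in>verts G. z $ a = \<alpha> \<bullet> p a + \<beta>"
      by (rule max_rank_stressD(3)[OF rank_id, rotated]) simp
    then show "z \<in> range (aff_fun G p)"
      using z unfolding range_aff_fun laplacian_kernel_def by blast
  qed
  then have "laplacian_kernel G \<omega> = range (aff_fun G p)"
    using range_aff_fun_subset_kernel[OF G eq] by blast
  then have "dim (laplacian_kernel G \<omega>) = CARD('d) + 1"
    by (simp add: dim_range_aff_fun[OF inj_aff_fun[OF G V conic]])
  moreover have "strictly_proper G (\<lambda>e. sgn (\<omega> e)) \<omega>"
    using \<omega>0 by (auto simp: strictly_proper_def zero_less_mult_iff neq_iff)
  moreover have "tensegrity G (\<lambda>e. sgn (\<omega> e)) p"
    using G \<omega>0 by (auto simp: tensegrity_def sgn_if)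
  ultimately show ?thesis
    unfolding super_stable_def
    using eq psd affine_hull_conic_free[OF G V conic] conic[unfolded conic_free_iff[OF G]] by blast
qed

section \<open>Combining the two stresses on the minor\<close>

text \<open>Since \<open>p\<close> is fixed, every combination of the stresses still annihilates the
  affine functions; on their complement positivity is open in \<open>t\<close>.\<close>

lemma max_rank_stress_perturb:
  fixes G :: "('v::finite, 'e) mgraph" and p :: "'v \<Rightarrow> real ^ 'd"
  assumes G: "multigraph G" and V: "verts G \<noteq> {}" and conic: "conic_free G (edges G) p"
    and rank: "max_rank_stress G (edges G) id p \<omega>0"
    and eq: "equilibrium_stress G p \<omega>0" "equilibrium_stress G p \<omega>1"
  shows "\<forall>\<^sub>F t in nhds 0. max_rank_stress G (edges G) id p (\<lambda>e. \<omega>0 e + t * \<omega>1 e)"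
proof -
  define P :: "real ^ 'd ^ 'v" where "P = (\<chi> v. if v \<in> verts G then p v else 0)"
  define u :: "real ^ 'v" where "u = (\<chi> v. if v \<in> verts G then 1 else 0)"
  define I where "I = edges G <+> - verts G"
  define A where "A i = (case i of Inl e \<Rightarrow> edge_vec G e | Inr v \<Rightarrow> axis v 1)" for i :: "'e + 'v"
  define w where "w t i = (case i of Inl e \<Rightarrow> \<omega>0 e + t * \<omega>1 e | Inr v \<Rightarrow> 1)" for t and i :: "'e + 'v"
  have fin: "finite (edges G)"
    using G by (simp add: multigraph_def)
  have split_sum: "(\<Sum>i\<in>I. f i) = (\<Sum>e\<in>edges G. f (Inl e)) + (\<Sum>v\<in>-verts G. f (Inr v))"
    for f :: "'e + 'v \<Rightarrow> 'z::comm_monoid_add"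
    unfolding I_def using fin by (subst sum.Plus) auto
  have A: "A (Inl e) = edge_vec G e" "A (Inr v) = axis v 1" and w: "w t (Inl e) = \<omega>0 e + t * \<omega>1 e" "w t (Inr v) = 1"
    for e v t
    by (simp_all add: A_def w_def)
  have aff: "affcomb P u \<alpha> \<beta> = aff_fun G p (\<alpha>, \<beta>)" for \<alpha> \<beta>
    by (simp add: affcomb_def aff_fun_def vec_eq_iff P_def u_def)
  have ed: "edge_diff G (($) P) e = edge_diff G p e" "edge_diff G (($) u) e = 0" if "e \<in> edges G" for e
    using ends_src_tgt[OF G that] by (simp_all add: edge_diff_def P_def u_def)
  have k0: "k = 0" if "k = affcomb P u \<alpha> \<beta>" "app P k = 0" "u \<bullet> k = 0" for k \<alpha> \<beta>
  proof -
    have "k \<bullet> k = \<alpha> \<bullet> app P k + \<beta> * (k \<bullet> u)"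
      using that(1) by (metis inner_affcomb)
    then show ?thesis
      using that by (simp add: inner_commute)
  qed
  let ?\<Psi> = "\<lambda>(t, z). (\<Sum>i\<in>I. w t i * (A i \<bullet> z)\<^sup>2) + (app P z \<bullet> app P z + (u \<bullet> z)\<^sup>2)"
  have "\<forall>\<^sub>F t in nhds 0. \<forall>z. z \<noteq> 0 \<longrightarrow> ?\<Psi> (t, z) > 0"
  proof (rule eventually_pos_homogeneous)
    show "continuous_on UNIV ?\<Psi>"
      unfolding split_beta split_sum A w by (intro continuous_intros)
    show "?\<Psi> (t, s *\<^sub>R z) = s\<^sup>2 * ?\<Psi> (t, z)" for t s z
      by (simp add: app.scaleR_right sum_distrib_left power2_eq_square algebra_simps)
    show "?\<Psi> (0, z) > 0" if "z \<noteq> 0" for z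
    proof -
      have q: "(\<Sum>i\<in>I. w 0 i * (A i \<bullet> z)\<^sup>2) = (\<Sum>e\<in>edges G. \<omega>0 e * (edge_diff G (($) z) e)\<^sup>2) + (\<Sum>v\<in>-verts G. (z $ v)\<^sup>2)"
        by (simp add: split_sum A w inner_edge_vec inner_axis')
      have nonneg: "(\<Sum>e\<in>edges G. \<omega>0 e * (edge_diff G (($) z) e)\<^sup>2) \<ge> 0" "(\<Sum>v\<in>-verts G. (z $ v)\<^sup>2) \<ge> 0"
          "app P z \<bullet> app P z \<ge> 0" "(u \<bullet> z)\<^sup>2 \<ge> 0"
        by (rule max_rank_stressD(2)[OF rank]) (auto intro: sum_nonneg)
      have "?\<Psi> (0, z) \<noteq> 0"
      proof
        assume "?\<Psi> (0, z) = 0"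
        then have 0: "(\<Sum>e\<in>edges G. \<omega>0 e * (edge_diff G (($) z) e)\<^sup>2) = 0" "(\<Sum>v\<in>-verts G. (z $ v)\<^sup>2) = 0"
            "app P z \<bullet> app P z = 0" "(u \<bullet> z)\<^sup>2 = 0"
          using nonneg unfolding prod.case q by linarith+
        have "\<exists>\<alpha> \<beta>. \<forall>a\<in>verts G. z $ a = \<alpha> \<bullet> p a + \<beta>"
          by (rule max_rank_stressD(3)[OF rank _ 0(1)]) simp
        moreover have "z $ v = 0" if "v \<notin> verts G" for v
          using 0(2) that by (subst (asm) sum_nonneg_eq_0_iff) auto
        ultimately have "z \<in> range (aff_fun G p)"
          unfolding range_aff_fun by blast
        then obtain \<alpha> \<beta> where "z = affcomb P u \<alpha> \<beta>"
          by (auto simp: aff)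
        then show False
          using k0 0(3,4) that by simp
      qed
      then show ?thesis
        using nonneg unfolding prod.case q by linarith
    qed
  qed
  then show ?thesis
  proof eventually_elim
    case (elim t)
    have weak: "(\<Sum>e\<in>edges G. ((\<omega>0 e + t * \<omega>1 e) * edge_diff G x e) *\<^sub>R edge_diff G p e) = 0" for x
    proof -
      have "(\<Sum>e\<in>edges G. ((\<omega>0 e + t * \<omega>1 e) * edge_diff G x e) *\<^sub>R edge_diff G p e)
          = (\<Sum>e\<in>edges G. (\<omega>0 e * edge_diff G x e) *\<^sub>R edge_diff G p e)
            + t *\<^sub>R (\<Sum>e\<in>edges G. (\<omega>1 e * edge_diff G x e) *\<^sub>R edge_diff G p e)"
        by (simp add: scaleR_sum_right sum.distrib[symmetric] algebra_simps)
      then show ?thesis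
        by (simp add: equilibrium_stress_weak[OF G] eq)
    qed
    have Au: "A i \<bullet> u = 0" if "i \<in> I" for i
      using that by (auto simp: I_def A inner_edge_vec ed(2) inner_axis') (simp add: u_def)
    have equil: "(\<Sum>i\<in>I. (w t i * (A i \<bullet> z)) *\<^sub>R app P (A i)) = 0" for z
    proof -
      have "(\<Sum>v\<in>-verts G. (w t (Inr v) * (A (Inr v) \<bullet> z)) *\<^sub>R app P (A (Inr v))) = 0"
        by (intro sum.neutral) (simp add: A P_def)
      then show ?thesis
        using weak[of "($) z"]
        by (simp add: split_sum) (simp add: A w inner_edge_vec app_edge_vec ed cong: sum.cong_simp)
    qed
    have nondeg: "\<alpha> = 0 \<and> \<beta> = 0" if "app P (affcomb P u \<alpha> \<beta>) = 0" "u \<bullet> affcomb P u \<alpha> \<beta> = 0" for \<alpha> \<beta>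
    proof -
      have "aff_fun G p (\<alpha>, \<beta>) = 0"
        using k0[OF refl that] by (simp add: aff)
      then have "(\<alpha>, \<beta>) = 0"
        using inj_aff_fun[OF G V conic] unfolding linear_injective_0[OF linear_aff_fun] by blast
      then show ?thesis
        by (simp add: zero_prod_def)
    qed
    have pos: "(\<Sum>i\<in>I. w t i * (A i \<bullet> z)\<^sup>2) > 0" if "z \<noteq> 0" "app P z = 0" "u \<bullet> z = 0" for z
      using elim[rule_format, OF that(1)] that(2,3) by simp
    note K = psd_of_kernel[of I A u "w t" P P, OF Au equil nondeg pos]
    show ?case
      unfolding max_rank_stress_def
    proof (intro allI impI conjI)
      fix x :: "'v \<Rightarrow> real"
      define z where "z = (\<chi> v. if v \<in> verts G then x v else 0)"
      have z: "edge_diff G (($) z) e = edge_diff G x e" if "e \<in> edges G" for e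
        using ends_src_tgt[OF G that] by (simp add: edge_diff_def z_def)
      have q: "(\<Sum>i\<in>I. w t i * (A i \<bullet> z)\<^sup>2) = (\<Sum>e\<in>edges G. (\<omega>0 e + t * \<omega>1 e) * (edge_diff G x e)\<^sup>2)"
      proof -
        have "(\<Sum>v\<in>-verts G. w t (Inr v) * (A (Inr v) \<bullet> z)\<^sup>2) = 0"
          by (intro sum.neutral) (simp add: A z_def inner_axis')
        then show ?thesis
          by (simp add: split_sum) (simp add: A w inner_edge_vec z cong: sum.cong_simp)
      qed
      show "(\<Sum>e\<in>edges G. ((\<omega>0 e + t * \<omega>1 e) * edge_diff G x e) *\<^sub>R edge_diff G p e) = 0"
        by (rule weak)
      show "(\<Sum>e\<in>edges G. (\<omega>0 e + t * \<omega>1 e) * (edge_diff G x e)\<^sup>2) \<ge> 0"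
        using K(1)[of z] unfolding q .
      assume "(\<Sum>e\<in>edges G. (\<omega>0 e + t * \<omega>1 e) * (edge_diff G x e)\<^sup>2) = 0"
      then obtain \<alpha> \<beta> where "z = aff_fun G p (\<alpha>, \<beta>)"
        using K(2)[of z] unfolding q aff by blast
      then have "\<forall>a\<in>verts G. z $ a = \<alpha> \<bullet> p a + \<beta>"
        by (simp add: aff_fun_def)
      then show "\<exists>\<alpha> \<beta>. \<forall>a\<in>verts G. x a = \<alpha> \<bullet> p a + \<beta>"
        by (auto simp: z_def)
    qed
  qed
qed

text \<open>The stress witnessing super stability and the non-splittable one may differ; all but finitely many
  small combinations of the two have both properties.\<close>

lemma super_stable_nonsplit_stress:
  fixes G :: "('v::finite, 'e) mgraph" and p :: "'v \<Rightarrow> real ^ 'd"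
  assumes G: "multigraph G" and V: "verts G \<noteq> {}"
    and stable: "super_stable G \<sigma> p" and inj: "inj_on p (verts G)"
    and eq1: "equilibrium_stress G p \<omega>1" and nonsplit: "non_splittable G p \<omega>1"
  shows "\<exists>\<omega>. nonsplit_stress G (edges G) p \<omega>"
proof -
  obtain \<omega>0 where eq0: "equilibrium_stress G p \<omega>0" and proper: "strictly_proper G \<sigma> \<omega>0"
    and psd: "pos_semidef (laplacian G \<omega>0)" and dim: "dim (laplacian_kernel G \<omega>0) = CARD('d) + 1"
    using stable unfolding super_stable_def by blast
  have conic: "conic_free G (edges G) p"
    using stable unfolding super_stable_def conic_free_iff[OF G] by blast
  have fin: "finite (edges G)"
    using G by (simp add: multigraph_def)
  define \<omega> where "\<omega> t e = \<omega>0 e + t * \<omega>1 e" for t e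
  have "\<forall>\<^sub>F t in nhds 0. max_rank_stress G (edges G) id p (\<omega> t)"
    unfolding \<omega>_def
    by (rule max_rank_stress_perturb[OF G V conic super_stable_max_rank_stress[OF G V conic eq0 psd dim] eq0 eq1])
  then have "\<forall>\<^sub>F t in at 0. max_rank_stress G (edges G) id p (\<omega> t)"
    by (simp add: eventually_at_filter eventually_mono)
  moreover have "\<forall>\<^sub>F t in at 0. \<forall>e\<in>edges G. \<omega> t e \<noteq> 0"
  proof (intro eventually_ball_finite ballI fin)
    fix e assume e: "e \<in> edges G"
    have "((\<lambda>t. \<omega>0 e + t * \<omega>1 e) \<longlongrightarrow> \<omega>0 e + 0 * \<omega>1 e) (at 0)"
      by (intro tendsto_intros)
    then show "\<forall>\<^sub>F t in at 0. \<omega> t e \<noteq> 0"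
      unfolding \<omega>_def by (rule tendsto_imp_eventually_ne) (use proper e in \<open>force simp: strictly_proper_def\<close>)
  qed
  moreover have "\<forall>\<^sub>F t in at 0. \<forall>v\<in>verts G. \<forall>F\<in>Pow (edges G). F \<noteq> {} \<longrightarrow> F \<subset> incident G v \<longrightarrow> force G p (\<omega> t) {v} F \<noteq> 0"
  proof (intro eventually_ball_finite ballI)
    fix v F assume v: "v \<in> verts G" and "F \<in> Pow (edges G)"
    show "\<forall>\<^sub>F t in at 0. F \<noteq> {} \<longrightarrow> F \<subset> incident G v \<longrightarrow> force G p (\<omega> t) {v} F \<noteq> 0"
    proof (cases "F \<noteq> {} \<and> F \<subset> incident G v")
      case True
      have "\<not> splittable_at G p \<omega>1 v"
        using nonsplit v by (simp add: non_splittable_def)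
      then have "(\<Sum>f\<in>F. \<omega>1 f *\<^sub>R (p (other_end G f v) - p v)) \<noteq> 0"
        using True unfolding splittable_at_def by blast
      moreover have "F \<subseteq> incident G v"
        using True by blast
      ultimately have B: "force G p \<omega>1 {v} F \<noteq> 0"
        by (simp add: force_vertex[OF G])
      \<comment> \<open>An affine function of \<open>t\<close> with nonzero slope has at most one
        zero; a zero at \<open>t = 0\<close> is excluded by the punctured neighbourhood.\<close>
      have lin: "force G p (\<omega> t) {v} F = force G p \<omega>0 {v} F + t *\<^sub>R force G p \<omega>1 {v} F" for t
        by (simp add: force_def \<omega>_def scaleR_sum_right sum.distrib[symmetric] algebra_simps)
      have "\<forall>\<^sub>F t in at 0. force G p (\<omega> t) {v} F \<noteq> 0"
      proof (cases "force G p \<omega>0 {v} F = 0")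
        case True
        then show ?thesis
          using B by (simp add: lin eventually_at_filter)
      next
        case False
        have "((\<lambda>t. force G p \<omega>0 {v} F + t *\<^sub>R force G p \<omega>1 {v} F) \<longlongrightarrow> force G p \<omega>0 {v} F + 0 *\<^sub>R force G p \<omega>1 {v} F) (at 0)"
          by (intro tendsto_intros)
        then show ?thesis
          unfolding lin by (rule tendsto_imp_eventually_ne) (use False in simp)
      qed
      then show ?thesis
        by eventually_elim simp
    qed auto
  qed (use fin in auto)
  ultimately have "\<forall>\<^sub>F t in at (0::real). max_rank_stress G (edges G) id p (\<omega> t) \<and> (\<forall>e\<in>edges G. \<omega> t e \<noteq> 0) \<and>
      (\<forall>v\<in>verts G. \<forall>F\<in>Pow (edges G). F \<noteq> {} \<longrightarrow> F \<subset> incident G v \<longrightarrow> force G p (\<omega> t) {v} F \<noteq> 0)"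
    (is "\<forall>\<^sub>F t in _. ?P t")
    by (intro eventually_conj)
  then have "\<exists>t. ?P t"
    by (rule eventually_happens'[OF at_neq_bot])
  then obtain t where t: "?P t"
    by (rule exE)
  have "nonsplit_stress G (edges G) p (\<omega> t)"
    unfolding nonsplit_stress_def
  proof (intro conjI ballI allI impI conic)
    show "max_rank_stress G (edges G) p p (\<omega> t)"
      by (rule max_rank_stress_coarsen[OF t[THEN conjunct1]]) simp
    show "\<omega> t e \<noteq> 0" if "e \<in> edges G" for e
      using t that by blast
    show "edge_diff G p e \<noteq> 0" if "e \<in> edges G" for e
      using ends_src_tgt(2-4)[OF G that] inj_onD[OF inj, of "src G e" "tgt G e"]
      by (auto simp: edge_diff_def)
    fix v F assume v: "v \<in> verts G" and F: "F \<noteq> {}" "F \<subset> cut G (edges G) (fibre G p v)"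
    have "fibre G p v = {v}"
      using v inj by (auto simp: fibre_def dest: inj_onD)
    moreover from this have "F \<subset> incident G v" "F \<in> Pow (edges G)"
      using F by (auto simp: incident_eq_cut[OF G] cut_def)
    ultimately show "force G p (\<omega> t) (fibre G p v) F \<noteq> 0"
      using t v F(1) by metis
  qed simp
  then show ?thesis
    by blast
qed

theorem theorem3p11:
  fixes G :: "('v::finite, 'e) mgraph" and H :: "('w::finite, 'f) mgraph"
  assumes "multigraph G" and "k_connected 2 G"
    and "multigraph H" and "k_connected 2 H"
    and "is_minor H G"
    and "\<exists>(\<sigma> :: 'f \<Rightarrow> real) (p :: 'w \<Rightarrow> real ^ 'd::finite).
           super_stable H \<sigma> p \<and> inj_on p (verts H) \<and>
           (\<exists>\<omega>. equilibrium_stress H p \<omega> \<and> non_splittable H p \<omega>)"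
  shows "\<exists>(\<sigma> :: 'e \<Rightarrow> real) (p :: 'v \<Rightarrow> real ^ 'd).
           super_stable G \<sigma> p \<and> inj_on p (verts G)"
proof -
  obtain \<sigma> and p :: "'w \<Rightarrow> real ^ 'd" and \<omega>1 where H: "super_stable H \<sigma> p" "inj_on p (verts H)"
      "equilibrium_stress H p \<omega>1" "non_splittable H p \<omega>1"
    using assms(6) by blast
  have V: "verts G \<noteq> {}" "verts H \<noteq> {}"
    using assms(2,4) by (auto simp: k_connected_def)
  obtain \<omega> where \<omega>: "nonsplit_stress H (edges H) p \<omega>"
    using super_stable_nonsplit_stress[OF assms(3) V(2) H] by blast
  show ?thesis
  proof (rule minor_branch_map[OF assms(1,2) V(2) assms(5)])
    fix E \<Phi> \<psi>
    assume E: "E \<subseteq> edges G" "\<Phi> ` verts G = verts H" "bij_betw \<psi> E (edges H)"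
        "\<And>e. e \<in> E \<Longrightarrow> ends H (\<psi> e) = \<Phi> ` ends G e"
      and conn: "\<And>a. a \<in> verts H \<Longrightarrow> connected_in G {x \<in> verts G. \<Phi> x = a}"
    have stress: "nonsplit_stress G E (\<lambda>v. p (\<Phi> v)) (\<lambda>e. \<omega> (\<psi> e))"
      by (rule nonsplit_stress_branch_map[OF assms(1,3) E \<omega> H(2)])
    have "connected_in G (fibre G (\<lambda>v. p (\<Phi> v)) v)" if "v \<in> verts G" for v
    proof -
      \<comment> \<open>Injectivity on \<open>H\<close> makes the fibres of the pulled-back
        positions exactly the branch sets.\<close>
      have "p (\<Phi> x) = p (\<Phi> v) \<longleftrightarrow> \<Phi> x = \<Phi> v" if "x \<in> verts G" for x
        using inj_on_eq_iff[OF H(2)] E(2) that \<open>v \<in> verts G\<close> by blast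
      then have "fibre G (\<lambda>v. p (\<Phi> v)) v = {x \<in> verts G. \<Phi> x = \<Phi> v}"
        by (auto simp: fibre_def)
      then show ?thesis
        using conn E(2) that by auto
    qed
    then obtain q :: "'v \<Rightarrow> real ^ 'd" and w where "nonsplit_stress G (edges G) q w" "inj_on q (verts G)"
      using injective_nonsplit_stress[OF assms(1,2) stress] by blast
    then show ?thesis
      using nonsplit_stress_super_stable[OF assms(1) V(1)] by blast
  qed
qed

end
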